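(* Let $\lambda\geq1$ and let $\varphi:\mathbf{RP}^1\to\mathbf{RP}^1$ be an orientation-preserving homeomorphism. The following are equivalent. (1) $\varphi$ is Weil–Petersson. (2) For every dyadic decomposition $\mathcal{D}$ of $\mathbf{RP}^1$, $$\sum_{I\in\mathcal{D}}\beta_\varphi(\lambda I)^2<\infty .$$
   Context: $\mathbf{RP}^1$ is identified with $\mathbf{R}/\pi\mathbf{Z}$ via $x\mapsto[\cos x:\sin x]$. Weil–Petersson: an orientation-preserving homeomorphism $\varphi:\mathbf{RP}^1\to\mathbf{RP}^1$ is Weil–Petersson if it has $L^1$ distributional derivative $\varphi'$ (i.e. it is absolutely continuous) and $\log(\varphi')\in H^{1/2}(\mathbf{RP}^1)$ (fractional Sobolev space). Dyadic decompositions: for a base point $x_0\in\mathbf{RP}^1$ and integers $m\geq0$, $0\leq k\leq 2^m-1$, let $I_{m,k}=x_0+[k\pi/2^m,(k+1)\pi/2^m]$ mod $\pi$. The $x_0$-based dyadic decomposition is $\mathcal{D}_{x_0}=\{I_{m,k}\mid m\geq0,\ 0\leq k\leq2^m-1\}$; a dyadic decomposition is any $\mathcal{D}_{x_0}$. $\ell(I)$ is the length of an interval $I$, and for $r\geq1$, $rI$ is the interval with the same centre as $I$ and length $r\,\ell(I)$. Beta numbers: let $\hat\varphi:\mathbf{R}\to\mathbf{R}$ be a lift of $\varphi$ (an increasing homeomorphism with $\hat\varphi(x+\pi)=\hat\varphi(x)+\pi$). For an interval $I$, lifted to $[a,b]\subset\mathbf{R}$, put $\ell(\varphi(I))=\hat\varphi(b)-\hat\varphi(a)$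 and $$\beta_\varphi(I)=\frac{1}{\ell(\varphi(I))}\inf_{A}\|\hat\varphi-A\|_{L^\infty([a,b])},$$ the infimum being over all linear (i.e. affine) functions $A(x)=\gamma x+\delta$, $\gamma,\delta\in\mathbf{R}$. Intervals $\lambda I$ of length exceeding $\pi$ are understood as intervals in the universal cover $\mathbf{R}$. *)

theory Defs
  imports "HOL-Analysis.Analysis" "HOL-Probability.Essential_Supremum"
begin

section \<open>The real projective line\<close>

text \<open>The point \<open>rp1_of x\<close> stands for \<open>[cos x : sin x]\<close>.\<close>

quotient_type rp1 = real / "\<lambda>x y. \<exists>k::int. y = x + of_int k * pi"
  morphisms rp1_rep rp1_of
proof (rule equivpI)
  show "reflp (\<lambda>x y. \<exists>k::int. y = x + of_int k * pi)"
    by (auto intro!: reflpI exI[of _ 0])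
  show "symp (\<lambda>x y. \<exists>k::int. y = x + of_int k * pi)"
    by (rule sympI, elim exE, rule_tac x = "- k" in exI) simp
  show "transp (\<lambda>x y. \<exists>k::int. y = x + of_int k * pi)"
    by (rule transpI, elim exE, rule_tac x = "k + ka" in exI) (simp add: algebra_simps)
qed

lemma rp1_of_eq_iff: "rp1_of x = rp1_of y \<longleftrightarrow> (\<exists>k::int. y = x + of_int k * pi)"
  by (rule rp1.abs_eq_iff)

lemma rp1_of_surj: "\<exists>x. rp1_of x = p"
  using Quotient3_abs_rep[OF Quotient3_rp1] by blast

instantiation rp1 :: metric_space
begin

definition dist_rp1_def:
  "dist p q = Inf {\<bar>x - y\<bar> | x y. rp1_of x = p \<and> rp1_of y = q}"

definition uniformity_rp1_def [code del]:
  "(uniformity :: (rp1 \<times> rp1) filter) = (INF e\<in>{0 <..}. principal {(x, y). dist x y < e})"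

definition open_rp1_def [code del]:
  "open (U :: rp1 set) \<longleftrightarrow> (\<forall>x\<in>U. eventually (\<lambda>(x', y). x' = x \<longrightarrow> y \<in> U) uniformity)"

instance
proof
  show "(uniformity :: (rp1 \<times> rp1) filter) = (INF e\<in>{0 <..}. principal {(x, y). dist x y < e})"
    by (rule uniformity_rp1_def)
  show "open (U :: rp1 set) \<longleftrightarrow> (\<forall>x\<in>U. eventually (\<lambda>(x', y). x' = x \<longrightarrow> y \<in> U) uniformity)" for U
    by (rule open_rp1_def)
  let ?S = "\<lambda>p q. {\<bar>x - y\<bar> | x y. rp1_of x = p \<and> rp1_of y = q}"
  have bdd: "bdd_below (?S p q)" for p q
    by (rule bdd_belowI[of _ 0]) auto
  have ne: "?S p q \<noteq> {}" for p q
    using rp1_of_surj[of p] rp1_of_surj[of q] by auto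
  have le: "dist (rp1_of x) (rp1_of y) \<le> \<bar>x - y\<bar>" for x y
    unfolding dist_rp1_def by (rule cInf_lower[OF _ bdd]) auto
  have approx: "\<exists>x y. rp1_of x = p \<and> rp1_of y = q \<and> \<bar>x - y\<bar> < dist p q + e" if "e > 0" for p q e
  proof -
    have "Inf (?S p q) < dist p q + e" using that by (simp add: dist_rp1_def)
    then show ?thesis using cInf_lessD[OF ne] by blast
  qed
  have nonneg: "0 \<le> dist p q" for p q :: rp1
    unfolding dist_rp1_def by (rule cInf_greatest[OF ne]) auto
  fix p q s :: rp1
  show "dist p q = 0 \<longleftrightarrow> p = q"
  proof
    assume "p = q"
    then obtain x where "rp1_of x = p" "rp1_of x = q" using rp1_of_surj by blast
    then show "dist p q = 0" using le[of x x] nonneg[of p q] by simp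
  next
    assume d0: "dist p q = 0"
    obtain x y where xy: "rp1_of x = p" "rp1_of y = q" using rp1_of_surj by blast
    show "p = q"
    proof (rule ccontr)
      assume neq: "p \<noteq> q"
      define f where "f = frac ((y - x) / pi)"
      define n where "n = \<lfloor>(y - x) / pi\<rfloor>"
      have f: "y - x = (of_int n + f) * pi" "0 \<le> f" "f < 1"
        by (simp_all add: f_def n_def frac_lt_1) (simp add: frac_def)
      have "f \<noteq> 0"
      proof
        assume "f = 0"
        then have "y = x + of_int n * pi" using f by simp
        then show False using neq xy rp1_of_eq_iff by blast
      qed
      with f have f0: "f > 0" by simp
      define e where "e = min f (1 - f) * pi"
      have e0: "e > 0" using f f0 by (simp add: e_def)
      obtain x' y' where x'y': "rp1_of x' = p" "rp1_of y' = q" "\<bar>x' - y'\<bar> < e"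
        using approx[OF e0, of p q] d0 by auto
      obtain i :: int where i: "x' = x + of_int i * pi" using rp1_of_eq_iff[of x x'] xy x'y' by auto
      obtain j :: int where j: "y' = y + of_int j * pi" using rp1_of_eq_iff[of y y'] xy x'y' by auto
      define l where "l = n + j - i"
      have "y' - x' = (of_int l + f) * pi"
        using f(1) i j by (simp add: l_def algebra_simps)
      then have "\<bar>x' - y'\<bar> = \<bar>of_int l + f\<bar> * pi"
        using abs_mult[of "of_int l + f" pi] by (simp add: abs_minus_commute[of x' y'])
      with x'y'(3) have lt: "\<bar>of_int l + f\<bar> < min f (1 - f)"
        by (simp add: e_def)
      show False
      proof (cases "l \<ge> 0")
        case True
        then have "real_of_int l \<ge> 0" by simp
        with lt f0 show False by linarith
      next
        case False
        then have "real_of_int l \<le> -1" by linarith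
        with lt f show False by linarith
      qed
    qed
  qed
  show "dist p q \<le> dist p s + dist q s"
  proof (rule field_le_epsilon)
    fix e :: real assume "e > 0"
    then have e: "e / 2 > 0" by simp
    obtain x y where 1: "rp1_of x = p" "rp1_of y = s" "\<bar>x - y\<bar> < dist p s + e / 2"
      using approx[OF e] by blast
    obtain x' y' where 2: "rp1_of x' = q" "rp1_of y' = s" "\<bar>x' - y'\<bar> < dist q s + e / 2"
      using approx[OF e] by blast
    obtain k :: int where k: "y = y' + of_int k * pi" using rp1_of_eq_iff[of y' y] 1 2 by auto
    have "rp1_of (x' + of_int k * pi) = q" using rp1_of_eq_iff[of x' "x' + of_int k * pi"] 2 by auto
    then have "dist p q \<le> \<bar>x - (x' + of_int k * pi)\<bar>" using le[of x "x' + of_int k * pi"] 1 by simp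
    also have "\<dots> \<le> \<bar>x - y\<bar> + \<bar>x' - y'\<bar>" using k by linarith
    finally show "dist p q \<le> dist p s + dist q s + e" using 1 2 by linarith
  qed
qed

end

lemma dist_rp1_of_le: "dist (rp1_of x) (rp1_of y) \<le> \<bar>x - y\<bar>"
  unfolding dist_rp1_def by (rule cInf_lower) (auto intro: bdd_belowI[of _ 0])

lemma continuous_on_rp1_of: "continuous_on A rp1_of"
  unfolding continuous_on_iff dist_real_def
  by (auto intro: le_less_trans[OF dist_rp1_of_le])

text \<open>The measure on \<open>\<real>/\<pi>\<int>\<close> induced by Lebesgue measure, of total mass \<open>\<pi>\<close>.\<close>

definition rp1_measure :: "rp1 measure" where
  "rp1_measure = distr (restrict_space lborel {0..<pi}) borel rp1_of"


section \<open>Orientation-preserving homeomorphisms and their lifts\<close>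

definition is_lift :: "(rp1 \<Rightarrow> rp1) \<Rightarrow> (real \<Rightarrow> real) \<Rightarrow> bool" where
  "is_lift \<phi> F \<longleftrightarrow>
     strict_mono F \<and> (\<exists>G. homeomorphism UNIV UNIV F G) \<and>
     (\<forall>x. F (x + pi) = F x + pi) \<and>
     (\<forall>x. \<phi> (rp1_of x) = rp1_of (F x))"

definition orientation_preserving_homeo :: "(rp1 \<Rightarrow> rp1) \<Rightarrow> bool" where
  "orientation_preserving_homeo \<phi> \<longleftrightarrow>
     (\<exists>\<psi>. homeomorphism UNIV UNIV \<phi> \<psi>) \<and> (\<exists>F. is_lift \<phi> F)"

text \<open>Lifts are unique up to an additive constant in \<open>\<pi>\<int>\<close> (\<open>is_lift_unique\<close> below).\<close>

definition the_lift :: "(rp1 \<Rightarrow> rp1) \<Rightarrow> real \<Rightarrow> real" where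
  "the_lift \<phi> = (SOME F. is_lift \<phi> F)"


section \<open>Weil--Petersson homeomorphisms\<close>

definition test_function :: "(real \<Rightarrow> real) \<Rightarrow> bool" where
  "test_function \<psi> \<longleftrightarrow>
     (\<forall>n x. (deriv ^^ n) \<psi> field_differentiable at x) \<and> compact (closure {x. \<psi> x \<noteq> 0})"

definition locally_integrable :: "(real \<Rightarrow> real) \<Rightarrow> bool" where
  "locally_integrable f \<longleftrightarrow> (\<forall>a b. set_integrable lborel {a..b} f)"

definition has_distributional_derivative :: "(real \<Rightarrow> real) \<Rightarrow> (real \<Rightarrow> real) \<Rightarrow> bool" where
  "has_distributional_derivative f g \<longleftrightarrow>
     locally_integrable f \<and> locally_integrable g \<and>
     (\<forall>\<psi>. test_function \<psi> \<longrightarrow>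
        (LINT x|lborel. f x * deriv \<psi> x) = - (LINT x|lborel. g x * \<psi> x))"

text \<open>The Sobolev space \<open>H\<^sup>s\<close>, \<open>s = 1/2\<close>, in dimension \<open>n = 1\<close>, through the Gagliardo seminorm;
  the exponent of the distance is \<open>n + 2 s = 2\<close>. The diagonal is a null set.\<close>

definition H_half :: "(rp1 \<Rightarrow> real) set" where
  "H_half = {u. u \<in> borel_measurable rp1_measure \<and>
     integrable rp1_measure (\<lambda>p. (u p)\<^sup>2) \<and>
     (\<integral>\<^sup>+ p. (\<integral>\<^sup>+ q. ennreal ((u p - u q)\<^sup>2 / (dist p q)\<^sup>2) \<partial>rp1_measure) \<partial>rp1_measure) < \<infinity>}"

text \<open>The derivative \<open>\<phi>'\<close> is the function \<open>g\<close> on \<open>\<real>/\<pi>\<int>\<close> whose pullback is the derivative of the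
  lift. Its logarithm is meaningful only if \<open>g > 0\<close> almost everywhere, which has to be required
  because \<^const>\<open>ln\<close> is a total function.\<close>

definition weil_petersson :: "(rp1 \<Rightarrow> rp1) \<Rightarrow> bool" where
  "weil_petersson \<phi> \<longleftrightarrow>
     orientation_preserving_homeo \<phi> \<and>
     (\<exists>g. integrable rp1_measure g \<and>
          has_distributional_derivative (the_lift \<phi>) (\<lambda>x. g (rp1_of x)) \<and>
          (AE p in rp1_measure. g p > 0) \<and>
          (\<lambda>p. ln (g p)) \<in> H_half)"


section \<open>Dyadic decompositions and beta numbers\<close>

text \<open>An interval is represented by the pair of endpoints of a lift to \<open>\<real>\<close>. The real \<open>x0\<close> is a
  representative of the base point; another representative shifts all intervals by the same
  multiple of \<open>\<pi>\<close>.\<close>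

definition dyadic_decomposition :: "real \<Rightarrow> (real \<times> real) set" where
  "dyadic_decomposition x0 =
     {(x0 + real k * pi / 2 ^ m, x0 + real (k + 1) * pi / 2 ^ m) | m k :: nat. k \<le> 2 ^ m - 1}"

definition dilate :: "real \<Rightarrow> real \<times> real \<Rightarrow> real \<times> real" where
  "dilate r = (\<lambda>(a, b). ((a + b) / 2 - r * (b - a) / 2, (a + b) / 2 + r * (b - a) / 2))"

definition Linf_norm :: "real \<Rightarrow> real \<Rightarrow> (real \<Rightarrow> real) \<Rightarrow> real" where
  "Linf_norm a b f = real_of_ereal (esssup (lebesgue_on {a..b}) (\<lambda>x. ereal \<bar>f x\<bar>))"

definition beta_lift :: "(real \<Rightarrow> real) \<Rightarrow> real \<times> real \<Rightarrow> real" where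
  "beta_lift F = (\<lambda>(a, b).
     (INF (c, d) \<in> UNIV. Linf_norm a b (\<lambda>x. F x - (c * x + d))) / (F b - F a))"

definition beta :: "(rp1 \<Rightarrow> rp1) \<Rightarrow> real \<times> real \<Rightarrow> real" where
  "beta \<phi> = beta_lift (the_lift \<phi>)"


section \<open>Independence of the choice of the lift\<close>

lemma is_lift_unique:
  assumes "is_lift \<phi> F" "is_lift \<phi> G"
  shows "\<exists>k::int. \<forall>x. G x = F x + of_int k * pi"
proof -
  have cont: "continuous_on UNIV F" "continuous_on UNIV G"
    using assms by (auto simp: is_lift_def homeomorphism_def)
  have "\<exists>k::int. G x = F x + of_int k * pi" for x
    using assms by (auto simp: is_lift_def rp1_of_eq_iff dest!: spec[of _ x])
  then obtain k :: "real \<Rightarrow> int" where k: "\<And>x. G x = F x + of_int (k x) * pi" by metis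
  have k': "real_of_int (k x) = (G x - F x) / pi" for x
    using k[of x] by (simp add: field_simps)
  have "(\<lambda>x. real_of_int (k x)) constant_on UNIV"
  proof (rule continuous_discrete_range_constant)
    show "continuous_on UNIV (\<lambda>x. real_of_int (k x))"
      unfolding k' by (intro continuous_intros cont) auto
    fix x :: real
    have "1 \<le> norm (real_of_int (k y) - real_of_int (k x))"
      if "real_of_int (k y) \<noteq> real_of_int (k x)" for y
    proof -
      have "1 \<le> \<bar>k y - k x\<bar>" using that by auto
      then show ?thesis unfolding real_norm_def by linarith
    qed
    then show "\<exists>e>0. \<forall>y. y \<in> UNIV \<and> real_of_int (k y) \<noteq> real_of_int (k x) \<longrightarrow>
                 e \<le> norm (real_of_int (k y) - real_of_int (k x))"
      by (intro exI[of _ 1]) auto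
  qed auto
  then obtain c where "\<And>x. real_of_int (k x) = c" by (auto simp: constant_on_def)
  then have "k x = k 0" for x by (metis of_int_eq_iff)
  then show ?thesis using k by metis
qed

lemma beta_lift_add_const: "beta_lift (\<lambda>x. F x + t) = beta_lift F"
proof -
  have "range (\<lambda>(c, d). Linf_norm a b (\<lambda>x. F x + t - (c * x + d))) =
        range (\<lambda>(c, d). Linf_norm a b (\<lambda>x. F x - (c * x + d)))" (is "range ?f = range ?g") for a b
  proof -
    have "?f (c, d) = ?g (c, d - t)" for c d
      by (simp add: algebra_simps)
    then have "?f = ?g \<circ> (\<lambda>(c, d). (c, d - t))" by auto
    moreover have "surj (\<lambda>(c :: real, d). (c :: real, d - t))"
      by (rule surjI[of _ "\<lambda>(c, d). (c, d + t)"]) auto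
    ultimately show ?thesis by (simp only: image_comp[symmetric])
  qed
  then show ?thesis by (simp add: beta_lift_def fun_eq_iff)
qed

lemma beta_eq_beta_lift:
  assumes "is_lift \<phi> F"
  shows "beta \<phi> = beta_lift F"
proof -
  have "is_lift \<phi> (the_lift \<phi>)"
    unfolding the_lift_def by (rule someI[of "is_lift \<phi>", OF assms])
  from is_lift_unique[OF assms this] obtain k :: int
    where "the_lift \<phi> = (\<lambda>x. F x + of_int k * pi)" by blast
  then show ?thesis by (simp add: beta_def beta_lift_add_const)
qed

end

theory Submission
  imports Defs
begin

text \<open>Write \<open>F\<close> for a lift of \<open>\<phi>\<close> and \<open>u\<close> for the logarithm of its density. Both implications go through
averages over dyadic intervals, and the square summable quantities that link \<open>u\<close> to the beta
numbers are differences between an interval and its two halves.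

Suppose first that \<open>u\<close> has finite energy. On an interval \<open>J\<close> with mean value \<open>c\<close> of \<open>u\<close>, the affine
function of slope \<open>e\<^sup>c\<close> through the left end of the graph differs from \<open>F\<close> by at most the integral of
\<open>\<bar>e\<^sup>u - e\<^sup>c\<bar>\<close>, while \<open>F\<close> increases by at least \<open>e\<^sup>c \<ell>(J)\<close> by Jensen's inequality. By Cauchy--Schwarz the
square of the beta number is at most the mean square oscillation of \<open>u\<close> on \<open>J\<close> times the mean of
\<open>(1 + e\<^sup>u\<^sup>-\<^sup>c)\<^sup>2\<close> (\<open>beta_sq_le_osc\<close>). The second factor is bounded uniformly in \<open>J\<close> by a
martingale argument: halving \<open>J\<close> repeatedly, the means of \<open>u\<close> form a dyadic martingale with
differences \<open>d\<close>, each step multiplies the mean of its exponential by at most \<open>max cosh (2 d)\<close>, and the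
sum of \<open>d\<^sup>2\<close> over all dyadic subintervals is controlled by the energy (\<open>exp_moment_le\<close>). The first
factor is summable over all dilated dyadic intervals because a pair \<open>x, y\<close> lies in boundedly many
of them at each scale above \<open>\<bar>x - y\<bar>\<close>, and the weights form a geometric series (\<open>osc_sum_le\<close>).

Conversely, suppose that the beta numbers are square summable for a dyadic system. They control
the relative difference \<open>skew\<close> between the increments of \<open>F\<close> on the two halves of an interval
(\<open>bisection_defect_le_beta\<close>), so the squares of \<open>skew\<close> are summable. Let \<open>l\<^sub>n\<close> be the logarithm of
the slope of \<open>F\<close> on the intervals of generation \<open>n\<close>. Passing from \<open>l\<^sub>n\<close> to \<open>l\<^sub>n\<^sub>+\<^sub>1\<close> changes it by
\<open>ln (1 \<plusminus> skew)\<close>, so that the sum of \<open>2\<^sup>n \<parallel>l\<^sub>n\<^sub>+\<^sub>1 - l\<^sub>n\<parallel>\<^sup>2\<close> is finite. An elementary inequality for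
sequences (\<open>weighted_tail_sum_le\<close>) turns this into convergence of \<open>l\<^sub>n\<close> to a limit \<open>u\<close> almost
everywhere and finiteness of the sum of \<open>2\<^sup>n \<parallel>u - l\<^sub>n\<parallel>\<^sup>2\<close>; the slopes converge with a common integrable
majorant, so \<open>e\<^sup>u\<close> is the density of \<open>F\<close> (\<open>log_density_log_deriv\<close>).

One dyadic system does not see differences across its endpoints, but the systems based at \<open>0\<close> and
\<open>\<pi>/3\<close> together do: points at distance less than \<open>\<pi> / (3 \<cdot> 2\<^sup>n)\<close> share an interval of generation \<open>n\<close>
in one of the two (\<open>same_grid_cell\<close>). On such an interval \<open>l\<^sub>n\<close> is constant, so the integral of
\<open>(u(x) - u(x + t))\<^sup>2\<close> over \<open>x\<close> is at most a multiple of the two errors \<open>\<parallel>u - l\<^sub>n\<parallel>\<^sup>2\<close>, and integrating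
against \<open>t\<^sup>-\<^sup>2\<close> gives the energy (\<open>circle_energy_finite\<close>).\<close>

section \<open>The circle as a quotient of the line\<close>

lemma rp1_of_shift: "rp1_of (x + of_int k * pi) = rp1_of x"
  by (metis rp1_of_eq_iff)

lemma rp1_of_add_pi [simp]: "rp1_of (x + pi) = rp1_of x"
  using rp1_of_shift[of x 1] by simp

lemma rp1_of_inj_period:
  assumes "x \<in> {0..<pi}" "y \<in> {0..<pi}" "rp1_of x = rp1_of y"
  shows "x = y"
proof -
  from assms(3) obtain k :: int where k: "y = x + of_int k * pi" by (auto simp: rp1_of_eq_iff)
  have "of_int k * pi < 1 * pi" "(-1) * pi < of_int k * pi"
    using assms(1,2) unfolding k atLeastLessThan_iff by linarith+
  then have "real_of_int k < 1" "-1 < real_of_int k" by (simp_all only: mult_less_cancel_right_pos[OF pi_gt_zero])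
  then have "k = 0" by linarith
  with k show ?thesis by simp
qed

lemma rp1_of_surj_period: "\<exists>x\<in>{0..<pi}. rp1_of x = p"
proof -
  obtain y where y: "rp1_of y = p" using rp1_of_surj by blast
  define x where "x = y + of_int (- \<lfloor>y / pi\<rfloor>) * pi"
  have "x = frac (y / pi) * pi" by (simp add: x_def frac_def algebra_simps)
  then have "x \<in> {0..<pi}" using frac_lt_1[of "y / pi"] by simp
  moreover have "rp1_of x = p" unfolding x_def rp1_of_shift y ..
  ultimately show ?thesis by blast
qed

text \<open>The inverse of \<open>rp1_of\<close> on a fundamental domain. It is Borel, which transports measurability
questions on the circle, including joint ones, to the line.\<close>

definition rp1_coord :: "rp1 \<Rightarrow> real" where
  "rp1_coord p = (SOME x. x \<in> {0..<pi} \<and> rp1_of x = p)"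

lemma rp1_coord: "rp1_coord p \<in> {0..<pi}" "rp1_of (rp1_coord p) = p"
proof -
  have "\<exists>x. x \<in> {0..<pi} \<and> rp1_of x = p" using rp1_of_surj_period[of p] by blast
  from someI_ex[OF this] show "rp1_coord p \<in> {0..<pi}" "rp1_of (rp1_coord p) = p"
    unfolding rp1_coord_def by blast+
qed

lemma measurable_rp1_of [measurable]: "rp1_of \<in> borel_measurable borel"
  by (rule borel_measurable_continuous_onI[OF continuous_on_rp1_of])

text \<open>For a level below \<open>\<pi>\<close>, the sublevel set is the image of a compact interval under \<open>rp1_of\<close>, hence closed.\<close>

lemma measurable_rp1_coord [measurable]: "rp1_coord \<in> borel_measurable borel"
proof (rule borel_measurableI_le)
  fix a :: real
  have "closed {p. rp1_coord p \<le> a}"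
  proof (cases "a < pi")
    case True
    have "{p. rp1_coord p \<le> a} = rp1_of ` {0..a}"
    proof safe
      fix p assume "rp1_coord p \<le> a"
      then show "p \<in> rp1_of ` {0..a}" using rp1_coord[of p] by (intro image_eqI[of _ _ "rp1_coord p"]) auto
    next
      fix x assume "x \<in> {0..a}"
      then have "rp1_coord (rp1_of x) = x"
        using True by (intro rp1_of_inj_period rp1_coord) auto
      then show "rp1_coord (rp1_of x) \<le> a" using \<open>x \<in> {0..a}\<close> by simp
    qed
    then show ?thesis
      by (simp add: compact_imp_closed compact_continuous_image continuous_on_rp1_of)
  next
    case False
    then have "{p. rp1_coord p \<le> a} = UNIV" using rp1_coord(1) by (force intro: less_imp_le less_le_trans)
    then show ?thesis by simp
  qed
  then show "{x \<in> space borel. rp1_coord x \<le> a} \<in> sets borel" by simp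
qed

lemma sets_rp1_measure [measurable_cong, simp]: "sets rp1_measure = sets borel"
  by (simp add: rp1_measure_def)

lemma space_rp1_measure [simp]: "space rp1_measure = UNIV"
  by (simp add: rp1_measure_def)

lemma nn_integral_rp1:
  assumes [measurable]: "f \<in> borel_measurable borel"
  shows "(\<integral>\<^sup>+p. f p \<partial>rp1_measure) = (\<integral>\<^sup>+x\<in>{0..<pi}. f (rp1_of x) \<partial>lborel)"
  unfolding rp1_measure_def
  by (subst nn_integral_distr)
     (auto simp: nn_integral_restrict_space intro!: measurable_restrict_space1)

lemma integrable_rp1_iff:
  fixes f :: "rp1 \<Rightarrow> real"
  assumes [measurable]: "f \<in> borel_measurable borel"
  shows "integrable rp1_measure f \<longleftrightarrow> set_integrable lborel {0..<pi} (\<lambda>x. f (rp1_of x))"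
  unfolding rp1_measure_def
  by (subst integrable_distr_eq)
     (auto simp: integrable_restrict_space set_integrable_def intro!: measurable_restrict_space1)

lemma AE_rp1_iff:
  assumes "{p. P p} \<in> sets borel"
  shows "(AE p in rp1_measure. P p) \<longleftrightarrow> (AE x in lborel. x \<in> {0..<pi} \<longrightarrow> P (rp1_of x))"
  unfolding rp1_measure_def using assms
  by (subst AE_distr_iff) (auto simp: AE_restrict_space_iff intro!: measurable_restrict_space1)

definition circle_dist :: "real \<Rightarrow> real \<Rightarrow> real" where
  "circle_dist x y = dist (rp1_of x) (rp1_of y)"

lemma circle_dist_le: "circle_dist x y \<le> \<bar>x - y\<bar>"
  by (simp add: circle_dist_def dist_rp1_of_le)

lemma circle_dist_nonneg [simp]: "0 \<le> circle_dist x y"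
  by (simp add: circle_dist_def)

lemma circle_dist_add_pi [simp]:
  "circle_dist (x + pi) y = circle_dist x y" "circle_dist x (y + pi) = circle_dist x y"
  by (simp_all add: circle_dist_def)

text \<open>Any other pair of representatives has its difference moved by a nonzero multiple of \<open>\<pi>\<close>, so it is
at least \<open>\<pi>/2\<close> apart.\<close>

lemma circle_dist_eq:
  assumes "\<bar>x - y\<bar> \<le> pi / 2"
  shows "circle_dist x y = \<bar>x - y\<bar>"
proof (rule antisym[OF circle_dist_le])
  have "\<bar>x - y\<bar> \<le> \<bar>x' - y'\<bar>" if e: "rp1_of x' = rp1_of x" "rp1_of y' = rp1_of y" for x' y'
  proof -
    obtain i :: int where i: "x' = x + of_int i * pi" using e(1) rp1_of_eq_iff[of x x'] by auto
    obtain j :: int where j: "y' = y + of_int j * pi" using e(2) rp1_of_eq_iff[of y y'] by auto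
    have eq: "x' - y' = (x - y) + of_int (i - j) * pi" using i j by (simp add: algebra_simps)
    show ?thesis
    proof (cases "i = j")
      case True then show ?thesis using eq by simp
    next
      case False
      then have "1 \<le> \<bar>real_of_int (i - j)\<bar>" by linarith
      then have "pi \<le> \<bar>of_int (i - j) * pi\<bar>"
        by (simp add: abs_mult) 
      then show ?thesis using eq assms by linarith
    qed
  qed
  then show "\<bar>x - y\<bar> \<le> circle_dist x y"
    unfolding circle_dist_def dist_rp1_def
    by (intro cInf_greatest) auto
qed

lemma circle_dist_measurable [measurable]:
  "(\<lambda>z. circle_dist (fst z) (snd z)) \<in> borel_measurable (borel \<Otimes>\<^sub>M borel)"
proof -
  have "continuous_on UNIV (\<lambda>z. circle_dist (fst z) (snd z))"
    unfolding circle_dist_def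
    by (intro continuous_on_dist continuous_on_compose2[OF continuous_on_rp1_of[of UNIV]] continuous_intros) auto
  then show ?thesis unfolding borel_prod by (rule borel_measurable_continuous_onI)
qed

text \<open>On the diagonal the quotient is \<open>0 / 0 = 0\<close>.\<close>

definition gagliardo :: "(real \<Rightarrow> real) \<Rightarrow> real \<Rightarrow> real \<Rightarrow> ennreal" where
  "gagliardo U x y = ennreal ((U x - U y)\<^sup>2 / (circle_dist x y)\<^sup>2)"

lemma gagliardo_measurable [measurable]:
  assumes [measurable]: "U \<in> borel_measurable borel" "f \<in> borel_measurable M" "g \<in> borel_measurable M"
  shows "(\<lambda>x. gagliardo U (f x) (g x)) \<in> borel_measurable M"
proof -
  have "(\<lambda>x. circle_dist (fst (f x, g x)) (snd (f x, g x))) \<in> borel_measurable M"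
    by (rule measurable_compose[OF _ circle_dist_measurable]) measurable
  then have [measurable]: "(\<lambda>x. circle_dist (f x) (g x)) \<in> borel_measurable M" by simp
  show ?thesis unfolding gagliardo_def by measurable
qed

definition circle_energy :: "(real \<Rightarrow> real) \<Rightarrow> ennreal" where
  "circle_energy U = (\<integral>\<^sup>+x\<in>{0..<pi}. (\<integral>\<^sup>+y\<in>{0..<pi}. gagliardo U x y \<partial>lborel) \<partial>lborel)"

text \<open>The distance of two points only depends on their coordinates, so both integrals over the circle
become integrals over a fundamental domain.\<close>

lemma H_half_iff:
  "u \<in> H_half \<longleftrightarrow> u \<in> borel_measurable borel \<and>
     (\<integral>\<^sup>+x\<in>{0..<pi}. ennreal ((u (rp1_of x))\<^sup>2) \<partial>lborel) < \<infinity> \<and>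
     circle_energy (\<lambda>x. u (rp1_of x)) < \<infinity>"
proof (cases "u \<in> borel_measurable borel")
  case True
  note [measurable] = this
  have um: "u \<in> borel_measurable rp1_measure" by measurable
  let ?U = "\<lambda>x. u (rp1_of x)"
  have k: "ennreal ((u p - u q)\<^sup>2 / (dist p q)\<^sup>2) = gagliardo ?U (rp1_coord p) (rp1_coord q)" for p q
    by (simp add: gagliardo_def circle_dist_def rp1_coord)
  have g: "gagliardo ?U x y = gagliardo ?U x' y'" if "rp1_of x = rp1_of x'" "rp1_of y = rp1_of y'" for x y x' y'
    using that by (simp add: gagliardo_def circle_dist_def)
  have Um [measurable]: "?U \<in> borel_measurable borel" by measurable
  have inner: "(\<integral>\<^sup>+q. ennreal ((u p - u q)\<^sup>2 / (dist p q)\<^sup>2) \<partial>rp1_measure)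
      = (\<integral>\<^sup>+y\<in>{0..<pi}. gagliardo ?U (rp1_coord p) y \<partial>lborel)" for p
    unfolding k
    apply (subst nn_integral_rp1, measurable)
    apply (intro nn_integral_cong arg_cong2[where f="(*)"] g refl)
    apply (simp add: rp1_coord)
    done
  have 1: "(\<integral>\<^sup>+ p. (\<integral>\<^sup>+ q. ennreal ((u p - u q)\<^sup>2 / (dist p q)\<^sup>2) \<partial>rp1_measure) \<partial>rp1_measure)
    = circle_energy ?U"
    unfolding inner circle_energy_def
    apply (subst nn_integral_rp1, measurable)
    apply (intro nn_integral_cong arg_cong2[where f="(*)"] g refl)
    apply (simp add: rp1_coord)
    done
  have 2: "integrable rp1_measure (\<lambda>p. (u p)\<^sup>2) \<longleftrightarrow> (\<integral>\<^sup>+x\<in>{0..<pi}. ennreal ((?U x)\<^sup>2) \<partial>lborel) < \<infinity>"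
    by (simp add: integrable_iff_bounded nn_integral_rp1)
  show ?thesis unfolding H_half_def using True um by (simp only: mem_Collect_eq 1 2 simp_thms)
next
  case False
  then show ?thesis by (simp add: H_half_def measurable_cong_sets[OF sets_rp1_measure refl])
qed

section \<open>Integrals of periodic functions\<close>

lemma nn_integral_shift_Ico:
  assumes [measurable]: "f \<in> borel_measurable borel"
  shows "(\<integral>\<^sup>+x\<in>{a + t..<b + t}. f x \<partial>lborel) = (\<integral>\<^sup>+x\<in>{a..<b::real}. f (x + t) \<partial>lborel)"
  by (subst nn_integral_real_affine[where c=1 and t=t])
     (auto intro!: nn_integral_cong simp: indicator_def add.commute)

lemma nn_integral_split_Ico:
  assumes [measurable]: "f \<in> borel_measurable borel" and "a \<le> b" "b \<le> (c::real)"
  shows "(\<integral>\<^sup>+x\<in>{a..<c}. f x \<partial>lborel) = (\<integral>\<^sup>+x\<in>{a..<b}. f x \<partial>lborel) + (\<integral>\<^sup>+x\<in>{b..<c}. f x \<partial>lborel)"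
proof -
  have "(\<integral>\<^sup>+x\<in>{a..<c}. f x \<partial>lborel) = (\<integral>\<^sup>+x. f x * indicator {a..<b} x + f x * indicator {b..<c} x \<partial>lborel)"
    using assms by (intro nn_integral_cong) (auto simp: indicator_def)
  also have "\<dots> = (\<integral>\<^sup>+x\<in>{a..<b}. f x \<partial>lborel) + (\<integral>\<^sup>+x\<in>{b..<c}. f x \<partial>lborel)"
    by (rule nn_integral_add) measurable
  finally show ?thesis .
qed

lemma periodic_shift_int:
  fixes f :: "real \<Rightarrow> 'a"
  assumes "\<And>x. f (x + p) = f x"
  shows "f (x + of_int k * p) = f x"
proof -
  have nat: "f (x + of_nat n * p) = f x" for n x
    by (induction n arbitrary: x) (use assms in \<open>auto simp: algebra_simps\<close>, metis add.assoc add.commute)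
  show ?thesis
  proof (cases "k \<ge> 0")
    case True then show ?thesis using nat[of x "nat k"] by simp
  next
    case False
    then have "f (x + of_int k * p) = f (x + of_int k * p + of_nat (nat (- k)) * p)" by (simp only: nat)
    then show ?thesis using False by (simp add: algebra_simps)
  qed
qed

text \<open>The multiple of \<open>\<pi>\<close> inside the window cuts it into two pieces that, after moving one of them by a
period, form a fundamental domain.\<close>

lemma nn_integral_period:
  assumes [measurable]: "f \<in> borel_measurable borel" and p: "\<And>x. f (x + pi) = f x"
  shows "(\<integral>\<^sup>+x\<in>{c..<c + pi}. f x \<partial>lborel) = (\<integral>\<^sup>+x\<in>{0..<pi}. f x \<partial>lborel)"
proof -
  define J where "J a b = (\<integral>\<^sup>+x\<in>{a..<b}. f x \<partial>lborel)" for a b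
  have sh: "J (a + of_int k * pi) (b + of_int k * pi) = J a b" for a b k
    unfolding J_def by (subst nn_integral_shift_Ico, simp) (simp add: periodic_shift_int[of f, OF p])
  define k where "k = \<lfloor>c / pi\<rfloor>"
  have k: "of_int k * pi \<le> c" "c < of_int k * pi + pi"
    using floor_divide_lower[of pi c] floor_divide_upper[of pi c] by (auto simp: k_def algebra_simps)
  have "J c (c + pi) = J c (of_int k * pi + pi) + J (of_int k * pi + pi) (c + pi)"
    unfolding J_def by (rule nn_integral_split_Ico) (use k in auto)
  also have "J (of_int k * pi + pi) (c + pi) = J (of_int k * pi) c"
    using sh[of "of_int k * pi" 1 c] by simp
  also have "J c (of_int k * pi + pi) + J (of_int k * pi) c = J (of_int k * pi) (of_int k * pi + pi)"
    unfolding J_def by (subst add.commute, rule nn_integral_split_Ico[symmetric]) (use k in auto)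
  also have "\<dots> = J 0 pi" using sh[of 0 k pi] by (simp add: add.commute)
  finally show ?thesis by (simp add: J_def)
qed

lemma nn_integral_periods:
  assumes [measurable]: "f \<in> borel_measurable borel" and p: "\<And>x. f (x + pi) = f x"
  shows "(\<integral>\<^sup>+x\<in>{c..<c + of_nat n * pi}. f x \<partial>lborel) = of_nat n * (\<integral>\<^sup>+x\<in>{0..<pi}. f x \<partial>lborel)"
proof (induction n)
  case 0 then show ?case by simp
next
  case (Suc n)
  have "(\<integral>\<^sup>+x\<in>{c..<c + of_nat (Suc n) * pi}. f x \<partial>lborel)
     = (\<integral>\<^sup>+x\<in>{c..<c + of_nat n * pi}. f x \<partial>lborel) + (\<integral>\<^sup>+x\<in>{c + of_nat n * pi..<(c + of_nat n * pi) + pi}. f x \<partial>lborel)"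
    by (subst nn_integral_split_Ico[of f c "c + of_nat n * pi"]) (auto simp: algebra_simps)
  also have "\<dots> = of_nat n * (\<integral>\<^sup>+x\<in>{0..<pi}. f x \<partial>lborel) + (\<integral>\<^sup>+x\<in>{0..<pi}. f x \<partial>lborel)"
    by (simp only: Suc.IH nn_integral_period[OF assms])
  finally show ?case by (simp add: distrib_right add.commute)
qed

text \<open>The exceptional set has measure zero on each of countably many blocks of periods.\<close>

lemma AE_periodic:
  assumes [measurable]: "Measurable.pred borel P" and p: "\<And>x. P (x + pi) = P x"
    and ae: "AE x in lborel. x \<in> {0..<pi} \<longrightarrow> P x"
  shows "AE x in lborel. P x"
proof -
  have "AE x in lborel. x \<in> {- of_nat n * pi..<of_nat n * pi} \<longrightarrow> P x" for n
  proof -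
    let ?f = "\<lambda>x. indicator {x. \<not> P x} x :: ennreal"
    have "(\<integral>\<^sup>+x\<in>{- of_nat n * pi..<- of_nat n * pi + of_nat (2 * n) * pi}. ?f x \<partial>lborel)
       = of_nat (2 * n) * (\<integral>\<^sup>+x\<in>{0..<pi}. ?f x \<partial>lborel)"
      by (rule nn_integral_periods) (auto simp: p indicator_def)
    also have "(\<integral>\<^sup>+x\<in>{0..<pi}. ?f x \<partial>lborel) = 0"
      by (subst nn_integral_0_iff_AE) (use ae in \<open>auto simp: indicator_def\<close>)
    finally have "(\<integral>\<^sup>+x\<in>{- of_nat n * pi..<of_nat n * pi}. ?f x \<partial>lborel) = 0"
      by (simp add: algebra_simps)
    then have "AE x in lborel. ?f x * indicator {- of_nat n * pi..<of_nat n * pi} x = 0"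
      by (subst (asm) nn_integral_0_iff_AE) auto
    then show ?thesis by (rule AE_mp) (auto simp: indicator_def split: if_splits)
  qed
  then have "AE x in lborel. \<forall>n. x \<in> {- of_nat n * pi..<of_nat n * pi} \<longrightarrow> P x"
    unfolding AE_all_countable by blast
  then show ?thesis
  proof (rule AE_mp, intro AE_I2 impI)
    fix x assume *: "\<forall>n. x \<in> {- of_nat n * pi..<of_nat n * pi} \<longrightarrow> P x"
    obtain n :: nat where "\<bar>x\<bar> / pi < of_nat n" using reals_Archimedean2 by blast
    then have "\<bar>x\<bar> < of_nat n * pi" by (simp add: field_simps)
    then show "P x" using *[rule_format, of n] by (auto simp: abs_less_iff)
  qed
qed

section \<open>Functions with a given distributional derivative\<close>

lemma continuous_bounded_Icc:
  fixes f :: "real \<Rightarrow> real"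
  assumes "continuous_on UNIV f"
  obtains B where "\<And>t. t \<in> {a..b} \<Longrightarrow> \<bar>f t\<bar> \<le> B"
proof -
  have "compact (f ` {a..b})" by (intro compact_continuous_image continuous_on_subset[OF assms]) auto
  then have "bounded (f ` {a..b})" by (rule compact_imp_bounded)
  then obtain B where "\<forall>y\<in>f ` {a..b}. norm y \<le> B" unfolding bounded_iff by blast
  then show thesis by (intro that[of B]) auto
qed

text \<open>Building blocks of bump functions. A polynomial in \<open>1/x\<close> in front of the exponential makes the
family closed under differentiation, so that smoothness follows from one differentiability
statement.\<close>

definition flat :: "real poly \<Rightarrow> real \<Rightarrow> real" where
  "flat p x = (if x > 0 then poly p (1 / x) * exp (- (1 / x)) else 0)"

lemma tendsto_poly_exp_at_top: "((\<lambda>t. poly q t * exp (- t)) \<longlongrightarrow> (0::real)) at_top"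
proof -
  have "((\<lambda>t. \<Sum>i\<le>degree q. coeff q i * (t ^ i / exp t)) \<longlongrightarrow> (\<Sum>i\<le>degree q. coeff q i * 0)) at_top"
    by (intro tendsto_sum tendsto_mult tendsto_const tendsto_power_div_exp_0)
  then show ?thesis by (simp add: poly_altdef sum_distrib_right exp_minus divide_inverse mult.assoc)
qed

lemma has_derivative_flat:
  "(flat p has_real_derivative flat (monom 1 2 * (p - pderiv p)) x) (at x)"
proof -
  consider "x > 0" | "x < 0" | "x = 0" by linarith
  then show ?thesis
  proof cases
    case 1
    have "((\<lambda>x. poly p (1 / x) * exp (- (1 / x))) has_real_derivative
        flat (monom 1 2 * (p - pderiv p)) x) (at x)"
      using 1 by (auto intro!: derivative_eq_intros DERIV_chain2[OF poly_DERIV]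
        simp: flat_def poly_monom field_simps power2_eq_square)
    then show ?thesis
      by (rule has_field_derivative_transform_within_open[where S="{0<..}"])
         (use 1 in \<open>auto simp: flat_def\<close>)
  next
    case 2
    have "((\<lambda>x. 0) has_real_derivative flat (monom 1 2 * (p - pderiv p)) x) (at x)"
      using 2 by (simp add: flat_def)
    then show ?thesis
      by (rule has_field_derivative_transform_within_open[where S="{..<0}"])
         (use 2 in \<open>auto simp: flat_def\<close>)
  next
    case 3
    have "((\<lambda>h. flat p h / h) \<longlongrightarrow> 0) (at_right 0)"
    proof (rule Lim_transform_eventually)
      show "((\<lambda>h. poly (pCons 0 p) (inverse h) * exp (- inverse h)) \<longlongrightarrow> 0) (at_right 0)"
        by (rule filterlim_compose[OF tendsto_poly_exp_at_top filterlim_inverse_at_top_right])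
      show "eventually (\<lambda>h. poly (pCons 0 p) (inverse h) * exp (- inverse h) = flat p h / h) (at_right 0)"
        by (rule eventually_at_rightI[of 0 1]) (auto simp: flat_def field_simps)
    qed
    moreover have "((\<lambda>h. flat p h / h) \<longlongrightarrow> 0) (at_left 0)"
    proof (rule Lim_transform_eventually)
      show "eventually (\<lambda>h. 0 = flat p h / h) (at_left 0)"
        by (rule eventually_at_leftI[of "-1" 0]) (auto simp: flat_def)
    qed simp
    ultimately have "((\<lambda>h. flat p h / h) \<longlongrightarrow> 0) (at 0)" by (simp add: filterlim_at_split)
    then show ?thesis unfolding 3 has_field_derivative_iff by (simp add: flat_def)
  qed
qed

lemma flat_smult: "flat (smult c p) x = c * flat p x"
  by (simp add: flat_def)

text \<open>Products of a flat function with a reflected one vanish outside an interval. Sums are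
included because the derivative of a product is a sum of two products.\<close>

inductive_set flat_products :: "(real \<Rightarrow> real) set" where
  mult: "e \<noteq> 0 \<Longrightarrow> (\<lambda>x. flat p ((x - a) / e) * flat q (1 - (x - a) / e)) \<in> flat_products"
| add: "f \<in> flat_products \<Longrightarrow> g \<in> flat_products \<Longrightarrow> (\<lambda>x. f x + g x) \<in> flat_products"

lemma flat_products_scale: "f \<in> flat_products \<Longrightarrow> (\<lambda>x. c * f x) \<in> flat_products"
proof (induction rule: flat_products.induct)
  case (mult e p a q)
  then show ?case using flat_products.mult[of e "smult c p" a q] by (simp add: flat_smult mult.assoc)
next
  case (add f g)
  then show ?case using flat_products.add[of "\<lambda>x. c * f x" "\<lambda>x. c * g x"] by (simp add: distrib_left)
qed

lemma flat_products_deriv: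
  "f \<in> flat_products \<Longrightarrow> \<exists>f'\<in>flat_products. \<forall>x. (f has_real_derivative f' x) (at x)"
proof (induction rule: flat_products.induct)
  case (mult e p a q)
  let ?D = "\<lambda>p. monom 1 2 * (p - pderiv p) :: real poly"
  let ?f' = "\<lambda>x. flat (smult (1/e) (?D p)) ((x - a) / e) * flat q (1 - (x - a) / e)
      + flat p ((x - a) / e) * flat (smult (-1/e) (?D q)) (1 - (x - a) / e)"
  have "?f' \<in> flat_products" by (intro flat_products.intros mult)
  moreover have "((\<lambda>x. flat p ((x - a) / e) * flat q (1 - (x - a) / e)) has_real_derivative ?f' x) (at x)" for x
    unfolding flat_smult using mult
    by (auto intro!: derivative_eq_intros DERIV_chain2[OF has_derivative_flat] simp: field_simps)
  ultimately show ?case by (intro bexI[of _ ?f'] allI)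
next
  case (add f g)
  then obtain f' g' where *: "f' \<in> flat_products" "g' \<in> flat_products"
    "\<And>x. (f has_real_derivative f' x) (at x)" "\<And>x. (g has_real_derivative g' x) (at x)" by blast
  show ?case
    by (rule bexI[OF _ flat_products.add[OF *(1,2)]]) (auto intro!: derivative_eq_intros *)
qed

lemma flat_products_smooth:
  assumes "f \<in> flat_products"
  shows "(deriv ^^ n) f field_differentiable at x"
proof -
  have d: "deriv g \<in> flat_products" "g field_differentiable at x" if g: "g \<in> flat_products" for g x
  proof -
    obtain g' where g': "g' \<in> flat_products" "\<And>x. (g has_real_derivative g' x) (at x)"
      using flat_products_deriv[OF g] by blast
    then have "deriv g = g'" by (intro ext DERIV_imp_deriv)
    then show "deriv g \<in> flat_products" "g field_differentiable at x"
      using g' by (auto simp: field_differentiable_def)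
  qed
  have "(deriv ^^ n) f \<in> flat_products" by (induction n) (auto intro: d assms)
  then show ?thesis by (rule d)
qed

lemma smooth_if_deriv_flat_products:
  assumes d: "\<And>x. (f has_real_derivative f' x) (at x)" and f': "f' \<in> flat_products"
  shows "(deriv ^^ n) f field_differentiable at x"
proof (cases n)
  case 0
  then show ?thesis using d by (auto simp: field_differentiable_def)
next
  case (Suc m)
  have "deriv f = f'" by (intro ext DERIV_imp_deriv d)
  then have "(deriv ^^ n) f = (deriv ^^ m) f'" unfolding Suc funpow_Suc_right by simp
  then show ?thesis using flat_products_smooth[OF f'] by simp
qed

text \<open>The step is a primitive of the bump \<open>exp (- 1/x) exp (- 1/(1 - x))\<close>, which lives on \<open>[0, 1]\<close>.\<close>

lemma smooth_step_exists:
  obtains H \<eta> :: "real \<Rightarrow> real" and c :: real where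
    "\<And>x. (H has_real_derivative \<eta> x) (at x)" "c > 0"
    "\<And>x. x \<le> 0 \<Longrightarrow> H x = 0" "\<And>x. x \<ge> 1 \<Longrightarrow> H x = c" "\<And>x. 0 \<le> H x" "\<And>x. H x \<le> c"
    "\<And>a e. e \<noteq> 0 \<Longrightarrow> (\<lambda>x. \<eta> ((x - a) / e)) \<in> flat_products"
    "\<And>x. 0 \<le> \<eta> x" "\<And>x. x \<notin> {0..1} \<Longrightarrow> \<eta> x = 0" "continuous_on UNIV \<eta>"
    "has_bochner_integral lborel \<eta> c"
proof -
  define \<eta> where "\<eta> x = flat 1 x * flat 1 (1 - x)" for x
  have fp: "(\<lambda>x. \<eta> ((x - a) / e)) \<in> flat_products" if "e \<noteq> 0" for a e
    unfolding \<eta>_def by (rule flat_products.mult[OF that])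
  have pos: "0 \<le> \<eta> x" and out: "x \<notin> {0<..<1} \<Longrightarrow> \<eta> x = 0" and inn: "x \<in> {0<..<1} \<Longrightarrow> \<eta> x > 0" for x
    by (auto simp: \<eta>_def flat_def)
  have "isCont \<eta> x" for x
    unfolding \<eta>_def
    by (intro continuous_intros isCont_o2[OF _ DERIV_isCont[OF has_derivative_flat]] DERIV_isCont[OF has_derivative_flat])
  then have cont: "continuous_on UNIV \<eta>" by (simp add: continuous_at_imp_continuous_on)
  have "\<exists>F. \<forall>x::real. -\<infinity> < ereal x \<longrightarrow> ereal x < \<infinity> \<longrightarrow> (F has_vector_derivative \<eta> x) (at x)"
    by (rule einterval_antiderivative) (use \<open>\<And>x. isCont \<eta> x\<close> in auto)
  then obtain F where F: "\<And>x::real. (F has_real_derivative \<eta> x) (at x)"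
    by (auto simp: has_real_derivative_iff_has_vector_derivative)
  define H where "H x = F x - F 0" for x
  have H: "(H has_real_derivative \<eta> x) (at x)" for x
    unfolding H_def by (auto intro!: derivative_eq_intros F)
  have mono: "H x \<le> H y" if "x \<le> y" for x y
    using that by (rule DERIV_nonneg_imp_nondecreasing) (use H pos in blast)
  have const: "H x = H y" if "x \<le> y" "\<And>z. x \<le> z \<Longrightarrow> z \<le> y \<Longrightarrow> \<eta> z = 0" for x y
  proof (rule antisym[OF mono[OF that(1)]])
    show "H y \<le> H x" using that(1)
      by (rule DERIV_nonpos_imp_nonincreasing) (use H that(2) in \<open>force\<close>)
  qed
  have H0: "H x = 0" if "x \<le> 0" for x using const[of x 0] that out by (auto simp: H_def)
  define c where "c = H 1"
  have H1: "H x = c" if "x \<ge> 1" for x using const[of 1 x] that out by (auto simp: c_def)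
  have "H 0 < H 1"
    by (rule DERIV_pos_imp_increasing_open[of 0 1 H])
       (use H inn in \<open>auto intro!: continuous_at_imp_continuous_on DERIV_isCont\<close>)
  then have c: "c > 0" using H0 by (simp add: c_def)
  have Hle: "0 \<le> H x" "H x \<le> c" for x
    using mono[of 0 x] mono[of x 1] H0[of x] H0[of 0] H1[of x] c by (cases "x \<le> 0"; cases "x \<ge> 1"; simp add: c_def)+
  have "has_bochner_integral lborel (\<lambda>x. \<eta> x * indicator {0..1} x) (H 1 - H 0)"
    by (rule has_bochner_integral_FTC_Icc_nonneg)
       (use H pos \<open>\<And>x. isCont \<eta> x\<close> cont in \<open>auto intro!: borel_measurable_continuous_onI DERIV_subset\<close>)
  moreover have "(\<lambda>x. \<eta> x * indicator {0..1} x) = \<eta>"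
  proof
    show "\<eta> x * indicator {0..1} x = \<eta> x" for x
      by (cases "x \<in> {0<..<1}") (use out[of x] in auto)
  qed
  ultimately have "has_bochner_integral lborel \<eta> c" using H0[of 0] by (simp add: c_def)
  moreover have "\<eta> x = 0" if "x \<notin> {0..1}" for x using out[of x] that by auto
  ultimately show thesis using that[of H \<eta> c] H c H0 H1 Hle fp pos cont by blast
qed

text \<open>Substituting \<open>t = x + s / (n + 1)\<close> moves the rescaling from the kernel into the argument of \<open>F\<close>,
where continuity and dominated convergence apply.\<close>

lemma tendsto_mollify:
  fixes F \<eta> :: "real \<Rightarrow> real"
  assumes F: "continuous_on UNIV F" and \<eta>: "integrable lborel \<eta>" "\<And>x. x \<notin> {0..1} \<Longrightarrow> \<eta> x = 0"
  shows "(\<lambda>n. LINT t|lborel. F t * (of_nat (Suc n) * \<eta> (of_nat (Suc n) * (t - x)))) \<longlonglongrightarrow> F x * (LINT t|lborel. \<eta> t)"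
    and "integrable lborel (\<lambda>t. F t * (of_nat (Suc n) * \<eta> (of_nat (Suc n) * (t - x))))"
proof -
  have [measurable]: "F \<in> borel_measurable borel" "\<eta> \<in> borel_measurable borel"
    using borel_measurable_continuous_onI[OF F] borel_measurable_integrable[OF \<eta>(1)] by auto
  obtain B where B: "\<And>t. t \<in> {x..x+1} \<Longrightarrow> \<bar>F t\<bar> \<le> B"
    using continuous_bounded_Icc[OF F] by blast
  have B0: "0 \<le> B" using B[of x] by simp
  have bd: "\<bar>F (x + s / of_nat (Suc n)) * \<eta> s\<bar> \<le> B * \<bar>\<eta> s\<bar>" for s n
  proof (cases "s \<in> {0..1}")
    case True
    then have "s / real (Suc n) \<le> 1 / real (Suc n)" by (intro divide_right_mono) auto
    also have "\<dots> \<le> 1" by simp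
    finally have "x + s / real (Suc n) \<in> {x..x+1}" using True by simp
    from B[OF this] show ?thesis by (auto simp: abs_mult intro!: mult_right_mono)
  qed (use \<eta> in auto)
  have iB: "integrable lborel (\<lambda>s. B * \<bar>\<eta> s\<bar>)" using \<eta> by simp
  have int: "integrable lborel (\<lambda>s. F (x + s / of_nat (Suc n)) * \<eta> s)" for n
    by (rule Bochner_Integration.integrable_bound[OF iB]) (use bd B0 in \<open>auto simp del: of_nat_Suc\<close>)
  have aff: "(\<lambda>s. F (x + s / of_nat (Suc n)) * \<eta> s)
     = (\<lambda>s. (\<lambda>t. F t * \<eta> (of_nat (Suc n) * (t - x))) (x + (1 / of_nat (Suc n)) * s))" for n
    by (auto simp: fun_eq_iff simp del: of_nat_Suc)
  have int2: "integrable lborel (\<lambda>t. F t * \<eta> (of_nat (Suc n) * (t - x)))" for n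
    using int[of n] unfolding aff
    by (subst (asm) lborel_integrable_real_affine_iff) (auto simp del: of_nat_Suc)
  have "integrable lborel (\<lambda>t. of_nat (Suc n) * (F t * \<eta> (of_nat (Suc n) * (t - x))))" for n
    using int2[of n] by (intro integrable_mult_right) auto
  then show "integrable lborel (\<lambda>t. F t * (of_nat (Suc n) * \<eta> (of_nat (Suc n) * (t - x))))"
    by (simp add: mult.left_commute)
  have eq: "(LINT t|lborel. F t * (of_nat (Suc n) * \<eta> (of_nat (Suc n) * (t - x)))) = (LINT s|lborel. F (x + s / of_nat (Suc n)) * \<eta> s)" for n
  proof -
    have "(LINT t|lborel. F t * \<eta> (of_nat (Suc n) * (t - x))) = \<bar>1 / of_nat (Suc n)\<bar> *\<^sub>R (LINT s|lborel. F (x + s / of_nat (Suc n)) * \<eta> s)"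
      unfolding aff by (rule lborel_integral_real_affine) simp
    moreover have "(LINT t|lborel. F t * (of_nat (Suc n) * \<eta> (of_nat (Suc n) * (t - x)))) = of_nat (Suc n) * (LINT t|lborel. F t * \<eta> (of_nat (Suc n) * (t - x)))"
      unfolding integral_mult_right_zero[symmetric] by (simp add: mult.left_commute)
    ultimately show ?thesis by (simp del: of_nat_Suc)
  qed
  have "(\<lambda>n. LINT s|lborel. F (x + s / of_nat (Suc n)) * \<eta> s) \<longlonglongrightarrow> (LINT s|lborel. F x * \<eta> s)"
  proof (rule integral_dominated_convergence[OF _ _ iB])
    show "AE s in lborel. (\<lambda>n. F (x + s / of_nat (Suc n)) * \<eta> s) \<longlonglongrightarrow> F x * \<eta> s"
    proof (rule AE_I2)
      fix s :: real
      have "(\<lambda>n. s * inverse (of_nat (Suc n))) \<longlonglongrightarrow> s * 0"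
        by (intro tendsto_intros LIMSEQ_inverse_real_of_nat)
      then have l: "(\<lambda>n. x + s / of_nat (Suc n)) \<longlonglongrightarrow> x"
        using tendsto_add[OF tendsto_const[of x]] by (fastforce simp: divide_inverse)
      have "isCont F x" using F by (simp add: continuous_on_eq_continuous_at)
      then show "(\<lambda>n. F (x + s / of_nat (Suc n)) * \<eta> s) \<longlonglongrightarrow> F x * \<eta> s"
        by (intro tendsto_mult tendsto_const isCont_tendsto_compose[OF _ l])
    qed
  qed (use bd in \<open>auto simp del: of_nat_Suc\<close>)
  then show "(\<lambda>n. LINT t|lborel. F t * (of_nat (Suc n) * \<eta> (of_nat (Suc n) * (t - x)))) \<longlonglongrightarrow> F x * (LINT t|lborel. \<eta> t)"
    unfolding eq by simp
qed

text \<open>Test against the difference of two steadily steeper smooth steps at \<open>x\<close> and \<open>y\<close>: it tends to the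
indicator of \<open>(x, y]\<close>, while its derivative is a difference of mollifiers at \<open>x\<close> and \<open>y\<close>.\<close>

lemma distributional_derivative_integral:
  assumes d: "has_distributional_derivative F G" and F: "continuous_on UNIV F" and xy: "x < y"
  shows "(LINT t:{x<..y}|lborel. G t) = F y - F x"
proof -
  obtain H \<eta> c where H: "\<And>x::real. (H has_real_derivative \<eta> x) (at x)" "c > 0"
    "\<And>x. x \<le> 0 \<Longrightarrow> H x = 0" "\<And>x. x \<ge> 1 \<Longrightarrow> H x = c" "\<And>x. 0 \<le> H x" "\<And>x. H x \<le> c"
    and fp: "\<And>a e. e \<noteq> 0 \<Longrightarrow> (\<lambda>x. \<eta> ((x - a) / e)) \<in> flat_products"
    and \<eta>: "\<And>x. 0 \<le> \<eta> x" "\<And>x. x \<notin> {0..1} \<Longrightarrow> \<eta> x = 0" "continuous_on UNIV \<eta>" "has_bochner_integral lborel \<eta> c"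
    by (rule smooth_step_exists, rule that, assumption+)
  have \<eta>i: "integrable lborel \<eta>" "(LINT t|lborel. \<eta> t) = c"
    using \<eta>(4) by (auto simp: has_bochner_integral_iff)
  have Gl: "set_integrable lborel {x..y + 1} G"
    using d by (auto simp: has_distributional_derivative_def locally_integrable_def)
  \<comment> \<open>The step has height \<open>c\<close>, hence the normalisation.\<close>
  define \<psi> where "\<psi> n t = (H (of_nat (Suc n) * (t - x)) - H (of_nat (Suc n) * (t - y))) / c" for n t
  define \<psi>' where "\<psi>' n t = (of_nat (Suc n) * \<eta> (of_nat (Suc n) * (t - x)) - of_nat (Suc n) * \<eta> (of_nat (Suc n) * (t - y))) / c" for n t
  have \<psi>d: "(\<psi> n has_real_derivative \<psi>' n t) (at t)" for n t
    unfolding \<psi>_def \<psi>'_def using H(2)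
    by (auto intro!: derivative_eq_intros DERIV_chain2[OF H(1)] simp del: of_nat_Suc)
  have "\<psi>' n \<in> flat_products" for n
  proof -
    have "(\<lambda>t. of_nat (Suc n) / c * \<eta> ((t - x) / (1 / of_nat (Suc n))) + - of_nat (Suc n) / c * \<eta> ((t - y) / (1 / of_nat (Suc n)))) \<in> flat_products"
      by (intro flat_products.add flat_products_scale fp) simp_all
    then show ?thesis unfolding \<psi>'_def
      by (simp add: diff_divide_distrib mult.commute del: of_nat_Suc)
  qed
  then have sm: "(deriv ^^ m) (\<psi> n) field_differentiable at t" for m n t
    using smooth_if_deriv_flat_products[OF \<psi>d] by blast
  have big: "of_nat (Suc n) * (t - z) \<ge> 1" if "t > z + 1" for n and t z :: real
  proof -
    have "1 * 1 \<le> real (Suc n) * (t - z)" using that by (intro mult_mono) auto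
    then show ?thesis by simp
  qed
  have \<psi>0: "\<psi> n t = 0" if "t \<notin> {x..y + 1}" for n t
  proof (cases "t < x")
    case True
    then have "of_nat (Suc n) * (t - x) \<le> 0" "of_nat (Suc n) * (t - y) \<le> 0" using xy
      by (auto intro!: mult_nonneg_nonpos simp del: of_nat_Suc)
    then show ?thesis by (simp add: \<psi>_def H)
  next
    case False
    then have "t > x + 1" "t > y + 1" using that xy by auto
    then show ?thesis using big[of x t n] big[of y t n] by (simp add: \<psi>_def H)
  qed
  have tf: "test_function (\<psi> n)" for n
  proof -
    have "{t. \<psi> n t \<noteq> 0} \<subseteq> {x..y + 1}" using \<psi>0 by blast
    then have "bounded {t. \<psi> n t \<noteq> 0}" using bounded_closed_interval bounded_subset by blast
    then show ?thesis using sm by (auto simp: test_function_def)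
  qed
  have \<psi>deriv: "deriv (\<psi> n) = \<psi>' n" for n by (intro ext DERIV_imp_deriv \<psi>d)
  have ibp: "(LINT t|lborel. F t * \<psi>' n t) = - (LINT t|lborel. G t * \<psi> n t)" for n
    using d tf[of n] \<psi>deriv[of n] by (auto simp: has_distributional_derivative_def)
  have "(\<lambda>n. LINT t|lborel. F t * \<psi>' n t) \<longlonglongrightarrow> (F x * c - F y * c) / c"
  proof -
    note m = tendsto_mollify[OF F \<eta>i(1) \<eta>(2), unfolded \<eta>i(2)]
    have "(LINT t|lborel. F t * \<psi>' n t) =
      ((LINT t|lborel. F t * (of_nat (Suc n) * \<eta> (of_nat (Suc n) * (t - x)))) - (LINT t|lborel. F t * (of_nat (Suc n) * \<eta> (of_nat (Suc n) * (t - y))))) / c" for n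
    proof -
      have "F t * \<psi>' n t = (F t * (of_nat (Suc n) * \<eta> (of_nat (Suc n) * (t - x)))
          - F t * (of_nat (Suc n) * \<eta> (of_nat (Suc n) * (t - y)))) / c" for t
        by (simp add: \<psi>'_def right_diff_distrib)
      moreover have "integrable lborel (\<lambda>t. F t * (of_nat (Suc n) * \<eta> (of_nat (Suc n) * (t - z))))" for z
        by (rule m(2))
      ultimately show ?thesis
        by (simp only: integral_divide_zero Bochner_Integration.integral_diff)
    qed
    then show ?thesis using H(2) by (auto intro!: tendsto_intros m(1) simp del: of_nat_Suc)
  qed
  moreover have "(F x * c - F y * c) / c = F x - F y" using H(2) by (simp add: field_simps)
  ultimately have lim1: "(\<lambda>n. LINT t|lborel. F t * \<psi>' n t) \<longlonglongrightarrow> F x - F y" by simp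
  have [measurable]: "H \<in> borel_measurable borel"
    by (intro borel_measurable_continuous_onI continuous_at_imp_continuous_on ballI DERIV_isCont[OF H(1)])
  have "\<psi> n \<in> borel_measurable borel" for n unfolding \<psi>_def by measurable
  note this [measurable]
  have [measurable]: "(\<lambda>t. G t * indicator {x..y+1} t) \<in> borel_measurable borel"
    using borel_measurable_integrable[OF Gl[unfolded set_integrable_def]] by (simp add: mult.commute)
  have G\<psi>: "G t * \<psi> n t = (G t * indicator {x..y+1} t) * \<psi> n t" for n t
    using \<psi>0 by (auto simp: indicator_def)
  have \<psi>1: "\<bar>\<psi> n t\<bar> \<le> 1" for n t
  proof -
    have "\<bar>H (of_nat (Suc n) * (t - x)) - H (of_nat (Suc n) * (t - y))\<bar> \<le> c"
      using H(5,6)[of "of_nat (Suc n) * (t - x)"] H(5,6)[of "of_nat (Suc n) * (t - y)"] by linarith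
    then show ?thesis using H(2) by (simp add: \<psi>_def abs_divide)
  qed
  have "(\<lambda>n. LINT t|lborel. (G t * indicator {x..y+1} t) * \<psi> n t) \<longlonglongrightarrow> (LINT t|lborel. (G t * indicator {x..y+1} t) * indicator {x<..y} t)"
  proof (rule integral_dominated_convergence)
    show "integrable lborel (\<lambda>t. \<bar>G t * indicator {x..y+1} t\<bar>)"
      using Gl by (intro integrable_abs) (simp add: set_integrable_def mult.commute)
    show "AE t in lborel. norm (G t * indicator {x..y+1} t * \<psi> n t) \<le> \<bar>G t * indicator {x..y+1} t\<bar>" for n
      using \<psi>1 by (intro AE_I2) (simp add: abs_mult mult_left_le)
    show "AE t in lborel. (\<lambda>n. G t * indicator {x..y+1} t * \<psi> n t) \<longlonglongrightarrow> G t * indicator {x..y+1} t * indicator {x<..y} t"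
    proof (rule AE_I2, rule tendsto_mult[OF tendsto_const])
      fix t
      have step: "(\<lambda>n. H (of_nat (Suc n) * (t - z)) / c) \<longlonglongrightarrow> indicator {z<..} t" for z
      proof (cases "t > z")
        case True
        have "eventually (\<lambda>n. H (of_nat (Suc n) * (t - z)) / c = 1) sequentially"
        proof -
          obtain N :: nat where N: "1 / (t - z) < of_nat N" using reals_Archimedean2 by blast
          have "H (of_nat (Suc n) * (t - z)) / c = 1" if "n \<ge> N" for n
          proof -
            have "1 / (t - z) \<le> real (Suc n)" using N that by linarith
            then have "1 \<le> real (Suc n) * (t - z)" using True by (simp add: field_simps del: of_nat_Suc)
            then show ?thesis using H by simp
          qed
          then show ?thesis by (auto simp: eventually_sequentially)
        qed
        then show ?thesis using True by (simp add: tendsto_eventually)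
      next
        case False
        then have "of_nat (Suc n) * (t - z) \<le> 0" for n by (auto intro!: mult_nonneg_nonpos simp del: of_nat_Suc)
        then have "H (of_nat (Suc n) * (t - z)) = 0" for n using H(3) by blast
        then show ?thesis using False by simp
      qed
      have "(\<lambda>n. \<psi> n t) \<longlonglongrightarrow> indicator {x<..} t - indicator {y<..} t"
        unfolding \<psi>_def diff_divide_distrib by (intro tendsto_diff step)
      then show "(\<lambda>n. \<psi> n t) \<longlonglongrightarrow> indicator {x<..y} t"
        using xy by (auto simp: indicator_def split: if_splits)
    qed
  qed measurable
  then have "(\<lambda>n. - (LINT t|lborel. G t * \<psi> n t)) \<longlonglongrightarrow> - (LINT t|lborel. (G t * indicator {x..y+1} t) * indicator {x<..y} t)"
    unfolding G\<psi> by (rule tendsto_minus)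
  then have "F x - F y = - (LINT t|lborel. (G t * indicator {x..y+1} t) * indicator {x<..y} t)"
    unfolding ibp[symmetric] using lim1 LIMSEQ_unique by blast
  also have "(LINT t|lborel. (G t * indicator {x..y+1} t) * indicator {x<..y} t) = (LINT t:{x<..y}|lborel. G t)"
    unfolding set_lebesgue_integral_def by (intro Bochner_Integration.integral_cong) (auto simp: indicator_def)
  finally show ?thesis by simp
qed

text \<open>Write \<open>F\<close> as a constant plus the integral of \<open>G\<close> and exchange the two integrations over the
triangle \<open>t \<le> x\<close> in a square that contains the support of the test function.\<close>

lemma integral_has_distributional_derivative:
  assumes F: "continuous_on UNIV F" and G: "locally_integrable G" "G \<in> borel_measurable borel"
    and FG: "\<And>x y. x \<le> y \<Longrightarrow> (LINT t:{x..y}|lborel. G t) = F y - F x"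
  shows "has_distributional_derivative F G"
  unfolding has_distributional_derivative_def
proof (intro conjI allI impI)
  note [measurable] = G(2) borel_measurable_continuous_onI[OF F]
  show "locally_integrable F"
    unfolding locally_integrable_def set_integrable_def
    by (intro allI borel_integrable_compact continuous_on_subset[OF F]) auto
  show "locally_integrable G" by (rule G)
  fix \<psi> assume tf: "test_function \<psi>"
  have "bounded {x. \<psi> x \<noteq> 0}"
    using tf compact_imp_bounded bounded_subset[OF _ closure_subset] by (auto simp: test_function_def)
  then obtain N where N: "\<And>x. \<psi> x \<noteq> 0 \<Longrightarrow> \<bar>x\<bar> \<le> N" by (auto simp: bounded_iff)
  \<comment> \<open>One unit beyond the support, so that \<open>\<psi>\<close> vanishes at \<open>a\<close> and \<open>b\<close> and its derivative outside.\<close>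
  define a b where "a = - \<bar>N\<bar> - 1" and "b = \<bar>N\<bar> + 1"
  have ab: "a < b" by (simp add: a_def b_def)
  have out: "\<psi> x = 0" if "x \<notin> {a<..<b}" for x 
  proof (rule ccontr)
    assume "\<psi> x \<noteq> 0"
    then have "\<bar>x\<bar> \<le> N" by (rule N)
    then show False using that by (auto simp: a_def b_def)
  qed
  have d: "(\<psi> has_real_derivative deriv \<psi> x) (at x)" for x
    using tf by (auto simp: test_function_def DERIV_deriv_iff_field_differentiable dest: spec[of _ 0])
  have "deriv \<psi> field_differentiable at x" for x
    using tf by (auto simp: test_function_def dest: spec[of _ 1])
  then have dc: "isCont (deriv \<psi>) x" for x using field_differentiable_imp_continuous_at by blast
  then have dcont: "continuous_on S (deriv \<psi>)" for S by (simp add: continuous_at_imp_continuous_on)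
  note [measurable] = borel_measurable_continuous_onI[OF dcont]
  have dout: "deriv \<psi> x = 0" if "x \<notin> {a..b}" for x
  proof (rule DERIV_imp_deriv)
    show "(\<psi> has_real_derivative 0) (at x)"
      by (rule has_field_derivative_transform_within_open[of "\<lambda>_. 0" _ _ "- {a..b}"])
         (use that out in auto)
  qed
  have FTC: "(LINT x:{s..b}|lborel. deriv \<psi> x) = - \<psi> s" if "s \<le> b" for s
  proof -
    have "(LINT x|lborel. deriv \<psi> x * indicator {s..b} x) = \<psi> b - \<psi> s"
      by (rule integral_FTC_Icc_real[OF that d]) (rule dc)
    then show ?thesis using out[of b] by (simp add: set_lebesgue_integral_def mult.commute)
  qed
  obtain B where B: "\<And>t. t \<in> {a..b} \<Longrightarrow> \<bar>deriv \<psi> t\<bar> \<le> B"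
    using continuous_bounded_Icc[OF dcont] by blast
  have B0: "0 \<le> B" using B[of a] ab by simp
  define k where "k t x = (if a \<le> t \<and> t \<le> x \<and> x \<le> b then G t * deriv \<psi> x else 0)" for t x
  define g where "g t = indicator {a..b} t * \<bar>G t\<bar>" for t
  have gi: "integrable lborel g"
    using G(1) integrable_abs[of lborel "\<lambda>t. indicator {a..b} t * G t"]
    by (auto simp: locally_integrable_def set_integrable_def g_def[abs_def] abs_mult)
  have [measurable]: "g \<in> borel_measurable borel" unfolding g_def by measurable
  have km: "case_prod k \<in> borel_measurable (lborel \<Otimes>\<^sub>M lborel)"
    unfolding k_def split_def by measurable
  have P: "integrable (lborel \<Otimes>\<^sub>M lborel) (\<lambda>(t, x). g t * (B * indicator {a..b} x))"
  proof (rule lborel_pair.Fubini_integrable)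
    show "(\<lambda>(t, x). g t * (B * indicator {a..b} x)) \<in> borel_measurable (lborel \<Otimes>\<^sub>M lborel)"
      by measurable
    have "(LINT x|lborel. norm (g t * (B * indicator {a..b} x))) = g t * (B * (b - a))" for t
      using ab B0 by (simp add: g_def abs_mult)
    then show "integrable lborel (\<lambda>t. LINT x|lborel. norm (case (t, x) of (t, x) \<Rightarrow> g t * (B * indicator {a..b} x)))"
      using gi by simp
    show "AE t in lborel. integrable lborel (\<lambda>x. case (t, x) of (t, x) \<Rightarrow> g t * (B * indicator {a..b} x))"
      using ab by (intro AE_I2) (auto intro!: integrable_mult_right integrable_real_indicator)
  qed
  have ki: "integrable (lborel \<Otimes>\<^sub>M lborel) (case_prod k)"
  proof (rule Bochner_Integration.integrable_bound[OF P km], rule AE_I2, safe)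
    fix t x
    show "norm (k t x) \<le> norm (g t * (B * indicator {a..b} x))"
      using B B0 by (auto simp: k_def g_def abs_mult intro!: mult_left_mono)
  qed
  have fub: "(LINT x|lborel. LINT t|lborel. k t x) = (LINT t|lborel. LINT x|lborel. k t x)"
    by (rule lborel_pair.Fubini_integral[OF ki])
  have kx: "(LINT t|lborel. k t x) = (F x - F a) * deriv \<psi> x" for x
  proof (cases "x \<in> {a..b}")
    case True
    have "k t x = (indicator {a..x} t *\<^sub>R G t) * deriv \<psi> x" for t
      using True by (auto simp: k_def indicator_def)
    then have "(LINT t|lborel. k t x) = (LINT t:{a..x}|lborel. G t) * deriv \<psi> x"
      unfolding set_lebesgue_integral_def by (simp only: integral_mult_left_zero)
    then show ?thesis using FG[of a x] True by simp
  next
    case False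
    then have "k t x = 0" for t by (auto simp: k_def)
    then show ?thesis using dout[OF False] by simp
  qed
  have kt: "(LINT x|lborel. k t x) = - (G t * \<psi> t)" for t
  proof (cases "t \<in> {a..b}")
    case True
    have "k t x = G t * (indicator {t..b} x *\<^sub>R deriv \<psi> x)" for x
      using True by (auto simp: k_def indicator_def)
    then have "(LINT x|lborel. k t x) = G t * (LINT x:{t..b}|lborel. deriv \<psi> x)"
      unfolding set_lebesgue_integral_def by (simp only: integral_mult_right_zero)
    then show ?thesis using FTC[of t] True by simp
  next
    case False
    then have "k t x = 0" for x by (auto simp: k_def)
    moreover have "\<psi> t = 0" by (rule out) (use False in auto)
    ultimately show ?thesis by simp
  qed
  have i: "integrable lborel (\<lambda>x. f x * deriv \<psi> x)" if f: "continuous_on UNIV f" for f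
  proof -
    have "integrable lborel (\<lambda>x. (f x * deriv \<psi> x) * indicator {a..b} x)"
      by (rule borel_integrable_atLeastAtMost) (use f dc in \<open>auto simp: continuous_on_eq_continuous_at\<close>)
    also have "(\<lambda>x. (f x * deriv \<psi> x) * indicator {a..b} x) = (\<lambda>x. f x * deriv \<psi> x)"
    proof
      show "(f x * deriv \<psi> x) * indicator {a..b} x = f x * deriv \<psi> x" for x
        by (cases "x \<in> {a..b}") (simp_all add: dout)
    qed
    finally show ?thesis .
  qed
  have i1: "integrable lborel (\<lambda>x. F x * deriv \<psi> x)" by (rule i[OF F])
  have i2: "integrable lborel (\<lambda>x. F a * deriv \<psi> x)" by (rule i) simp
  have "(\<lambda>x. indicator {a..b} x *\<^sub>R deriv \<psi> x) = deriv \<psi>"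
  proof
    show "indicator {a..b} x *\<^sub>R deriv \<psi> x = deriv \<psi> x" for x
      by (cases "x \<in> {a..b}") (simp_all add: dout)
  qed
  moreover have "(LINT x:{a..b}|lborel. deriv \<psi> x) = 0"
    using FTC[of a] ab out[of a] by simp
  ultimately have z: "(LINT x|lborel. deriv \<psi> x) = 0"
    unfolding set_lebesgue_integral_def by simp
  have "(LINT x|lborel. F a * deriv \<psi> x) = 0"
    unfolding integral_mult_right_zero z by simp
  then have "(LINT x|lborel. F x * deriv \<psi> x) = (LINT x|lborel. F x * deriv \<psi> x - F a * deriv \<psi> x)"
    unfolding Bochner_Integration.integral_diff[OF i1 i2] by simp
  also have "\<dots> = (LINT x|lborel. (F x - F a) * deriv \<psi> x)"
    by (simp only: left_diff_distrib)
  also have "\<dots> = (LINT t|lborel. - (G t * \<psi> t))"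
    using fub unfolding kx kt .
  also have "\<dots> = - (LINT t|lborel. G t * \<psi> t)"
    by (rule integral_minus)
  finally show "(LINT x|lborel. F x * deriv \<psi> x) = - (LINT x|lborel. G x * \<psi> x)" .
qed

section \<open>Beta numbers and dyadic sums\<close>

text \<open>For continuous functions the essential supremum is a pointwise one; this lemma and the next allow
beta numbers to be estimated from pointwise bounds in both directions.\<close>

lemma Linf_norm_le:
  assumes "a < b" and c: "continuous_on UNIV f" and le: "\<And>x. x \<in> {a..b} \<Longrightarrow> \<bar>f x\<bar> \<le> s"
  shows "0 \<le> Linf_norm a b f" "Linf_norm a b f \<le> s"
    "esssup (lebesgue_on {a..b}) (\<lambda>x. ereal \<bar>f x\<bar>) = ereal (Linf_norm a b f)"
proof -
  let ?M = "lebesgue_on {a..b}"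
  have [measurable]: "f \<in> borel_measurable lebesgue"
    using borel_measurable_continuous_onI[OF c] by (simp add: measurable_completion)
  have m: "(\<lambda>x. ereal \<bar>f x\<bar>) \<in> borel_measurable ?M"
    by (intro measurable_restrict_space1) measurable
  have pos: "emeasure ?M (space ?M) \<noteq> 0" using assms(1) by (simp add: emeasure_restrict_space)
  have "0 = esssup ?M (\<lambda>x. 0 :: ereal)" using esssup_const[OF pos] by simp
  also have "\<dots> \<le> esssup ?M (\<lambda>x. ereal \<bar>f x\<bar>)"
    by (rule esssup_AE_mono) auto
  finally have 0: "0 \<le> esssup ?M (\<lambda>x. ereal \<bar>f x\<bar>)" .
  have 1: "esssup ?M (\<lambda>x. ereal \<bar>f x\<bar>) \<le> ereal s"
    by (rule esssup_I[OF m]) (use le in \<open>auto intro!: AE_I2\<close>)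
  show "0 \<le> Linf_norm a b f" "Linf_norm a b f \<le> s"
    "esssup ?M (\<lambda>x. ereal \<bar>f x\<bar>) = ereal (Linf_norm a b f)"
    using 0 1 unfolding Linf_norm_def by (cases "esssup ?M (\<lambda>x. ereal \<bar>f x\<bar>)"; simp)+
qed

text \<open>The set where a continuous function obeys a bound is closed, so an almost everywhere bound on an
open interval holds on its closure.\<close>

lemma le_Linf_norm:
  assumes "a < b" and c: "continuous_on UNIV f" and x: "x \<in> {a..b}"
  shows "\<bar>f x\<bar> \<le> Linf_norm a b f"
proof -
  let ?M = "lebesgue_on {a..b}"
  obtain s where s: "\<And>x. x \<in> {a..b} \<Longrightarrow> \<bar>f x\<bar> \<le> s"
    using continuous_bounded_Icc[OF c] by blast
  have e: "esssup ?M (\<lambda>x. ereal \<bar>f x\<bar>) = ereal (Linf_norm a b f)"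
    by (rule Linf_norm_le(3)[OF assms(1) c, where s=s]) (rule s)
  have "AE y in ?M. ereal \<bar>f y\<bar> \<le> ereal (Linf_norm a b f)"
    using esssup_AE[where M="?M" and f="\<lambda>x. ereal \<bar>f x\<bar>"] unfolding e .
  then have "AE y in lebesgue. y \<in> {a..b} \<longrightarrow> \<bar>f y\<bar> \<le> Linf_norm a b f"
    by (simp add: AE_restrict_space_iff)
  then have ae: "AE y\<in>{a<..<b} in lebesgue. y \<in> {y. \<bar>f y\<bar> \<le> Linf_norm a b f}"
    by (rule AE_mp) auto
  have cl: "closed {y. \<bar>f y\<bar> \<le> Linf_norm a b f}"
    by (intro closed_Collect_le continuous_intros c)
  have "{a<..<b} \<subseteq> {y. \<bar>f y\<bar> \<le> Linf_norm a b f}"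
    using mem_closed_if_AE_lebesgue_open[OF _ cl ae] by auto
  from closure_minimal[OF this cl] show ?thesis using x assms(1) by auto
qed

lemma continuous_minus_affine:
  "continuous_on UNIV F \<Longrightarrow> continuous_on UNIV (\<lambda>x::real. F x - (c * x + d :: real))"
  by (intro continuous_intros)

lemma Linf_norm_affine_nonneg:
  fixes F :: "real \<Rightarrow> real"
  assumes "a < b" "continuous_on UNIV F"
  shows "0 \<le> Linf_norm a b (\<lambda>x. F x - (c * x + d))"
  by (rule order_trans[OF abs_ge_zero le_Linf_norm[OF assms(1) continuous_minus_affine[OF assms(2)], of a]])
     (use assms(1) in simp)

lemma Linf_inf_bdd:
  assumes "a < b" "continuous_on UNIV F"
  shows "bdd_below (range (\<lambda>(c, d). Linf_norm a b (\<lambda>x. F x - (c * x + d))))"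
proof (rule bdd_belowI[of _ 0], safe)
  fix c d :: real
  show "0 \<le> Linf_norm a b (\<lambda>x. F x - (c * x + d))"
    by (rule Linf_norm_affine_nonneg[OF assms(1,2)])
qed

lemma beta_lift_nonneg:
  assumes "a < b" "continuous_on UNIV F" "F a < F b"
  shows "0 \<le> beta_lift F (a, b)"
proof -
  have "0 \<le> (INF (c, d) \<in> UNIV. Linf_norm a b (\<lambda>x. F x - (c * x + d)))"
  proof (rule cINF_greatest, simp, safe)
    fix c d :: real
    show "0 \<le> Linf_norm a b (\<lambda>x. F x - (c * x + d))"
      by (rule Linf_norm_affine_nonneg[OF assms(1,2)])
  qed
  then show ?thesis using assms(3) by (simp add: beta_lift_def)
qed

lemma beta_lift_upper:
  assumes "a < b" "continuous_on UNIV F" "F a < F b"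
    and "\<And>x. x \<in> {a..b} \<Longrightarrow> \<bar>F x - (c * x + d)\<bar> \<le> s"
  shows "beta_lift F (a, b) \<le> s / (F b - F a)"
proof -
  have "(INF (c, d) \<in> UNIV. Linf_norm a b (\<lambda>x. F x - (c * x + d))) \<le> Linf_norm a b (\<lambda>x. F x - (c * x + d))"
    using cINF_lower[OF Linf_inf_bdd[OF assms(1,2)], of "(c, d)"] by simp
  also have "\<dots> \<le> s" by (rule Linf_norm_le(2)[OF assms(1) continuous_minus_affine[OF assms(2)] assms(4)])
  finally show ?thesis using assms(3) by (simp add: beta_lift_def divide_right_mono)
qed

lemma beta_lift_lower:
  assumes "a < b" "continuous_on UNIV F" "F a < F b"
    and K: "\<And>c d s. (\<And>x. x \<in> {a..b} \<Longrightarrow> \<bar>F x - (c * x + d)\<bar> \<le> s) \<Longrightarrow> K \<le> s"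
  shows "K / (F b - F a) \<le> beta_lift F (a, b)"
proof -
  have "K \<le> (INF (c, d) \<in> UNIV. Linf_norm a b (\<lambda>x. F x - (c * x + d)))"
  proof (rule cINF_greatest, simp, safe)
    fix c d :: real
    show "K \<le> Linf_norm a b (\<lambda>x. F x - (c * x + d))"
      by (rule K[of c d]) (rule le_Linf_norm[OF assms(1) continuous_minus_affine[OF assms(2)]])
  qed
  then show ?thesis using assms(3) by (simp add: beta_lift_def divide_right_mono)
qed

text \<open>An affine function has no second difference, so an affine approximation with error \<open>s\<close> bounds the
second difference of \<open>F\<close> by \<open>4 s\<close>. The left side is relative to the increment \<open>V\<close> on the interval
itself and the beta number to the increment \<open>D\<close> on the dilated one. If \<open>s\<close> is small compared with
\<open>D\<close>, the approximation also shows that \<open>V\<close> is at least a fixed fraction of \<open>D\<close>; otherwise the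
estimate is trivial because the left side never exceeds \<open>1\<close>.\<close>

lemma bisection_defect_le_beta:
  assumes "a < b" "continuous_on UNIV F" "strict_mono F" "1 \<le> lam"
  shows "\<bar>F a - 2 * F ((a + b) / 2) + F b\<bar> / (F b - F a) \<le> 8 * lam * beta_lift F (dilate lam (a, b))"
proof -
  define a' b' where "a' = (a + b) / 2 - lam * (b - a) / 2" and "b' = (a + b) / 2 + lam * (b - a) / 2"
  have "(b - a) * 1 \<le> (b - a) * lam" using assms by (intro mult_left_mono) auto
  then have ab: "a' \<le> a" "b \<le> b'" "b' - a' = lam * (b - a)" by (auto simp: a'_def b'_def field_simps)
  have d: "dilate lam (a, b) = (a', b')" by (simp add: dilate_def a'_def b'_def)
  define m where "m = (a + b) / 2"
  define D where "D = F b' - F a'"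
  define V where "V = F b - F a"
  define E where "E = \<bar>F a - 2 * F m + F b\<bar>"
  have less: "a' < b'" using ab assms by simp
  have D: "D > 0" and V: "V > 0" using assms(1,3) less by (auto simp: D_def V_def strict_mono_def)
  have m: "a < m" "m < b" using assms by (auto simp: m_def)
  have "F a < F m" "F m < F b" using m assms(3) by (auto simp: strict_mono_def)
  then have EV: "E \<le> V" by (auto simp: E_def V_def)
  have "(E / V * D / (8 * lam)) / (F b' - F a') \<le> beta_lift F (a', b')"
  proof (rule beta_lift_lower[OF less assms(2)])
    show "F a' < F b'" using less assms by (auto simp: strict_mono_def)
    fix c e s assume s: "\<And>x. x \<in> {a'..b'} \<Longrightarrow> \<bar>F x - (c * x + e)\<bar> \<le> s"
    have sa: "\<bar>F a - (c * a + e)\<bar> \<le> s" "\<bar>F m - (c * m + e)\<bar> \<le> s" "\<bar>F b - (c * b + e)\<bar> \<le> s"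
      "\<bar>F a' - (c * a' + e)\<bar> \<le> s" "\<bar>F b' - (c * b' + e)\<bar> \<le> s"
      using ab m assms(1) less by (auto intro!: s)
    have s0: "0 \<le> s" using sa(1) by linarith
    show "E / V * D / (8 * lam) \<le> s"
    proof (cases "D / (8 * lam) \<le> s")
      case True
      \<comment> \<open>Here the error is so large that the trivial bound suffices.\<close>
      have "E / V \<le> 1" using EV V by simp
      then have "E / V * (D / (8 * lam)) \<le> 1 * (D / (8 * lam))" using D assms by (intro mult_right_mono) auto
      then show ?thesis using True by simp
    next
      case False
      then have s8: "8 * lam * s < D" using assms by (simp add: field_simps)
      \<comment> \<open>Affine functions are exact at the midpoint, so at most four times the error remains.\<close>
      have "c * m = (c * a + c * b) / 2" by (simp add: m_def field_simps)
      then have "F a - 2 * F m + F b = (F a - (c * a + e)) - 2 * (F m - (c * m + e)) + (F b - (c * b + e))"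
        by simp
      moreover have "\<bar>p - 2 * q + r\<bar> \<le> 4 * s" if "\<bar>p\<bar> \<le> s" "\<bar>q\<bar> \<le> s" "\<bar>r\<bar> \<le> s" for p q r
        using that by linarith
      ultimately have E4: "E \<le> 4 * s" using sa(1-3) unfolding E_def by presburger
      have "D \<le> c * (b' - a') + 2 * s" using sa(4,5) unfolding D_def right_diff_distrib by linarith
      then have 1: "D \<le> lam * (c * (b - a)) + 2 * s" unfolding ab by (simp add: mult_ac)
      have 2: "c * (b - a) \<le> V + 2 * s" using sa(1,3) unfolding V_def right_diff_distrib by linarith
      have "lam * (c * (b - a)) \<le> lam * (V + 2 * s)" using 2 assms by (intro mult_left_mono) auto
      with 1 have "D \<le> lam * V + 2 * (lam * s) + 2 * s" by (simp add: algebra_simps)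
      moreover have "s \<le> lam * s" using s0 assms by (simp add: mult_le_cancel_right1)
      ultimately have "D \<le> 2 * lam * V" using s8 s0 by linarith
      then have "E * D \<le> (4 * s) * (2 * lam * V)" using E4 s0 D by (intro mult_mono) auto
      then show ?thesis using V assms by (simp add: field_simps)
    qed
  qed
  then have "E / V / (8 * lam) \<le> beta_lift F (a', b')" using D by (simp add: D_def[symmetric])
  moreover have "0 < 8 * lam" using assms(4) by simp
  ultimately have "E / V \<le> beta_lift F (a', b') * (8 * lam)" by (simp only: pos_divide_le_eq)
  then show ?thesis unfolding d E_def[symmetric] V_def[symmetric] m_def[symmetric]
    by (simp only: mult.commute)
qed

definition dyadic_interval :: "real \<Rightarrow> real \<Rightarrow> nat \<Rightarrow> nat \<Rightarrow> real \<times> real" where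
  "dyadic_interval a L n k = (a + real k * L / 2 ^ n, a + real (k + 1) * L / 2 ^ n)"

text \<open>Scale and position can be read off from the endpoints, so summing over the set of intervals is the
same as summing over the index pairs.\<close>

lemma summable_on_dyadic_decomposition:
  fixes f :: "real \<times> real \<Rightarrow> real"
  assumes nn: "\<And>m k. 0 \<le> f (dyadic_interval x0 pi m k)"
  shows "f summable_on dyadic_decomposition x0 \<longleftrightarrow>
    summable (\<lambda>m. \<Sum>k<2 ^ m. f (dyadic_interval x0 pi m k))"
proof -
  define h where "h = (\<lambda>(m, k). dyadic_interval x0 pi m k)"
  define S where "S = (SIGMA m:(UNIV::nat set). {..<2 ^ m :: nat})"
  have le: "k \<le> 2 ^ m - 1 \<longleftrightarrow> k < 2 ^ m" for k m :: nat
    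
  proof -
    have "0 < (2::nat) ^ m" by simp
    then show ?thesis by linarith
  qed
  have D: "dyadic_decomposition x0 = h ` S"
  proof (intro equalityI subsetI)
    fix I assume "I \<in> dyadic_decomposition x0"
    then obtain m k where "k < 2 ^ m" "I = h (m, k)"
      unfolding dyadic_decomposition_def le h_def dyadic_interval_def by auto
    then show "I \<in> h ` S" unfolding S_def by blast
  next
    fix I assume "I \<in> h ` S"
    then obtain m k where "k < 2 ^ m" "I = h (m, k)" unfolding S_def by auto
    then show "I \<in> dyadic_decomposition x0"
      unfolding dyadic_decomposition_def le h_def dyadic_interval_def by auto
  qed
  have inj: "inj_on h S"
  proof (rule inj_onI, clarify)
    fix m k n l assume eq: "h (m, k) = h (n, l)"
    have "real (k + 1) * pi / 2 ^ m - real k * pi / 2 ^ m = real (l + 1) * pi / 2 ^ n - real l * pi / 2 ^ n"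
      using eq by (auto simp: h_def dyadic_interval_def)
    then have "pi / 2 ^ m = pi / 2 ^ n" by (simp add: field_simps)
    then have mn: "m = n" by simp
    then show "m = n \<and> k = l" using eq by (auto simp: h_def dyadic_interval_def)
  qed
  have "f summable_on dyadic_decomposition x0 \<longleftrightarrow> (f \<circ> h) summable_on S"
    unfolding D by (rule summable_on_reindex[OF inj])
  also have "\<dots> \<longleftrightarrow> summable (\<lambda>m. \<Sum>k<2 ^ m. f (h (m, k)))"
  proof
    assume s: "(f \<circ> h) summable_on S"
    show "summable (\<lambda>m. \<Sum>k<2 ^ m. f (h (m, k)))"
    proof (rule summableI_nonneg_bounded)
      show "0 \<le> (\<Sum>k<2 ^ n. f (h (n, k)))" for n by (auto intro!: sum_nonneg nn simp: h_def)
      fix N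
      have "(\<Sum>m<N. \<Sum>k<2 ^ m. f (h (m, k))) = sum (f \<circ> h) (SIGMA m:{..<N}. {..<2 ^ m})"
        by (subst sum.Sigma) auto
      also have "\<dots> \<le> infsum (f \<circ> h) S"
        by (rule finite_sum_le_infsum[OF s]) (auto simp: S_def h_def nn)
      finally show "(\<Sum>m<N. \<Sum>k<2 ^ m. f (h (m, k))) \<le> infsum (f \<circ> h) S" .
    qed
  next
    assume s: "summable (\<lambda>m. \<Sum>k<2 ^ m. f (h (m, k)))"
    show "(f \<circ> h) summable_on S"
    proof (rule nonneg_bdd_above_summable_on)
      show "0 \<le> (f \<circ> h) x" if "x \<in> S" for x using nn by (auto simp: h_def split: prod.splits)
      show "bdd_above (sum (f \<circ> h) ` {G. G \<subseteq> S \<and> finite G})"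
      proof (rule bdd_aboveI, safe)
        fix G assume G: "G \<subseteq> S" "finite G"
        obtain N where N: "\<And>m k. (m, k) \<in> G \<Longrightarrow> m < N"
        proof -
          have "finite (fst ` G)" using G by simp
          from finite_nat_set_iff_bounded[THEN iffD1, OF this]
          obtain N where N: "\<forall>m\<in>fst ` G. m < N" ..
          show ?thesis
          proof (rule that)
            show "m < N" if "(m, k) \<in> G" for m k
              using bspec[OF N imageI[OF that]] by simp
          qed
        qed
        have "sum (f \<circ> h) G \<le> sum (f \<circ> h) (SIGMA m:{..<N}. {..<2 ^ m})"
          using G N by (intro sum_mono2) (auto simp: S_def h_def nn)
        also have "\<dots> = (\<Sum>m<N. \<Sum>k<2 ^ m. f (h (m, k)))"
          by (subst sum.Sigma) auto
        also have "\<dots> \<le> (\<Sum>m. \<Sum>k<2 ^ m. f (h (m, k)))"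
          by (rule sum_le_suminf[OF s]) (auto intro!: sum_nonneg nn simp: h_def)
        finally show "sum (f \<circ> h) G \<le> (\<Sum>m. \<Sum>k<2 ^ m. f (h (m, k)))" .
      qed
    qed
  qed
  finally show ?thesis by (simp add: h_def)
qed

section \<open>The logarithmic density of a lift\<close>

text \<open>The density of \<open>F\<close> is \<open>e\<^sup>U\<close>. Working with \<open>U\<close> makes positivity of the density automatic.\<close>

definition log_density :: "(real \<Rightarrow> real) \<Rightarrow> (real \<Rightarrow> real) \<Rightarrow> bool" where
  "log_density F U \<longleftrightarrow> U \<in> borel_measurable borel \<and> (\<forall>x. U (x + pi) = U x) \<and>
     (\<forall>x y. x \<le> y \<longrightarrow> (\<integral>\<^sup>+t\<in>{x..<y}. ennreal (exp (U t)) \<partial>lborel) = ennreal (F y - F x))"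

lemma nn_integral_endpoints:
  fixes f :: "real \<Rightarrow> ennreal"
  shows "(\<integral>\<^sup>+t\<in>{x<..y}. f t \<partial>lborel) = (\<integral>\<^sup>+t\<in>{x..<y}. f t \<partial>lborel)"
    "(\<integral>\<^sup>+t\<in>{x..y}. f t \<partial>lborel) = (\<integral>\<^sup>+t\<in>{x..<y}. f t \<partial>lborel)"
proof -
  have "AE t in lborel. t \<noteq> x \<and> t \<noteq> y" using AE_lborel_singleton[of x] AE_lborel_singleton[of y] by eventually_elim auto
  then show "(\<integral>\<^sup>+t\<in>{x<..y}. f t \<partial>lborel) = (\<integral>\<^sup>+t\<in>{x..<y}. f t \<partial>lborel)"
    "(\<integral>\<^sup>+t\<in>{x..y}. f t \<partial>lborel) = (\<integral>\<^sup>+t\<in>{x..<y}. f t \<partial>lborel)"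
    by (intro nn_integral_cong_AE; elim AE_mp; intro AE_I2; auto simp: indicator_def)+
qed

text \<open>From now on the statement is about functions on the line. In one direction the density is
recovered by testing against smooth functions; in the other, the function on the circle is
obtained by composing with \<open>rp1_coord\<close>.\<close>

lemma weil_petersson_iff:
  assumes "orientation_preserving_homeo \<phi>"
  shows "weil_petersson \<phi> \<longleftrightarrow> (\<exists>U. log_density (the_lift \<phi>) U \<and>
    (\<integral>\<^sup>+x\<in>{0..<pi}. ennreal ((U x)\<^sup>2) \<partial>lborel) < \<infinity> \<and> circle_energy U < \<infinity>)"
proof -
  define F where "F = the_lift \<phi>"
  obtain F' where "is_lift \<phi> F'" using assms unfolding orientation_preserving_homeo_def by blast
  then have "is_lift \<phi> F" unfolding F_def the_lift_def by (rule someI[of "is_lift \<phi>"])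
  then have F: "strict_mono F" "continuous_on UNIV F"
    by (auto simp: is_lift_def homeomorphism_def)
  have Fm: "F x \<le> F y" if "x \<le> y" for x y using F(1) that by (simp add: strict_mono_less_eq)
  show ?thesis unfolding F_def[symmetric]
  proof
    assume "weil_petersson \<phi>"
    then obtain g where g: "integrable rp1_measure g" "has_distributional_derivative F (\<lambda>x. g (rp1_of x))"
      "AE p in rp1_measure. g p > 0" "(\<lambda>p. ln (g p)) \<in> H_half"
      by (auto simp: weil_petersson_def F_def)
    have gm [measurable]: "g \<in> borel_measurable borel"
      using borel_measurable_integrable[OF g(1)] by (simp add: measurable_cong_sets[OF sets_rp1_measure refl])
    define U where "U x = ln (g (rp1_of x))" for x
    have "AE x in lborel. 0 < g (rp1_of x)"
    proof (rule AE_periodic)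
      show "AE x in lborel. x \<in> {0..<pi} \<longrightarrow> 0 < g (rp1_of x)"
        using g(3) by (subst (asm) AE_rp1_iff) auto
    qed auto
    have "(\<integral>\<^sup>+t\<in>{x..<y}. ennreal (exp (U t)) \<partial>lborel) = ennreal (F y - F x)" if "x \<le> y" for x y
    proof (cases "x = y")
      case False
      then have xy: "x < y" using that by simp
      have si: "set_integrable lborel {x..y} (\<lambda>t. g (rp1_of t))"
        using g(2) by (auto simp: has_distributional_derivative_def locally_integrable_def)
      then have si: "integrable lborel (\<lambda>t. indicator {x<..y} t *\<^sub>R g (rp1_of t))"
        by (intro set_integrable_subset[OF si, unfolded set_integrable_def]) auto
      have "(\<integral>\<^sup>+t\<in>{x..<y}. ennreal (exp (U t)) \<partial>lborel) = (\<integral>\<^sup>+t\<in>{x<..y}. ennreal (exp (U t)) \<partial>lborel)"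
        by (simp add: nn_integral_endpoints)
      also have "\<dots> = (\<integral>\<^sup>+t. ennreal (indicator {x<..y} t *\<^sub>R g (rp1_of t)) \<partial>lborel)"
        using \<open>AE x in lborel. 0 < g (rp1_of x)\<close>
        by (intro nn_integral_cong_AE, elim AE_mp, intro AE_I2) (auto simp: U_def indicator_def)
      also have "\<dots> = ennreal (LINT t:{x<..y}|lborel. g (rp1_of t))"
        unfolding set_lebesgue_integral_def
        by (rule nn_integral_eq_integral[OF si]) (use \<open>AE x in lborel. 0 < g (rp1_of x)\<close> in \<open>elim AE_mp, intro AE_I2, auto simp: indicator_def\<close>)
      also have "\<dots> = ennreal (F y - F x)"
        by (simp add: distributional_derivative_integral[OF g(2) F(2) xy])
      finally show ?thesis .
    qed simp
    moreover have "U \<in> borel_measurable borel" unfolding U_def by measurable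
    ultimately have "log_density F U" by (auto simp: log_density_def U_def)
    moreover have "(\<integral>\<^sup>+x\<in>{0..<pi}. ennreal ((U x)\<^sup>2) \<partial>lborel) < \<infinity>" "circle_energy U < \<infinity>"
      using g(4) unfolding H_half_iff U_def by auto
    ultimately show "\<exists>U. log_density F U \<and> (\<integral>\<^sup>+x\<in>{0..<pi}. ennreal ((U x)\<^sup>2) \<partial>lborel) < \<infinity> \<and> circle_energy U < \<infinity>"
      by blast
  next
    assume "\<exists>U. log_density F U \<and> (\<integral>\<^sup>+x\<in>{0..<pi}. ennreal ((U x)\<^sup>2) \<partial>lborel) < \<infinity> \<and> circle_energy U < \<infinity>"
    then obtain U where U: "log_density F U" "(\<integral>\<^sup>+x\<in>{0..<pi}. ennreal ((U x)\<^sup>2) \<partial>lborel) < \<infinity>" "circle_energy U < \<infinity>"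
      by blast
    have [measurable]: "U \<in> borel_measurable borel" and per: "U (x + pi) = U x"
      and FU: "x \<le> y \<Longrightarrow> (\<integral>\<^sup>+t\<in>{x..<y}. ennreal (exp (U t)) \<partial>lborel) = ennreal (F y - F x)" for x y
      using U(1) by (auto simp: log_density_def)
    define u where "u p = U (rp1_coord p)" for p
    have [measurable]: "u \<in> borel_measurable borel" unfolding u_def by measurable
    have u: "u (rp1_of x) = U x" for x
    proof -
      obtain k :: int where "rp1_coord (rp1_of x) = x + of_int k * pi"
        using rp1_of_eq_iff[of x "rp1_coord (rp1_of x)"] rp1_coord(2)[of "rp1_of x"] by auto
      then show ?thesis by (simp add: u_def periodic_shift_int[of U, OF per])
    qed
    have nn: "(\<integral>\<^sup>+t. ennreal (indicator {x..y} t *\<^sub>R exp (U t)) \<partial>lborel) = ennreal (F y - F x)" if "x \<le> y" for x y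
      using FU[OF that] unfolding nn_integral_endpoints(2)[of _ x y, symmetric]
      by (simp add: ennreal_mult'' ennreal_indicator mult.commute)
    have si: "set_integrable lborel {x..y} (\<lambda>t. exp (U t))" for x y
    proof (cases "x \<le> y")
      case True
      show ?thesis unfolding set_integrable_def
      proof (rule integrableI_nonneg)
        show "(\<integral>\<^sup>+t. ennreal (indicator {x..y} t *\<^sub>R exp (U t)) \<partial>lborel) < \<infinity>"
          unfolding nn[OF True] by simp
      qed auto
    qed (simp add: set_integrable_def)
    have int: "(LINT t:{x..y}|lborel. exp (U t)) = F y - F x" if "x \<le> y" for x y
      unfolding set_lebesgue_integral_def
      by (subst integral_eq_nn_integral) (use nn[OF that] Fm[OF that] in auto)
    show "weil_petersson \<phi>"
      unfolding weil_petersson_def F_def[symmetric]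
    proof (intro conjI exI[of _ "\<lambda>p. exp (u p)"] assms)
      have "set_integrable lborel {0..<pi} (\<lambda>t. exp (U t))"
        by (rule set_integrable_subset[OF si[of 0 pi]]) auto
      then show "integrable rp1_measure (\<lambda>p. exp (u p))"
        by (subst integrable_rp1_iff) (simp_all add: u)
      show "has_distributional_derivative F (\<lambda>x. exp (u (rp1_of x)))"
        unfolding u by (rule integral_has_distributional_derivative[OF F(2) _ _ int])
          (auto simp: locally_integrable_def si)
      show "AE p in rp1_measure. 0 < exp (u p)" by simp
      have "(\<lambda>x. u (rp1_of x)) = U" by (simp add: u)
      then show "(\<lambda>p. ln (exp (u p))) \<in> H_half"
        using U by (simp add: H_half_iff u)
    qed
  qed
qed

section \<open>Dyadic grids and mean oscillation\<close>

text \<open>The left endpoint of the cell of the grid \<open>a + h \<int>\<close> that contains \<open>x\<close>. Step functions on the grid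
are the functions that factor through it.\<close>

definition grid_left :: "real \<Rightarrow> real \<Rightarrow> real \<Rightarrow> real" where
  "grid_left a h x = a + h * of_int \<lfloor>(x - a) / h\<rfloor>"

lemma grid_left_cell:
  assumes "h > 0" "x \<in> {a + real k * h..<a + real (k + 1) * h}"
  shows "grid_left a h x = a + real k * h"
proof -
  have "\<lfloor>(x - a) / h\<rfloor> = int k"
    using assms by (intro floor_unique) (auto simp: field_simps)
  then show ?thesis by (simp add: grid_left_def)
qed

text \<open>The map factors through the integers, on which every function is measurable.\<close>

lemma measurable_grid_left [measurable]:
  fixes f :: "real \<Rightarrow> 'b::topological_space"
  shows "(\<lambda>x. f (grid_left a h x)) \<in> borel_measurable borel"
proof -
  have "(\<lambda>x::real. \<lfloor>(x - a) / h\<rfloor>) \<in> measurable borel (count_space UNIV)" by measurable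
  from measurable_compose[OF this, of "\<lambda>i. f (a + h * of_int i)" borel]
  show ?thesis by (simp add: grid_left_def)
qed

lemma nn_integral_cells:
  assumes [measurable]: "f \<in> borel_measurable borel" and "h \<ge> 0"
  shows "(\<integral>\<^sup>+x\<in>{a..<a + real N * h}. f x \<partial>lborel) =
    (\<Sum>k<N. \<integral>\<^sup>+x\<in>{a + real k * h..<a + real (k + 1) * h}. f x \<partial>lborel)"
proof (induction N)
  case (Suc N)
  have "(\<integral>\<^sup>+x\<in>{a..<a + real (Suc N) * h}. f x \<partial>lborel) =
    (\<integral>\<^sup>+x\<in>{a..<a + real N * h}. f x \<partial>lborel) + (\<integral>\<^sup>+x\<in>{a + real N * h..<a + real (Suc N) * h}. f x \<partial>lborel)"
    by (rule nn_integral_split_Ico) (use assms in \<open>auto simp: algebra_simps\<close>)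
  then show ?case unfolding sum.lessThan_Suc by (simp only: Suc.IH Suc_eq_plus1)
qed simp

lemma nn_integral_grid:
  assumes [measurable]: "(\<lambda>x. f (grid_left a h x) x) \<in> borel_measurable borel" and h: "h > 0"
  shows "(\<integral>\<^sup>+x\<in>{a..<a + real N * h}. f (grid_left a h x) x \<partial>lborel) =
    (\<Sum>k<N. \<integral>\<^sup>+x\<in>{a + real k * h..<a + real (k + 1) * h}. f (a + real k * h) x \<partial>lborel)"
proof -
  have "(\<integral>\<^sup>+x\<in>{a + real k * h..<a + real (k + 1) * h}. f (grid_left a h x) x \<partial>lborel)
    = (\<integral>\<^sup>+x\<in>{a + real k * h..<a + real (k + 1) * h}. f (a + real k * h) x \<partial>lborel)" for k
    by (intro nn_integral_cong) (use grid_left_cell[OF h] in \<open>auto simp: indicator_def\<close>)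
  then show ?thesis by (subst nn_integral_cells) (use h in auto)
qed

lemma nn_integral_const_Ico:
  "a \<le> b \<Longrightarrow> (\<integral>\<^sup>+x\<in>{a..<b::real}. c \<partial>lborel) = c * ennreal (b - a)"
  by (simp add: nn_integral_cmult_indicator)

lemma sum_even_odd:
  fixes f :: "nat \<Rightarrow> 'a::comm_monoid_add"
  shows "(\<Sum>k<2 * N. f k) = (\<Sum>k<N. f (2 * k) + f (2 * k + 1))"
  by (induction N) (simp_all add: add.assoc)

text \<open>The sum of the functions is integrable, so it is finite almost everywhere.\<close>

lemma AE_summable:
  fixes f :: "nat \<Rightarrow> 'a \<Rightarrow> real"
  assumes [measurable]: "\<And>n. f n \<in> borel_measurable M" "A \<in> sets M"
    and nn: "\<And>n x. 0 \<le> f n x"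
    and le: "\<And>N. (\<Sum>n<N. \<integral>\<^sup>+x\<in>A. ennreal (f n x) \<partial>M) \<le> ennreal C"
  shows "AE x in M. x \<in> A \<longrightarrow> summable (\<lambda>n. f n x)"
proof -
  have "(\<integral>\<^sup>+x. (\<Sum>n. ennreal (f n x) * indicator A x) \<partial>M) = (\<Sum>n. \<integral>\<^sup>+x\<in>A. ennreal (f n x) \<partial>M)"
    by (rule nn_integral_suminf) measurable
  also have "\<dots> \<le> ennreal C" by (rule suminf_le_const[OF summableI le])
  finally have "(\<integral>\<^sup>+x. (\<Sum>n. ennreal (f n x) * indicator A x) \<partial>M) \<noteq> \<infinity>"
    by (auto simp: top_unique)
  then have "AE x in M. (\<Sum>n. ennreal (f n x) * indicator A x) \<noteq> \<infinity>"
    by (rule nn_integral_noteq_infinite[rotated]) measurable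
  then show ?thesis
  proof (rule AE_mp, intro AE_I2 impI)
    fix x assume "(\<Sum>n. ennreal (f n x) * indicator A x) \<noteq> \<infinity>" "x \<in> A"
    then show "summable (\<lambda>n. f n x)" by (intro summable_suminf_not_top nn) simp
  qed
qed

definition mean :: "(real \<Rightarrow> real) \<Rightarrow> real \<Rightarrow> real \<Rightarrow> real" where
  "mean U a b = (LINT t:{a..<b}|lborel. U t) / (b - a)"

text \<open>The mean square oscillation, that is, the variance with respect to normalised Lebesgue measure.\<close>

definition osc :: "(real \<Rightarrow> real) \<Rightarrow> real \<Rightarrow> real \<Rightarrow> real" where
  "osc U a b = (LINT t:{a..<b}|lborel. (U t - mean U a b)\<^sup>2) / (b - a)"

lemma osc_nonneg: "a < b \<Longrightarrow> 0 \<le> osc U a b"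
  unfolding osc_def set_lebesgue_integral_def by (intro divide_nonneg_pos integral_nonneg_AE) auto

lemma set_integral_const_Ico: "a \<le> b \<Longrightarrow> (LINT x:{a..<b}|lborel. c) = (b - a) * (c::real)"
  unfolding set_lebesgue_integral_def by (simp add: mult.commute)

lemma set_integrable_const_Ico: "set_integrable lborel {a..<b::real} (\<lambda>x. c::real)"
  unfolding set_integrable_def by (cases "a \<le> b") auto

locale locally_square_integrable =
  fixes U :: "real \<Rightarrow> real"
  assumes U_measurable [measurable]: "U \<in> borel_measurable borel"
    and U_square: "\<And>a b. (\<integral>\<^sup>+x\<in>{a..<b}. ennreal ((U x)\<^sup>2) \<partial>lborel) < \<infinity>"
begin

lemma integrable_square: "set_integrable lborel {a..<b} (\<lambda>x. (U x)\<^sup>2)"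
proof -
  have "(\<integral>\<^sup>+x. ennreal (indicator {a..<b} x *\<^sub>R (U x)\<^sup>2) \<partial>lborel) = (\<integral>\<^sup>+x\<in>{a..<b}. ennreal ((U x)\<^sup>2) \<partial>lborel)"
    by (intro nn_integral_cong) (simp add: indicator_def)
  with U_square[of a b] have "(\<integral>\<^sup>+x. ennreal (indicator {a..<b} x *\<^sub>R (U x)\<^sup>2) \<partial>lborel) < \<infinity>" by simp
  then show ?thesis unfolding set_integrable_def by (intro integrableI_nonneg) auto
qed

lemma integrable_U: "set_integrable lborel {a..<b} U"
proof -
  have "set_integrable lborel {a..<b} (\<lambda>x. 1 + (U x)\<^sup>2)"
    by (intro set_integral_add set_integrable_const_Ico integrable_square)
  then show ?thesis
  proof (rule set_integrable_bound)
    show "AE x in lborel. x \<in> {a..<b} \<longrightarrow> norm (U x) \<le> norm (1 + (U x)\<^sup>2)"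
    proof (intro AE_I2 impI)
      fix x
      have "0 \<le> (\<bar>U x\<bar> - 1)\<^sup>2" by simp
      then have "2 * \<bar>U x\<bar> \<le> 1 + (U x)\<^sup>2" by (simp add: power2_diff)
      then show "norm (U x) \<le> norm (1 + (U x)\<^sup>2)" by (simp add: abs_if)
    qed
  qed (auto simp: set_borel_measurable_def)
qed

lemma integrable_shift_square: "set_integrable lborel {a..<b} (\<lambda>x. (U x - c)\<^sup>2)"
proof -
  have "(U x - c)\<^sup>2 = (U x)\<^sup>2 + (- 2 * c) * U x + c\<^sup>2" for x by (simp add: power2_diff)
  then show ?thesis
    by (simp only:) (intro set_integral_add set_integrable_mult_right set_integrable_const_Ico integrable_square integrable_U impI)
qed

lemma integral_U: "a < b \<Longrightarrow> (LINT t:{a..<b}|lborel. U t) = (b - a) * mean U a b"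
  by (simp add: mean_def)

lemma integral_shift_square:
  assumes "a < b"
  shows "(LINT t:{a..<b}|lborel. (U t - c)\<^sup>2) = (b - a) * (osc U a b + (mean U a b - c)\<^sup>2)"
proof -
  define m where "m = mean U a b"
  have "(U t - c)\<^sup>2 = (U t - m)\<^sup>2 + ((2 * (m - c)) * U t + (c\<^sup>2 - m\<^sup>2))" for t
    by (simp add: power2_eq_square algebra_simps)
  then have "(LINT t:{a..<b}|lborel. (U t - c)\<^sup>2) = (LINT t:{a..<b}|lborel. (U t - m)\<^sup>2 + ((2 * (m - c)) * U t + (c\<^sup>2 - m\<^sup>2)))"
    by simp
  also have "\<dots> = (LINT t:{a..<b}|lborel. (U t - m)\<^sup>2) + (LINT t:{a..<b}|lborel. (2 * (m - c)) * U t + (c\<^sup>2 - m\<^sup>2))"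
    by (intro set_integral_add set_integrable_mult_right set_integrable_const_Ico integrable_shift_square integrable_U impI)
  also have "(LINT t:{a..<b}|lborel. (2 * (m - c)) * U t + (c\<^sup>2 - m\<^sup>2)) = (LINT t:{a..<b}|lborel. (2 * (m - c)) * U t) + (LINT t:{a..<b}|lborel. (c\<^sup>2 - m\<^sup>2))"
    by (intro set_integral_add set_integrable_mult_right set_integrable_const_Ico integrable_U impI)
  also have "(LINT t:{a..<b}|lborel. (2 * (m - c)) * U t) = (2 * (m - c)) * ((b - a) * m)"
    by (simp only: set_integral_mult_right integral_U[OF assms] m_def)
  also have "(LINT t:{a..<b}|lborel. (c\<^sup>2 - m\<^sup>2)) = (b - a) * (c\<^sup>2 - m\<^sup>2)"
    by (rule set_integral_const_Ico) (use assms in simp)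
  also have "(LINT t:{a..<b}|lborel. (U t - m)\<^sup>2) = (b - a) * osc U a b"
    using assms by (simp add: osc_def m_def)
  finally show ?thesis by (simp add: m_def power2_eq_square algebra_simps)
qed

lemma nn_integral_shift_square:
  assumes "a < b"
  shows "(\<integral>\<^sup>+x\<in>{a..<b}. ennreal ((U x - c)\<^sup>2) \<partial>lborel) = ennreal ((b - a) * (osc U a b + (mean U a b - c)\<^sup>2))"
proof -
  have "(\<integral>\<^sup>+x\<in>{a..<b}. ennreal ((U x - c)\<^sup>2) \<partial>lborel) = (\<integral>\<^sup>+x. ennreal (indicator {a..<b} x *\<^sub>R (U x - c)\<^sup>2) \<partial>lborel)"
    by (intro nn_integral_cong) (simp add: indicator_def)
  also have "\<dots> = ennreal (LINT t:{a..<b}|lborel. (U t - c)\<^sup>2)"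
    unfolding set_lebesgue_integral_def
    by (rule nn_integral_eq_integral[OF integrable_shift_square[unfolded set_integrable_def]]) simp
  finally show ?thesis by (simp only: integral_shift_square[OF assms])
qed

text \<open>The variance is half the mean square difference of two independent samples; this form is what
compares directly with the energy.\<close>

lemma nn_integral_double_difference:
  assumes "a < b"
  shows "(\<integral>\<^sup>+x\<in>{a..<b}. (\<integral>\<^sup>+y\<in>{a..<b}. ennreal ((U x - U y)\<^sup>2) \<partial>lborel) \<partial>lborel) = ennreal (2 * (b - a)\<^sup>2 * osc U a b)"
proof -
  define m where "m = mean U a b"
  note o = osc_nonneg[OF assms, of U]
  have "(\<integral>\<^sup>+y\<in>{a..<b}. ennreal ((U x - U y)\<^sup>2) \<partial>lborel) = ennreal ((b - a) * osc U a b) + ennreal (b - a) * ennreal ((U x - m)\<^sup>2)" for x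
    unfolding power2_commute[of "U x"] nn_integral_shift_square[OF assms] m_def
    using assms o by (simp add: distrib_left ennreal_plus ennreal_mult power2_commute[of "U x"])
  then have "(\<integral>\<^sup>+x\<in>{a..<b}. (\<integral>\<^sup>+y\<in>{a..<b}. ennreal ((U x - U y)\<^sup>2) \<partial>lborel) \<partial>lborel)
     = (\<integral>\<^sup>+x. ennreal ((b - a) * osc U a b) * indicator {a..<b} x + ennreal (b - a) * (ennreal ((U x - m)\<^sup>2) * indicator {a..<b} x) \<partial>lborel)"
    by (intro nn_integral_cong) (simp add: distrib_right mult.assoc)
  also have "\<dots> = ennreal ((b - a) * osc U a b) * ennreal (b - a) + ennreal (b - a) * ennreal ((b - a) * osc U a b)"
    using assms by (simp add: nn_integral_add nn_integral_cmult nn_integral_shift_square m_def nn_integral_cmult_indicator)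
  also have "\<dots> = ennreal (2 * (b - a)\<^sup>2 * osc U a b)"
  proof -
    have "ennreal (w * v) * ennreal w + ennreal w * ennreal (w * v) = ennreal (2 * w\<^sup>2 * v)"
      if "0 \<le> w" "0 \<le> v" for w v
      using that by (simp flip: ennreal_mult ennreal_plus add: power2_eq_square mult_ac)
    from this[of "b - a"] show ?thesis using assms o by simp
  qed
  finally show ?thesis .
qed

lemma integral_split:
  fixes a b c :: real
  assumes "set_integrable lborel {a..<b} f" "a \<le> c" "c \<le> b"
  shows "(LINT t:{a..<b}|lborel. f t :: real) = (LINT t:{a..<c}|lborel. f t) + (LINT t:{c..<b}|lborel. f t)"
proof -
  have "{a..<b} = {a..<c} \<union> {c..<b}" using assms by auto
  then show ?thesis
    by (simp only:) (intro set_integral_Un set_integrable_subset[OF assms(1)]; use assms in auto)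
qed

lemma mean_midpoint:
  assumes "a < b"
  shows "mean U a b = (mean U a ((a + b) / 2) + mean U ((a + b) / 2) b) / 2"
proof -
  define c where "c = (a + b) / 2"
  have c: "a < c" "c < b" "c - a = (b - a) / 2" "b - c = (b - a) / 2" using assms by (auto simp: c_def field_simps)
  have "(b - a) * mean U a b = (c - a) * mean U a c + (b - c) * mean U c b"
    using integral_split[OF integrable_U, of a c b] c(1,2) assms by (simp add: integral_U)
  then have "(b - a) * mean U a b = (b - a) * ((mean U a c + mean U c b) / 2)"
    unfolding c by (simp add: field_simps)
  then show ?thesis using assms unfolding c_def by (simp only: mult_cancel_left) auto
qed

text \<open>Replacing \<open>U\<close> on each half by its mean there does not increase the variance.\<close>

lemma child_means_le_osc:
  assumes "a < b"
  shows "((mean U a ((a + b) / 2) - mean U ((a + b) / 2) b) / 2)\<^sup>2 \<le> osc U a b"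
proof -
  define c where "c = (a + b) / 2"
  have c: "a < c" "c < b" "c - a = (b - a) / 2" "b - c = (b - a) / 2" using assms by (auto simp: c_def field_simps)
  define m p q where "m = mean U a b" and "p = mean U a c" and "q = mean U c b"
  have m: "m = (p + q) / 2" using mean_midpoint[OF assms] by (simp add: m_def p_def q_def c_def)
  have "(b - a) * osc U a b = (LINT t:{a..<b}|lborel. (U t - m)\<^sup>2)"
    by (simp add: integral_shift_square[OF assms] m_def)
  also have "\<dots> = (LINT t:{a..<c}|lborel. (U t - m)\<^sup>2) + (LINT t:{c..<b}|lborel. (U t - m)\<^sup>2)"
    by (rule integral_split[OF integrable_shift_square]) (use c in auto)
  also have "\<dots> = (b - a) / 2 * (osc U a c + (p - m)\<^sup>2) + (b - a) / 2 * (osc U c b + (q - m)\<^sup>2)"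
    by (simp only: integral_shift_square[OF c(1)] integral_shift_square[OF c(2)] c p_def q_def)
  also have "\<dots> \<ge> (b - a) / 2 * (0 + (p - m)\<^sup>2) + (b - a) / 2 * (0 + (q - m)\<^sup>2)"
    using assms c osc_nonneg[of a c U] osc_nonneg[of c b U]
    by (intro add_mono mult_left_mono) auto
  also have "(b - a) / 2 * (0 + (p - m)\<^sup>2) + (b - a) / 2 * (0 + (q - m)\<^sup>2) = (b - a) * ((p - q) / 2)\<^sup>2"
    unfolding m by (simp add: power2_eq_square field_simps)
  finally show ?thesis using assms unfolding p_def q_def c_def by (simp only: mult_le_cancel_left_pos diff_gt_0_iff_gt)
qed

end

section \<open>Finite energy makes the beta numbers square summable\<close>

lemma power_two_squared: "((2::real) ^ n)\<^sup>2 = 4 ^ n"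
  by (simp add: power2_eq_square flip: power_mult_distrib)

text \<open>A geometric series is comparable to its last term; the induction keeps track of this through the
additional bound by \<open>4\<^sup>N / 3\<close>.\<close>

lemma geometric_cutoff_sum:
  assumes "0 \<le> R"
  shows "(\<Sum>n<N. if 2 ^ n < R then 4 ^ n else 0) \<le> 4 / 3 * (R::real)\<^sup>2"
proof -
  let ?S = "\<lambda>N. \<Sum>n<N. if 2 ^ n < R then 4 ^ n else 0 :: real"
  have "?S N \<le> 4 ^ N / 3 \<and> ?S N \<le> 4 / 3 * R\<^sup>2"
  proof (induction N)
    case (Suc N)
    show ?case
    proof (cases "2 ^ N < R")
      case True
      have "((2::real) ^ N)\<^sup>2 \<le> R\<^sup>2" using True by (intro power_mono) auto
      then have "4 ^ N \<le> R\<^sup>2" unfolding power_two_squared .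
      then show ?thesis using Suc True by simp
    next
      case False
      then have "?S (Suc N) = ?S N" by simp
      moreover have "(4::real) ^ N \<le> 4 ^ Suc N" by simp
      ultimately show ?thesis using Suc by linarith
    qed
  qed simp
  then show ?thesis by simp
qed

lemma card_nat_window:
  fixes s w :: real
  assumes K: "\<And>k::nat. k \<in> K \<Longrightarrow> s < real k \<and> real k \<le> s + w" and w: "0 \<le> w"
  shows "real (card K) \<le> w + 1"
proof -
  have sub: "int ` K \<subseteq> {\<lfloor>s\<rfloor> + 1..\<lfloor>s + w\<rfloor>}"
  proof safe
    fix k assume "k \<in> K"
    from K[OF this] show "int k \<in> {\<lfloor>s\<rfloor> + 1..\<lfloor>s + w\<rfloor>}" by (simp add: le_floor_iff) linarith
  qed
  have "card K = card (int ` K)" by (simp add: card_image)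
  also have "\<dots> \<le> card {\<lfloor>s\<rfloor> + 1..\<lfloor>s + w\<rfloor>}" by (rule card_mono[OF _ sub]) simp
  finally have "card K \<le> nat (\<lfloor>s + w\<rfloor> - \<lfloor>s\<rfloor>)" by simp
  moreover have "\<lfloor>s\<rfloor> \<le> \<lfloor>s + w\<rfloor>" using w by (intro floor_mono) simp
  ultimately have "real (card K) \<le> real_of_int (\<lfloor>s + w\<rfloor> - \<lfloor>s\<rfloor>)" by linarith
  then show ?thesis by linarith
qed

definition dilated_cell :: "real \<Rightarrow> real \<Rightarrow> real \<Rightarrow> nat \<Rightarrow> nat \<Rightarrow> real set" where
  "dilated_cell a L lam n k = {a + (real k + 1/2) * (L / 2 ^ n) - lam * (L / 2 ^ n) / 2..<
     a + (real k + 1/2) * (L / 2 ^ n) + lam * (L / 2 ^ n) / 2}"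

lemma dilated_cell_overlap_count:
  assumes L: "L > 0" and lam: "1 \<le> lam" and xy: "x \<noteq> y"
  shows "(\<Sum>k<2 ^ n. indicator (dilated_cell a L lam n k) x * indicator (dilated_cell a L lam n k) y)
    \<le> (if 2 ^ n < lam * L / \<bar>x - y\<bar> then lam + 1 else (0::real))"
proof (cases "2 ^ n < lam * L / \<bar>x - y\<bar>")
  case True
  define h where "h = L / 2 ^ n"
  have h: "h > 0" using L by (simp add: h_def)
  let ?K = "{k. k < 2 ^ n \<and> x \<in> dilated_cell a L lam n k}"
  have "(\<Sum>k<2 ^ n. indicator (dilated_cell a L lam n k) x * indicator (dilated_cell a L lam n k) y)
    \<le> (\<Sum>k<2 ^ n. if x \<in> dilated_cell a L lam n k then 1 else (0::real))"
    by (intro sum_mono) (auto simp: indicator_def)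
  also have "\<dots> = real (card ?K)"
    by (subst sum.inter_filter[symmetric]) auto
  also have "\<dots> \<le> lam + 1"
  proof (rule card_nat_window[where s="(x - a) / h - 1/2 - lam/2"])
    fix k assume "k \<in> ?K"
    then have "a + (real k + 1/2) * h - lam * h / 2 \<le> x" "x < a + (real k + 1/2) * h + lam * h / 2"
      by (auto simp: dilated_cell_def h_def)
    then have "(real k + 1/2 - lam/2) * h \<le> x - a" "x - a < (real k + 1/2 + lam/2) * h" by (simp_all add: algebra_simps)
    then have "real k + 1/2 - lam/2 \<le> (x - a) / h" "(x - a) / h < real k + 1/2 + lam/2"
      using h by (simp_all add: pos_le_divide_eq pos_divide_less_eq)
    then show "(x - a) / h - 1/2 - lam/2 < real k \<and> real k \<le> (x - a) / h - 1/2 - lam/2 + lam" by linarith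
  qed (use lam in simp)
  finally show ?thesis using True by simp
next
  case False
  have z: "indicator (dilated_cell a L lam n k) x * indicator (dilated_cell a L lam n k) y = (0::real)" for k
  proof (rule ccontr)
    assume "indicator (dilated_cell a L lam n k) x * indicator (dilated_cell a L lam n k) y \<noteq> (0::real)"
    then have "x \<in> dilated_cell a L lam n k" "y \<in> dilated_cell a L lam n k" by (auto simp: indicator_def split: if_splits)
    moreover have "\<bar>x - y\<bar> < w" if "x \<in> {m - w / 2..<m + w / 2}" "y \<in> {m - w / 2..<m + w / 2}" for m w
      using that by auto
    ultimately have "\<bar>x - y\<bar> < lam * (L / 2 ^ n)" unfolding dilated_cell_def by blast
    then have "2 ^ n < lam * L / \<bar>x - y\<bar>" using xy by (simp add: field_simps)
    then show False using False by simp
  qed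
  show ?thesis using False by (simp only: z sum.neutral_const if_False order_refl)
qed

text \<open>Only scales with \<open>lam L / 2\<^sup>n > \<bar>x - y\<bar>\<close> contribute, each with at most \<open>lam + 1\<close> cells, and the
coefficients grow like \<open>4\<^sup>n\<close>.\<close>

lemma dilated_cell_overlap_sum:
  assumes L: "L > 0" and lam: "1 \<le> lam" and xy: "x \<noteq> y"
  shows "(\<Sum>n<N. \<Sum>k<2 ^ n. indicator (dilated_cell a L lam n k) x * indicator (dilated_cell a L lam n k) y
      / (2 * (lam * (L / 2 ^ n))\<^sup>2)) \<le> (lam + 1) / (x - y)\<^sup>2"
proof -
  define R where "R = lam * L / \<bar>x - y\<bar>"
  define C where "C = (lam + 1) / (2 * (lam * L)\<^sup>2)"
  have R: "0 \<le> R" using L lam by (simp add: R_def)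
  have C: "0 \<le> C" using lam by (simp add: C_def)
  have "(\<Sum>k<2 ^ n. indicator (dilated_cell a L lam n k) x * indicator (dilated_cell a L lam n k) y
      / (2 * (lam * (L / 2 ^ n))\<^sup>2)) \<le> C * (if 2 ^ n < R then 4 ^ n else 0)" for n
  proof -
    have "(\<Sum>k<2 ^ n. indicator (dilated_cell a L lam n k) x * indicator (dilated_cell a L lam n k) y
      / (2 * (lam * (L / 2 ^ n))\<^sup>2)) = (\<Sum>k<2 ^ n. indicator (dilated_cell a L lam n k) x * indicator (dilated_cell a L lam n k) y)
      / (2 * (lam * (L / 2 ^ n))\<^sup>2)" by (simp only: sum_divide_distrib)
    also have "\<dots> \<le> (if 2 ^ n < R then lam + 1 else 0) / (2 * (lam * (L / 2 ^ n))\<^sup>2)"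
      unfolding R_def by (intro divide_right_mono dilated_cell_overlap_count assms) simp
    also have "\<dots> = C * (if 2 ^ n < R then 4 ^ n else 0)"
      using L lam by (simp add: C_def power_divide power_mult_distrib power_two_squared field_simps)
    finally show ?thesis .
  qed
  then have "(\<Sum>n<N. \<Sum>k<2 ^ n. indicator (dilated_cell a L lam n k) x * indicator (dilated_cell a L lam n k) y
      / (2 * (lam * (L / 2 ^ n))\<^sup>2)) \<le> (\<Sum>n<N. C * (if 2 ^ n < R then 4 ^ n else 0))"
    by (rule sum_mono)
  also have "\<dots> = C * (\<Sum>n<N. if 2 ^ n < R then 4 ^ n else 0)" by (simp only: sum_distrib_left)
  also have "\<dots> \<le> C * (4 / 3 * R\<^sup>2)" by (intro mult_left_mono geometric_cutoff_sum R C)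
  also have "\<dots> = (2 / 3) * ((lam + 1) / (x - y)\<^sup>2)"
    using L lam xy by (simp add: C_def R_def power_divide power_mult_distrib field_simps)
  also have "\<dots> \<le> 1 * ((lam + 1) / (x - y)\<^sup>2)" using lam by (intro mult_right_mono) auto
  finally show ?thesis by simp
qed

context locally_square_integrable begin

lemma osc_double_integral:
  assumes "p < q"
  shows "ennreal (osc U p q) = (\<integral>\<^sup>+x. \<integral>\<^sup>+y. ennreal (indicator {p..<q} x * indicator {p..<q} y / (2 * (q - p)\<^sup>2) * (U x - U y)\<^sup>2) \<partial>lborel \<partial>lborel)"
proof -
  define r where "r = 1 / (2 * (q - p)\<^sup>2)"
  have r: "0 \<le> r" "r * (2 * (q - p)\<^sup>2) = 1" using assms by (auto simp: r_def)
  have eq: "ennreal (indicator {p..<q} x * indicator {p..<q} y / (2 * (q - p)\<^sup>2) * (U x - U y)\<^sup>2)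
     = ennreal r * (ennreal ((U x - U y)\<^sup>2) * indicator {p..<q} y) * indicator {p..<q} x" for x y
  proof (cases "x \<in> {p..<q} \<and> y \<in> {p..<q}")
    case True
    have "ennreal (r * (U x - U y)\<^sup>2) = ennreal r * ennreal ((U x - U y)\<^sup>2)"
      by (rule ennreal_mult[OF r(1)]) simp
    then show ?thesis using True by (simp add: r_def)
  next
    case False
    then show ?thesis by (auto simp: indicator_def)
  qed
  have "(\<integral>\<^sup>+x. \<integral>\<^sup>+y. ennreal (indicator {p..<q} x * indicator {p..<q} y / (2 * (q - p)\<^sup>2) * (U x - U y)\<^sup>2) \<partial>lborel \<partial>lborel)
    = (\<integral>\<^sup>+x. ennreal r * ((\<integral>\<^sup>+y\<in>{p..<q}. ennreal ((U x - U y)\<^sup>2) \<partial>lborel) * indicator {p..<q} x) \<partial>lborel)"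
    unfolding eq
    by (intro nn_integral_cong, subst nn_integral_multc, measurable, subst nn_integral_cmult, measurable, rule mult.assoc)
  also have "\<dots> = ennreal r * ennreal (2 * (q - p)\<^sup>2 * osc U p q)"
    by (subst nn_integral_cmult) (simp_all add: nn_integral_double_difference[OF assms])
  also have "\<dots> = ennreal (r * (2 * (q - p)\<^sup>2) * osc U p q)"
  proof -
    have "0 \<le> 2 * (q - p)\<^sup>2 * osc U p q" using osc_nonneg[OF assms, of U] by simp
    from ennreal_mult[OF r(1) this] show ?thesis by (simp only: mult.assoc)
  qed
  also have "\<dots> = ennreal (osc U p q)" by (simp only: r(2) mult_1)
  finally show ?thesis by (rule sym)
qed

text \<open>Each oscillation is a double integral over the square of a cell, and the sum is taken under the
integral sign, where the pointwise overlap bound replaces it by the energy kernel.\<close>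

lemma osc_sum_le:
  assumes L: "L > 0" and lam: "1 \<le> lam" and sub: "\<And>n k. k < 2 ^ n \<Longrightarrow> dilated_cell a L lam n k \<subseteq> {c..<d}"
    and pq: "\<And>n k. dilated_cell a L lam n k = {p n k..<q n k}" "\<And>n k. q n k - p n k = lam * (L / 2 ^ n)"
  shows "(\<Sum>n<N. \<Sum>k<2 ^ n. ennreal (osc U (p n k) (q n k))) \<le>
    ennreal (lam + 1) * (\<integral>\<^sup>+x\<in>{c..<d}. (\<integral>\<^sup>+y\<in>{c..<d}. ennreal ((U x - U y)\<^sup>2 / (x - y)\<^sup>2) \<partial>lborel) \<partial>lborel)"
proof -
  define K where "K n k x y = indicator (dilated_cell a L lam n k) x * indicator (dilated_cell a L lam n k) y
      / (2 * (lam * (L / 2 ^ n))\<^sup>2) * (U x - U y)\<^sup>2" for n k x y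
  have [measurable]: "dilated_cell a L lam n k \<in> sets borel" for n k by (simp add: dilated_cell_def)
  have K0: "0 \<le> K n k x y" for n k x y using L lam by (simp add: K_def)
  have less: "p n k < q n k" for n k
  proof -
    have "0 < lam * (L / 2 ^ n)" using L lam by simp
    then show ?thesis using pq(2)[of n k] by linarith
  qed
  have osc: "ennreal (osc U (p n k) (q n k)) = (\<integral>\<^sup>+x. \<integral>\<^sup>+y. ennreal (K n k x y) \<partial>lborel \<partial>lborel)" for n k
    unfolding osc_double_integral[OF less] pq(1)[symmetric] pq(2) K_def ..
  have Km [measurable]: "(\<lambda>z. ennreal (K n k (fst z) (snd z))) \<in> borel_measurable (lborel \<Otimes>\<^sub>M lborel)" for n k
    unfolding K_def by measurable
  have Km' [measurable]: "(\<lambda>y. ennreal (K n k x y)) \<in> borel_measurable lborel" for n k x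
    unfolding K_def by measurable
  have Km'' [measurable]: "(\<lambda>x. \<integral>\<^sup>+y. ennreal (K n k x y) \<partial>lborel) \<in> borel_measurable lborel" for n k
    unfolding K_def by measurable
  have pt: "(\<Sum>n<N. \<Sum>k<2 ^ n. ennreal (K n k x y)) \<le>
     ennreal (lam + 1) * (ennreal ((U x - U y)\<^sup>2 / (x - y)\<^sup>2) * indicator {c..<d} y) * indicator {c..<d} x" for x y
  proof (cases "x \<in> {c..<d} \<and> y \<in> {c..<d}")
    case True
    have "(\<Sum>n<N. \<Sum>k<2 ^ n. K n k x y) \<le> (lam + 1) * ((U x - U y)\<^sup>2 / (x - y)\<^sup>2)"
    proof (cases "x = y")
      case True then show ?thesis by (simp add: K_def)
    next
      case False
      have "(\<Sum>n<N. \<Sum>k<2 ^ n. K n k x y) = (\<Sum>n<N. \<Sum>k<2 ^ n. indicator (dilated_cell a L lam n k) x * indicator (dilated_cell a L lam n k) y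
      / (2 * (lam * (L / 2 ^ n))\<^sup>2)) * (U x - U y)\<^sup>2"
        unfolding K_def by (simp only: sum_distrib_right)
      also have "\<dots> \<le> (lam + 1) / (x - y)\<^sup>2 * (U x - U y)\<^sup>2"
        by (intro mult_right_mono dilated_cell_overlap_sum L lam False) simp
      finally show ?thesis by simp
    qed
    then have "ennreal (\<Sum>n<N. \<Sum>k<2 ^ n. K n k x y) \<le> ennreal ((lam + 1) * ((U x - U y)\<^sup>2 / (x - y)\<^sup>2))"
      by (rule ennreal_leI)
    moreover have "(\<Sum>n<N. \<Sum>k<2 ^ n. ennreal (K n k x y)) = ennreal (\<Sum>n<N. \<Sum>k<2 ^ n. K n k x y)"
      by (simp add: sum_ennreal K0 sum_nonneg)
    moreover have "ennreal (lam + 1) * (ennreal ((U x - U y)\<^sup>2 / (x - y)\<^sup>2) * indicator {c..<d} y) * indicator {c..<d} x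
        = ennreal ((lam + 1) * ((U x - U y)\<^sup>2 / (x - y)\<^sup>2))"
    proof -
      have "0 \<le> lam + 1" "0 \<le> (U x - U y)\<^sup>2 / (x - y)\<^sup>2" using lam by auto
      from ennreal_mult[OF this] show ?thesis using True by simp
    qed
    ultimately show ?thesis by simp
  next
    case False
    have "K n k x y = 0" if "k < 2 ^ n" for n k
      using False sub[OF that] by (auto simp: K_def indicator_def)
    then show ?thesis by simp
  qed
  have "(\<Sum>n<N. \<Sum>k<2 ^ n. ennreal (osc U (p n k) (q n k))) = (\<integral>\<^sup>+x. \<integral>\<^sup>+y. (\<Sum>n<N. \<Sum>k<2 ^ n. ennreal (K n k x y)) \<partial>lborel \<partial>lborel)"
    unfolding osc by (simp add: nn_integral_sum)
  also have "\<dots> \<le> (\<integral>\<^sup>+x. \<integral>\<^sup>+y. ennreal (lam + 1) * (ennreal ((U x - U y)\<^sup>2 / (x - y)\<^sup>2) * indicator {c..<d} y) * indicator {c..<d} x \<partial>lborel \<partial>lborel)"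
    by (intro nn_integral_mono pt)
  also have "\<dots> = (\<integral>\<^sup>+x. ennreal (lam + 1) * ((\<integral>\<^sup>+y\<in>{c..<d}. ennreal ((U x - U y)\<^sup>2 / (x - y)\<^sup>2) \<partial>lborel) * indicator {c..<d} x) \<partial>lborel)"
    by (intro nn_integral_cong, subst nn_integral_multc, measurable, subst nn_integral_cmult, measurable, rule mult.assoc)
  also have "\<dots> = ennreal (lam + 1) * (\<integral>\<^sup>+x\<in>{c..<d}. (\<integral>\<^sup>+y\<in>{c..<d}. ennreal ((U x - U y)\<^sup>2 / (x - y)\<^sup>2) \<partial>lborel) \<partial>lborel)"
    by (rule nn_integral_cmult) measurable
  finally show ?thesis .
qed

end

text \<open>A Gaussian bound for \<open>2 cosh x\<close>: by second order expansion near \<open>0\<close>, and from \<open>\<bar>x\<bar> \<le> x\<^sup>2\<close> elsewhere.\<close>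

lemma exp_plus_exp_minus_le: "exp x + exp (- x) \<le> 2 * exp (x\<^sup>2)" for x :: real
proof -
  have pos: "exp t + exp (- t) \<le> 2 * exp (t\<^sup>2)" if t: "0 \<le> t" for t :: real
  proof (cases "t \<le> 1")
    case True
    have 1: "exp t \<le> 1 + t + t\<^sup>2" using t True by (rule exp_bound)
    have "1 \<le> (1 - t + t\<^sup>2) * (1 + t)" using t by (simp add: algebra_simps power2_eq_square)
    also have "\<dots> \<le> (1 - t + t\<^sup>2) * exp t"
    proof (rule mult_left_mono[OF exp_ge_add_one_self])
      show "0 \<le> 1 - t + t\<^sup>2" using True by simp
    qed
    finally have 2: "exp (- t) \<le> 1 - t + t\<^sup>2" by (simp add: exp_minus field_simps)
    show ?thesis using 1 2 exp_ge_add_one_self[of "t\<^sup>2"] by linarith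
  next
    case False
    then have "t * 1 \<le> t * t" by (intro mult_left_mono) auto
    then have "exp t \<le> exp (t\<^sup>2)" by (simp add: power2_eq_square)
    moreover have "exp (- t) \<le> exp t" using t by simp
    ultimately show ?thesis by linarith
  qed
  show ?thesis
  proof (cases "0 \<le> x")
    case False
    then show ?thesis using pos[of "- x"] by simp
  qed (rule pos)
qed

context locally_square_integrable begin

text \<open>Exponential integrability from square summable martingale differences. Let \<open>c n k\<close> be the mean of
\<open>U\<close> on the \<open>k\<close>-th cell of generation \<open>n\<close>. The two children of a cell have means \<open>c n k \<plusminus> t\<close> with
\<open>t\<^sup>2\<close> at most the oscillation, so refining multiplies the average \<open>2\<^sup>-\<^sup>n A n\<close> of the exponentials by
at most \<open>cosh (2 t) \<le> e\<^sup>4\<^sup>v\<close>, where \<open>v\<close> is the total oscillation of that generation. The step functions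
converge to \<open>U\<close> almost everywhere since their squared errors have a finite sum, and the bound
passes to the limit by Fatou's lemma.\<close>

lemma exp_moment_le:
  assumes L: "L > 0"
    and S: "\<And>N. (\<Sum>n<N. \<Sum>k<2 ^ n. osc U (a + real k * (L / 2 ^ n)) (a + real (k + 1) * (L / 2 ^ n))) \<le> S"
  shows "(\<integral>\<^sup>+x\<in>{a..<a + L}. ennreal (exp (2 * (U x - mean U a (a + L)))) \<partial>lborel) \<le> ennreal (L * exp (4 * S))"
proof -
  define h where "h n = L / 2 ^ n" for n :: nat
  define c where "c n k = mean U (a + real k * h n) (a + real (k + 1) * h n)" for n k
  define v where "v n k = osc U (a + real k * h n) (a + real (k + 1) * h n)" for n k
  define e where "e n = (\<Sum>k<2 ^ n. v n k)" for n
  have h: "h n > 0" "h n \<le> L" "h (Suc n) = h n / 2" "real (2 ^ n) * h n = L" for n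
    using L one_le_power[of "2::real" n] by (auto simp: h_def field_simps)
  have less: "a + real k * h n < a + real (k + 1) * h n" for n k
    using h(1)[of n] by (simp add: algebra_simps)
  have v0: "0 \<le> v n k" for n k unfolding v_def by (rule osc_nonneg[OF less])
  have e0: "0 \<le> e n" for n unfolding e_def by (intro sum_nonneg v0)
  have eS: "(\<Sum>n<N. e n) \<le> S" for N using S[of N] by (simp only: e_def v_def h_def)
  have c0: "c 0 0 = mean U a (a + L)" by (simp add: c_def h_def)
  have mid: "((a + real k * h n) + (a + real (k + 1) * h n)) / 2 = a + real (2 * k + 1) * h (Suc n)"
    "a + real k * h n = a + real (2 * k) * h (Suc n)" "a + real (k + 1) * h n = a + real (2 * k + 1 + 1) * h (Suc n)" for n k
    by (simp_all add: h(3) field_simps)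
  have cm: "c n k = (c (Suc n) (2 * k) + c (Suc n) (2 * k + 1)) / 2"
    "((c (Suc n) (2 * k) - c (Suc n) (2 * k + 1)) / 2)\<^sup>2 \<le> v n k" for n k
    using mean_midpoint[OF less[of k n]] child_means_le_osc[OF less[of k n]]
    unfolding mid(1) unfolding c_def v_def mid(2)[of k n, symmetric] mid(3)[of k n, symmetric] .
  define A where "A n = (\<Sum>k<2 ^ n. exp (2 * (c n k - c 0 0)))" for n
  have A: "A n \<le> 2 ^ n * exp (4 * (\<Sum>m<n. e m))" for n
  proof (induction n)
    case 0 show ?case by (simp add: A_def)
  next
    case (Suc n)
    have "A (Suc n) = (\<Sum>k<2 ^ n. exp (2 * (c (Suc n) (2 * k) - c 0 0)) + exp (2 * (c (Suc n) (2 * k + 1) - c 0 0)))"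
      unfolding A_def power_Suc by (rule sum_even_odd)
    also have "\<dots> \<le> (\<Sum>k<2 ^ n. exp (2 * (c n k - c 0 0)) * (2 * exp (4 * e n)))"
    proof (rule sum_mono)
      fix k :: nat assume "k \<in> {..<2 ^ n}"
      then have "v n k \<le> e n" unfolding e_def by (intro member_le_sum v0) auto
      define t where "t = (c (Suc n) (2 * k) - c (Suc n) (2 * k + 1)) / 2"
      have t: "c (Suc n) (2 * k) = c n k + t" "c (Suc n) (2 * k + 1) = c n k - t"
        using cm(1)[of n k] by (simp_all add: t_def field_simps)
      have "exp (2 * (c (Suc n) (2 * k) - c 0 0)) + exp (2 * (c (Suc n) (2 * k + 1) - c 0 0))
        = exp (2 * (c n k - c 0 0)) * (exp (2 * t) + exp (- (2 * t)))"
        unfolding t by (simp add: distrib_left algebra_simps flip: exp_add)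
      also have "\<dots> \<le> exp (2 * (c n k - c 0 0)) * (2 * exp ((2 * t)\<^sup>2))"
        by (intro mult_left_mono exp_plus_exp_minus_le) simp
      also have "\<dots> \<le> exp (2 * (c n k - c 0 0)) * (2 * exp (4 * e n))"
      proof -
        have "t\<^sup>2 \<le> e n" using cm(2)[of n k] \<open>v n k \<le> e n\<close> unfolding t_def by (rule order_trans)
        then show ?thesis by (simp add: power_mult_distrib)
      qed
      finally show "exp (2 * (c (Suc n) (2 * k) - c 0 0)) + exp (2 * (c (Suc n) (2 * k + 1) - c 0 0))
        \<le> exp (2 * (c n k - c 0 0)) * (2 * exp (4 * e n))" .
    qed
    also have "\<dots> = A n * (2 * exp (4 * e n))" unfolding A_def by (simp only: sum_distrib_right)
    also have "\<dots> \<le> (2 ^ n * exp (4 * (\<Sum>m<n. e m))) * (2 * exp (4 * e n))"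
      by (intro mult_right_mono Suc.IH) simp
    also have "\<dots> = 2 ^ Suc n * exp (4 * (\<Sum>m<Suc n. e m))"
      by (simp add: distrib_left exp_add)
    finally show ?case .
  qed
  \<comment> \<open>The conditional expectation of \<open>U\<close> given its cell of generation \<open>n\<close>.\<close>
  define V where "V n x = mean U (grid_left a (h n) x) (grid_left a (h n) x + h n)" for n x
  have Vm [measurable]: "V n \<in> borel_measurable borel" for n
    unfolding V_def by (rule measurable_grid_left)
  have Vc: "mean U (a + real k * h n) (a + real k * h n + h n) = c n k" for n k
    by (simp add: c_def algebra_simps)
  have J: "{a..<a + L} = {a..<a + real (2 ^ n) * h n}" for n by (simp only: h(4))
  have I1: "(\<integral>\<^sup>+x\<in>{a..<a + L}. ennreal ((U x - V n x)\<^sup>2) \<partial>lborel) = ennreal (h n * e n)" for n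
  proof -
    have "(\<integral>\<^sup>+x\<in>{a..<a + L}. ennreal ((U x - V n x)\<^sup>2) \<partial>lborel)
      = (\<Sum>k<2 ^ n. \<integral>\<^sup>+x\<in>{a + real k * h n..<a + real (k + 1) * h n}. ennreal ((U x - c n k)\<^sup>2) \<partial>lborel)"
      unfolding J[of n] V_def
      by (subst nn_integral_grid[where f="\<lambda>l x. ennreal ((U x - mean U l (l + h n))\<^sup>2)"]) (use h in \<open>simp_all only: Vc, measurable\<close>)
    also have "\<dots> = (\<Sum>k<2 ^ n. ennreal (h n * v n k))"
    proof (rule sum.cong[OF refl])
      fix k
      have "a + real (k + 1) * h n - (a + real k * h n) = h n" by (simp add: algebra_simps)
      then show "(\<integral>\<^sup>+x\<in>{a + real k * h n..<a + real (k + 1) * h n}. ennreal ((U x - c n k)\<^sup>2) \<partial>lborel) = ennreal (h n * v n k)"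
        unfolding nn_integral_shift_square[OF less] by (simp add: c_def v_def)
    qed
    also have "\<dots> = ennreal (h n * e n)"
      using h(1)[of n] v0 by (simp add: e_def sum_distrib_left)
    finally show ?thesis .
  qed
  have "AE x in lborel. x \<in> {a..<a + L} \<longrightarrow> summable (\<lambda>n. (U x - V n x)\<^sup>2)"
  proof (rule AE_summable)
    fix N
    have "(\<Sum>n<N. \<integral>\<^sup>+x\<in>{a..<a + L}. ennreal ((U x - V n x)\<^sup>2) \<partial>lborel) = ennreal (\<Sum>n<N. h n * e n)"
      unfolding I1 using h e0 by (intro sum_ennreal) (simp add: less_imp_le)
    also have "(\<Sum>n<N. h n * e n) \<le> (\<Sum>n<N. L * e n)" by (intro sum_mono mult_right_mono h e0)
    also have "(\<Sum>n<N. L * e n) \<le> L * S" using eS[of N] L by (simp flip: sum_distrib_left)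
    finally show "(\<Sum>n<N. \<integral>\<^sup>+x\<in>{a..<a + L}. ennreal ((U x - V n x)\<^sup>2) \<partial>lborel) \<le> ennreal (L * S)"
      by (simp add: ennreal_leI)
  qed auto
  then have lim: "AE x in lborel. x \<in> {a..<a + L} \<longrightarrow> (\<lambda>n. V n x) \<longlonglongrightarrow> U x"
  proof (rule AE_mp, intro AE_I2 impI)
    fix x assume "x \<in> {a..<a + L} \<longrightarrow> summable (\<lambda>n. (U x - V n x)\<^sup>2)" "x \<in> {a..<a + L}"
    then have "(\<lambda>n. (U x - V n x)\<^sup>2) \<longlonglongrightarrow> 0" by (intro summable_LIMSEQ_zero) blast
    then have "(\<lambda>n. U x - V n x) \<longlonglongrightarrow> 0" by simp
    then have "(\<lambda>n. U x - (U x - V n x)) \<longlonglongrightarrow> U x - 0" by (intro tendsto_diff tendsto_const)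
    then show "(\<lambda>n. V n x) \<longlonglongrightarrow> U x" by simp
  qed
  have I2: "(\<integral>\<^sup>+x\<in>{a..<a + L}. ennreal (exp (2 * (V n x - c 0 0))) \<partial>lborel) \<le> ennreal (L * exp (4 * S))" for n
  proof -
    have "(\<integral>\<^sup>+x\<in>{a..<a + L}. ennreal (exp (2 * (V n x - c 0 0))) \<partial>lborel)
      = (\<Sum>k<2 ^ n. \<integral>\<^sup>+x\<in>{a + real k * h n..<a + real (k + 1) * h n}. ennreal (exp (2 * (c n k - c 0 0))) \<partial>lborel)"
      unfolding J[of n] V_def
      by (subst nn_integral_grid[where f="\<lambda>l x. ennreal (exp (2 * (mean U l (l + h n) - c 0 0)))"]) (use h in \<open>simp_all only: Vc, measurable\<close>)
    also have "\<dots> = (\<Sum>k<2 ^ n. ennreal (exp (2 * (c n k - c 0 0)) * h n))"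
    proof (rule sum.cong[OF refl])
      fix k
      have w: "a + real (k + 1) * h n - (a + real k * h n) = h n" by (simp add: algebra_simps)
      show "(\<integral>\<^sup>+x\<in>{a + real k * h n..<a + real (k + 1) * h n}. ennreal (exp (2 * (c n k - c 0 0))) \<partial>lborel) = ennreal (exp (2 * (c n k - c 0 0)) * h n)"
        by (subst nn_integral_const_Ico[OF less_imp_le[OF less]]) (simp only: w ennreal_mult'' h(1)[THEN less_imp_le])
    qed
    also have "\<dots> = ennreal (A n * h n)"
      using h(1)[of n] by (simp add: A_def sum_distrib_right)
    also have "A n * h n \<le> (2 ^ n * exp (4 * (\<Sum>m<n. e m))) * h n" by (intro mult_right_mono A h(1)[THEN less_imp_le])
    also have "\<dots> = L * exp (4 * (\<Sum>m<n. e m))" using h(4)[of n] by (simp add: mult_ac)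
    also have "\<dots> \<le> L * exp (4 * S)" using eS[of n] L by simp
    finally show ?thesis by (simp add: ennreal_leI)
  qed
  have "(\<integral>\<^sup>+x\<in>{a..<a + L}. ennreal (exp (2 * (U x - c 0 0))) \<partial>lborel)
    = (\<integral>\<^sup>+x. liminf (\<lambda>n. ennreal (exp (2 * (V n x - c 0 0))) * indicator {a..<a + L} x) \<partial>lborel)"
  proof (rule nn_integral_cong_AE, rule AE_mp[OF lim], intro AE_I2 impI)
    fix x assume x: "x \<in> {a..<a + L} \<longrightarrow> (\<lambda>n. V n x) \<longlonglongrightarrow> U x"
    have "(\<lambda>n. ennreal (exp (2 * (V n x - c 0 0))) * indicator {a..<a + L} x) \<longlonglongrightarrow> ennreal (exp (2 * (U x - c 0 0))) * indicator {a..<a + L} x"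
    proof (cases "x \<in> {a..<a + L}")
      case True
      then have "(\<lambda>n. ennreal (exp (2 * (V n x - c 0 0)))) \<longlonglongrightarrow> ennreal (exp (2 * (U x - c 0 0)))"
        using x by (intro tendsto_ennrealI tendsto_intros) auto
      then show ?thesis using True by simp
    qed simp
    then show "ennreal (exp (2 * (U x - c 0 0))) * indicator {a..<a + L} x = liminf (\<lambda>n. ennreal (exp (2 * (V n x - c 0 0))) * indicator {a..<a + L} x)"
      by (rule lim_imp_Liminf[OF sequentially_bot, symmetric])
  qed
  also have "\<dots> \<le> liminf (\<lambda>n. \<integral>\<^sup>+x\<in>{a..<a + L}. ennreal (exp (2 * (V n x - c 0 0))) \<partial>lborel)"
    by (rule nn_integral_liminf) measurable
  also have "\<dots> \<le> limsup (\<lambda>n. \<integral>\<^sup>+x\<in>{a..<a + L}. ennreal (exp (2 * (V n x - c 0 0))) \<partial>lborel)"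
    by (rule Liminf_le_Limsup) simp
  also have "\<dots> \<le> ennreal (L * exp (4 * S))" by (rule Limsup_bounded, rule always_eventually, rule allI, rule I2)
  finally show ?thesis by (simp only: c0)
qed

end

context locally_square_integrable begin

text \<open>With \<open>v = U - c\<close>, where \<open>c\<close> is the mean, compare \<open>F\<close> with the affine function of slope \<open>e\<^sup>c\<close>. The
error is at most \<open>e\<^sup>c\<close> times the integral of \<open>\<bar>e\<^sup>v - 1\<bar> \<le> \<bar>v\<bar> (1 + e\<^sup>v)\<close>, to which Cauchy--Schwarz
applies, and the increment of \<open>F\<close> is at least \<open>e\<^sup>c (b - a)\<close> because \<open>e\<^sup>v \<ge> 1 + v\<close> and \<open>v\<close> has mean
zero.\<close>

lemma beta_sq_le_osc:
  assumes F: "continuous_on UNIV F" "strict_mono F"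
    and FU: "\<And>x y. x \<le> y \<Longrightarrow> (\<integral>\<^sup>+t\<in>{x..<y}. ennreal (exp (U t)) \<partial>lborel) = ennreal (F y - F x)"
    and ab: "a < b"
    and K: "(\<integral>\<^sup>+x\<in>{a..<b}. ennreal (exp (2 * (U x - mean U a b))) \<partial>lborel) \<le> ennreal ((b - a) * K)" "0 \<le> K"
  shows "(beta_lift F (a, b))\<^sup>2 \<le> 2 * (1 + K) * osc U a b"
proof -
  define c where "c = mean U a b"
  define w where "w = b - a"
  have w: "w > 0" using ab by (simp add: w_def)
  have Fm: "F x \<le> F y" if "x \<le> y" for x y using F(2) that by (simp add: strict_mono_less_eq)
  have nn: "(\<integral>\<^sup>+t. ennreal (indicator {x..<y} t *\<^sub>R exp (U t)) \<partial>lborel) = ennreal (F y - F x)" if "x \<le> y" for x y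
  proof -
    have "(\<integral>\<^sup>+t. ennreal (indicator {x..<y} t *\<^sub>R exp (U t)) \<partial>lborel) = (\<integral>\<^sup>+t\<in>{x..<y}. ennreal (exp (U t)) \<partial>lborel)"
      by (intro nn_integral_cong) (simp add: indicator_def)
    then show ?thesis by (simp only: FU[OF that])
  qed
  have si: "set_integrable lborel {x..<y} (\<lambda>t. exp (U t))" if "x \<le> y" for x y
    unfolding set_integrable_def
  proof (rule integrableI_nonneg)
    show "(\<integral>\<^sup>+t. ennreal (indicator {x..<y} t *\<^sub>R exp (U t)) \<partial>lborel) < \<infinity>"
      unfolding nn[OF that] by simp
  qed auto
  have int: "(LINT t:{x..<y}|lborel. exp (U t)) = F y - F x" if "x \<le> y" for x y
  proof -
    have "ennreal (LINT t:{x..<y}|lborel. exp (U t)) = ennreal (F y - F x)"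
      unfolding set_lebesgue_integral_def nn[OF that, symmetric]
      by (rule nn_integral_eq_integral[OF si[OF that, unfolded set_integrable_def], symmetric]) simp
    moreover have "0 \<le> (LINT t:{x..<y}|lborel. exp (U t))"
      unfolding set_lebesgue_integral_def by (rule Bochner_Integration.integral_nonneg) simp
    ultimately show ?thesis using Fm[OF that] by simp
  qed
  have sid: "set_integrable lborel {x..<y} (\<lambda>t. exp (U t) - exp c)" if "x \<le> y" for x y
    by (intro set_integral_diff si[OF that] set_integrable_const_Ico)
  define N where "N = (LINT t:{a..<b}|lborel. \<bar>exp (U t) - exp c\<bar>)"
  have siN: "set_integrable lborel {a..<b} (\<lambda>t. \<bar>exp (U t) - exp c\<bar>)"
    by (intro set_integrable_abs sid) (use ab in simp)
  have N0: "0 \<le> N" unfolding N_def set_lebesgue_integral_def by (rule Bochner_Integration.integral_nonneg) simp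
  have aff: "\<bar>F x - (exp c * x + (F a - exp c * a))\<bar> \<le> N" if x: "x \<in> {a..b}" for x
  proof -
    have ax: "a \<le> x" using x by simp
    have "F x - F a - exp c * (x - a) = (LINT t:{a..<x}|lborel. exp (U t)) - (LINT t:{a..<x}|lborel. exp c)"
      by (simp add: int[OF ax] set_integral_const_Ico[OF ax])
    also have "\<dots> = (LINT t:{a..<x}|lborel. exp (U t) - exp c)"
      by (rule set_integral_diff(2)[symmetric, OF si[OF ax] set_integrable_const_Ico])
    finally have eq: "F x - F a - exp c * (x - a) = (LINT t:{a..<x}|lborel. exp (U t) - exp c)" .
    have "\<bar>LINT t:{a..<x}|lborel. exp (U t) - exp c\<bar> \<le> (LINT t|lborel. norm (indicator {a..<x} t *\<^sub>R (exp (U t) - exp c)))"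
      unfolding set_lebesgue_integral_def using integral_norm_bound[of lborel "\<lambda>t. indicator {a..<x} t *\<^sub>R (exp (U t) - exp c)"] by simp
    also have "\<dots> \<le> (LINT t|lborel. indicator {a..<b} t *\<^sub>R \<bar>exp (U t) - exp c\<bar>)"
    proof (rule integral_mono)
      show "integrable lborel (\<lambda>t. norm (indicator {a..<x} t *\<^sub>R (exp (U t) - exp c)))"
        by (rule integrable_norm) (rule sid[OF ax, unfolded set_integrable_def])
      show "integrable lborel (\<lambda>t. indicator {a..<b} t *\<^sub>R \<bar>exp (U t) - exp c\<bar>)"
        by (rule siN[unfolded set_integrable_def])
      show "norm (indicator {a..<x} t *\<^sub>R (exp (U t) - exp c)) \<le> indicator {a..<b} t *\<^sub>R \<bar>exp (U t) - exp c\<bar>" for t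
        using x by (auto simp: indicator_def)
    qed
    also have "\<dots> = N" by (simp add: N_def set_lebesgue_integral_def)
    finally have "\<bar>F x - F a - exp c * (x - a)\<bar> \<le> N" by (simp only: eq)
    moreover have "F x - (exp c * x + (F a - exp c * a)) = F x - F a - exp c * (x - a)" by (simp add: algebra_simps)
    ultimately show ?thesis by simp
  qed
  \<comment> \<open>Jensen, by the tangent of the exponential function at \<open>c\<close>.\<close>
  have D: "exp c * w \<le> F b - F a"
  proof -
    have "(LINT t:{a..<b}|lborel. exp c * (1 - c) + exp c * U t) = (LINT t:{a..<b}|lborel. exp c * (1 - c)) + (LINT t:{a..<b}|lborel. exp c * U t)"
      by (intro set_integral_add set_integrable_const_Ico set_integrable_mult_right integrable_U impI)
    also have "\<dots> = exp c * w"
      using ab by (simp add: set_integral_const_Ico integral_U c_def w_def algebra_simps)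
    finally have "exp c * w = (LINT t:{a..<b}|lborel. exp c * (1 - c) + exp c * U t)" by simp
    also have "\<dots> \<le> (LINT t:{a..<b}|lborel. exp (U t))"
    proof (rule set_integral_mono)
      show "set_integrable lborel {a..<b} (\<lambda>t. exp c * (1 - c) + exp c * U t)"
        by (intro set_integral_add set_integrable_const_Ico set_integrable_mult_right integrable_U impI)
      show "set_integrable lborel {a..<b} (\<lambda>t. exp (U t))" by (rule si) (use ab in simp)
      fix t
      have "exp c * (1 - c) + exp c * U t = exp c * (1 + (U t - c))" by (simp add: algebra_simps)
      also have "\<dots> \<le> exp c * exp (U t - c)" by (intro mult_left_mono exp_ge_add_one_self) simp
      also have "\<dots> = exp (U t)" by (simp flip: exp_add)
      finally show "exp c * (1 - c) + exp c * U t \<le> exp (U t)" .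
    qed
    also have "\<dots> = F b - F a" by (rule int) (use ab in simp)
    finally show ?thesis .
  qed
  define X where "X = (w * osc U a b) * (2 * w * (1 + K))"
  define f where "f x = ennreal \<bar>U x - c\<bar> * indicator {a..<b} x" for x
  define g where "g x = ennreal (1 + exp (U x - c)) * indicator {a..<b} x" for x
  have [measurable]: "f \<in> borel_measurable borel" "g \<in> borel_measurable borel" unfolding f_def g_def by measurable
  have f2: "(\<integral>\<^sup>+x. (f x)\<^sup>2 \<partial>lborel) = ennreal (w * osc U a b)"
  proof -
    have "(\<integral>\<^sup>+x. (f x)\<^sup>2 \<partial>lborel) = (\<integral>\<^sup>+x\<in>{a..<b}. ennreal ((U x - c)\<^sup>2) \<partial>lborel)"
      by (intro nn_integral_cong) (simp add: f_def indicator_def ennreal_power)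
    then show ?thesis by (simp add: nn_integral_shift_square[OF ab] c_def w_def)
  qed
  have g2: "(\<integral>\<^sup>+x. (g x)\<^sup>2 \<partial>lborel) \<le> ennreal (2 * w * (1 + K))"
  proof -
    have "(\<integral>\<^sup>+x. (g x)\<^sup>2 \<partial>lborel) \<le> (\<integral>\<^sup>+x. 2 * indicator {a..<b} x + 2 * (ennreal (exp (2 * (U x - c))) * indicator {a..<b} x) \<partial>lborel)"
    proof (rule nn_integral_mono)
      fix x
      have "(1 + exp (U x - c))\<^sup>2 \<le> 2 + 2 * exp (2 * (U x - c))"
      proof -
        have "0 \<le> (1 - exp (U x - c))\<^sup>2" by simp
        moreover have "exp (2 * (U x - c)) = (exp (U x - c))\<^sup>2" by (simp only: exp_double)
        ultimately show ?thesis by (simp add: power2_eq_square algebra_simps)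
      qed
      then have "ennreal ((1 + exp (U x - c))\<^sup>2) \<le> ennreal (2 + 2 * exp (2 * (U x - c)))" by (rule ennreal_leI)
      also have "\<dots> = 2 + 2 * ennreal (exp (2 * (U x - c)))" by (simp add: ennreal_plus ennreal_mult)
      finally show "(g x)\<^sup>2 \<le> 2 * indicator {a..<b} x + 2 * (ennreal (exp (2 * (U x - c))) * indicator {a..<b} x)"
        by (cases "x \<in> {a..<b}") (simp_all add: g_def ennreal_power del: ennreal_plus)
    qed
    also have "\<dots> = 2 * ennreal w + 2 * (\<integral>\<^sup>+x\<in>{a..<b}. ennreal (exp (2 * (U x - c))) \<partial>lborel)"
      using ab by (simp add: nn_integral_add nn_integral_cmult nn_integral_cmult_indicator w_def)
    also have "\<dots> \<le> 2 * ennreal w + 2 * ennreal (w * K)"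
      using K(1) unfolding c_def[symmetric] w_def[symmetric] by (intro add_left_mono mult_left_mono) auto
    also have "\<dots> = ennreal (2 * w) + ennreal (2 * (w * K))"
      using w K(2) by (simp add: ennreal_mult)
    also have "\<dots> = ennreal (2 * w * (1 + K))"
      using w K(2) by (subst ennreal_plus[symmetric]) (auto simp: algebra_simps)
    finally show ?thesis .
  qed
  have "ennreal N = (\<integral>\<^sup>+x. ennreal (indicator {a..<b} x *\<^sub>R \<bar>exp (U x) - exp c\<bar>) \<partial>lborel)"
    unfolding N_def set_lebesgue_integral_def
    by (rule nn_integral_eq_integral[OF siN[unfolded set_integrable_def], symmetric]) simp
  also have "\<dots> \<le> (\<integral>\<^sup>+x. ennreal (exp c) * (f x * g x) \<partial>lborel)"
  proof (rule nn_integral_mono)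
    fix x
    define v where "v = U x - c"
    have v: "exp (U x) = exp c * exp v" by (simp add: v_def flip: exp_add)
    have "\<bar>exp v - 1\<bar> \<le> \<bar>v\<bar> * (1 + exp v)"
    proof (cases "0 \<le> v")
      case True
      have "1 + (- v) \<le> exp (- v)" by (rule exp_ge_add_one_self)
      then have "(1 - v) * exp v \<le> exp (- v) * exp v" by (intro mult_right_mono) auto
      then have "exp v - v * exp v \<le> 1" by (simp add: algebra_simps flip: exp_add)
      then show ?thesis using True by (simp add: algebra_simps)
    next
      case False
      have "1 + v \<le> exp v" by (rule exp_ge_add_one_self)
      moreover have "v * exp v \<le> 0" using False by (intro mult_nonpos_nonneg) auto
      ultimately have "1 - exp v \<le> - v - v * exp v" by linarith
      moreover have "\<bar>exp v - 1\<bar> = 1 - exp v" "\<bar>v\<bar> * (1 + exp v) = - v - v * exp v"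
        using False by (simp_all add: algebra_simps)
      ultimately show ?thesis by simp
    qed
    then have "exp c * \<bar>exp v - 1\<bar> \<le> exp c * (\<bar>v\<bar> * (1 + exp v))" by (intro mult_left_mono) auto
    moreover have "\<bar>exp (U x) - exp c\<bar> = exp c * \<bar>exp v - 1\<bar>"
    proof -
      have "exp (U x) - exp c = exp c * (exp v - 1)" unfolding v by (simp add: algebra_simps)
      then show ?thesis by (simp only: abs_mult abs_exp_cancel)
    qed
    ultimately have "ennreal \<bar>exp (U x) - exp c\<bar> \<le> ennreal (exp c * (\<bar>v\<bar> * (1 + exp v)))"
      by (intro ennreal_leI) simp
    also have "\<dots> = ennreal (exp c) * (ennreal \<bar>v\<bar> * ennreal (1 + exp v))"
    proof -
      have "0 \<le> exp c" "0 \<le> \<bar>v\<bar>" "0 \<le> 1 + exp v" by (auto simp: add_nonneg_nonneg)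
      then show ?thesis by (simp only: ennreal_mult mult_nonneg_nonneg)
    qed
    finally show "ennreal (indicator {a..<b} x *\<^sub>R \<bar>exp (U x) - exp c\<bar>) \<le> ennreal (exp c) * (f x * g x)"
      by (cases "x \<in> {a..<b}") (simp_all add: f_def g_def v_def del: ennreal_plus)
  qed
  also have "\<dots> = ennreal (exp c) * (\<integral>\<^sup>+x. f x * g x \<partial>lborel)" by (rule nn_integral_cmult) measurable
  finally have "(ennreal N)\<^sup>2 \<le> (ennreal (exp c) * (\<integral>\<^sup>+x. f x * g x \<partial>lborel))\<^sup>2" by (rule power_mono) simp
  also have "\<dots> = (ennreal (exp c))\<^sup>2 * (\<integral>\<^sup>+x. f x * g x \<partial>lborel)\<^sup>2" by (rule power_mult_distrib)
  also have "\<dots> \<le> (ennreal (exp c))\<^sup>2 * ((\<integral>\<^sup>+x. (f x)\<^sup>2 \<partial>lborel) * (\<integral>\<^sup>+x. (g x)\<^sup>2 \<partial>lborel))"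
    by (intro mult_left_mono Cauchy_Schwarz_nn_integral) auto
  also have "\<dots> \<le> (ennreal (exp c))\<^sup>2 * (ennreal (w * osc U a b) * ennreal (2 * w * (1 + K)))"
    unfolding f2 by (intro mult_left_mono g2) auto
  also have "\<dots> = ennreal ((exp c)\<^sup>2 * X)"
  proof -
    have "0 \<le> w * osc U a b" "0 \<le> 2 * w * (1 + K)" "0 \<le> exp c" "0 \<le> (exp c)\<^sup>2" "0 \<le> X"
      using w K(2) osc_nonneg[OF ab, of U] by (auto simp: X_def)
    then show ?thesis unfolding X_def by (simp only: ennreal_mult ennreal_power)
  qed
  finally have "ennreal (N\<^sup>2) \<le> ennreal ((exp c)\<^sup>2 * X)" using N0 by (simp add: ennreal_power)
  moreover have "0 \<le> (exp c)\<^sup>2 * X" using w K(2) osc_nonneg[OF ab, of U] by (auto simp: X_def)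
  ultimately have N2: "N\<^sup>2 \<le> (exp c)\<^sup>2 * X" by (simp only: ennreal_le_iff)
  have Fab: "F a < F b" using ab F(2) by (simp add: strict_mono_less)
  have "beta_lift F (a, b) \<le> N / (F b - F a)"
    by (rule beta_lift_upper[OF ab F(1) Fab aff])
  also have "\<dots> \<le> N / (exp c * w)" using D N0 w by (intro divide_left_mono) (auto simp: Fab)
  finally have "(beta_lift F (a, b))\<^sup>2 \<le> (N / (exp c * w))\<^sup>2"
    by (intro power_mono beta_lift_nonneg[OF ab F(1) Fab])
  also have "\<dots> = N\<^sup>2 / (exp c * w)\<^sup>2" by (rule power_divide)
  also have "\<dots> \<le> (exp c)\<^sup>2 * X / (exp c * w)\<^sup>2" by (intro divide_right_mono N2) simp
  also have "\<dots> = 2 * (1 + K) * osc U a b"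
    using w by (simp add: X_def power_mult_distrib power2_eq_square)
  finally show ?thesis .
qed

end

lemma periodic_locally_square_integrable:
  assumes [measurable]: "U \<in> borel_measurable borel" and per: "\<And>x. U (x + pi) = U x"
    and l2: "(\<integral>\<^sup>+x\<in>{0..<pi}. ennreal ((U x)\<^sup>2) \<partial>lborel) < \<infinity>"
  shows "locally_square_integrable U"
proof
  fix a b :: real
  obtain n :: nat where "(b - a) / pi < of_nat n" using reals_Archimedean2 by blast
  then have n: "b \<le> a + of_nat n * pi" by (simp add: field_simps)
  have "(\<integral>\<^sup>+x\<in>{a..<b}. ennreal ((U x)\<^sup>2) \<partial>lborel) \<le> (\<integral>\<^sup>+x\<in>{a..<a + of_nat n * pi}. ennreal ((U x)\<^sup>2) \<partial>lborel)"
    using n by (intro nn_integral_mono) (auto simp: indicator_def)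
  also have "\<dots> = of_nat n * (\<integral>\<^sup>+x\<in>{0..<pi}. ennreal ((U x)\<^sup>2) \<partial>lborel)"
    by (rule nn_integral_periods) (auto simp: per)
  also have "\<dots> < \<infinity>" using l2 by (simp add: ennreal_mult_less_top of_nat_less_top)
  finally show "(\<integral>\<^sup>+x\<in>{a..<b}. ennreal ((U x)\<^sup>2) \<partial>lborel) < \<infinity>" .
qed (rule assms)

text \<open>The distance on the circle is at most the distance on the line, and a bounded square is covered by
finitely many periods in each variable.\<close>

lemma line_energy_finite:
  assumes [measurable]: "U \<in> borel_measurable borel" and per: "\<And>x. U (x + pi) = U x"
    and en: "circle_energy U < \<infinity>"
  shows "(\<integral>\<^sup>+x\<in>{c..<d}. (\<integral>\<^sup>+y\<in>{c..<d}. ennreal ((U x - U y)\<^sup>2 / (x - y)\<^sup>2) \<partial>lborel) \<partial>lborel) < \<infinity>"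
proof -
  obtain n :: nat where "(d - c) / pi < of_nat n" using reals_Archimedean2 by blast
  then have n: "d \<le> c + of_nat n * pi" by (simp add: field_simps)
  have gper: "gagliardo U (x + pi) y = gagliardo U x y" "gagliardo U x (y + pi) = gagliardo U x y" for x y
    by (simp_all add: gagliardo_def per)
  have le: "ennreal ((U x - U y)\<^sup>2 / (x - y)\<^sup>2) \<le> gagliardo U x y" for x y
  proof (cases "circle_dist x y = 0")
    case True
    then have "rp1_of x = rp1_of y" by (simp add: circle_dist_def)
    then obtain k :: int where "y = x + of_int k * pi" using rp1_of_eq_iff by blast
    then have "U x = U y" by (simp add: periodic_shift_int[of U, OF per])
    then show ?thesis by simp
  next
    case False
    then have p: "0 < circle_dist x y" using circle_dist_nonneg[of x y] by linarith
    have "(circle_dist x y)\<^sup>2 \<le> \<bar>x - y\<bar>\<^sup>2" by (intro power_mono circle_dist_le circle_dist_nonneg)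
    then have "(U x - U y)\<^sup>2 / \<bar>x - y\<bar>\<^sup>2 \<le> (U x - U y)\<^sup>2 / (circle_dist x y)\<^sup>2"
      using p circle_dist_le[of x y] by (intro divide_left_mono mult_pos_pos zero_less_power) auto
    then show ?thesis unfolding gagliardo_def by (intro ennreal_leI) simp
  qed
  have "(\<integral>\<^sup>+x\<in>{c..<d}. (\<integral>\<^sup>+y\<in>{c..<d}. ennreal ((U x - U y)\<^sup>2 / (x - y)\<^sup>2) \<partial>lborel) \<partial>lborel)
    \<le> (\<integral>\<^sup>+x\<in>{c..<c + of_nat n * pi}. (\<integral>\<^sup>+y\<in>{c..<c + of_nat n * pi}. gagliardo U x y \<partial>lborel) \<partial>lborel)"
    using n le by (intro nn_integral_mono mult_mono) (auto simp: indicator_def)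
  also have "\<dots> = (\<integral>\<^sup>+x\<in>{c..<c + of_nat n * pi}. (of_nat n * (\<integral>\<^sup>+y\<in>{0..<pi}. gagliardo U x y \<partial>lborel)) \<partial>lborel)"
  proof -
    have "(\<integral>\<^sup>+y\<in>{c..<c + of_nat n * pi}. gagliardo U x y \<partial>lborel) = of_nat n * (\<integral>\<^sup>+y\<in>{0..<pi}. gagliardo U x y \<partial>lborel)" for x
      by (rule nn_integral_periods) (measurable, rule gper)
    then show ?thesis by simp
  qed
  also have "\<dots> = of_nat n * (\<integral>\<^sup>+x\<in>{0..<pi}. (of_nat n * (\<integral>\<^sup>+y\<in>{0..<pi}. gagliardo U x y \<partial>lborel)) \<partial>lborel)"
    by (rule nn_integral_periods) (measurable, simp only: gper)
  also have "\<dots> = of_nat n * (of_nat n * circle_energy U)"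
    unfolding circle_energy_def mult.assoc by (subst nn_integral_cmult) auto
  also have "\<dots> < \<infinity>" using en by (simp add: ennreal_mult_less_top of_nat_less_top)
  finally show ?thesis .
qed

lemma dilate_dyadic_interval:
  assumes "dilate lam (dyadic_interval a L n k) = (p, q)"
  shows "dilated_cell a L lam n k = {p..<q}" "q - p = lam * (L / 2 ^ n)"
proof -
  define h where "h = L / 2 ^ n"
  have "dyadic_interval a L n k = (a + real k * h, a + real (k + 1) * h)"
    by (simp add: dyadic_interval_def h_def)
  then have "p = a + (real k + 1/2) * h - lam * h / 2" "q = a + (real k + 1/2) * h + lam * h / 2"
    using assms by (auto simp: dilate_def algebra_simps add_divide_distrib)
  then show "dilated_cell a L lam n k = {p..<q}" "q - p = lam * (L / 2 ^ n)"
    by (simp_all add: dilated_cell_def h_def)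
qed

lemma dilated_cell_subset:
  assumes "k < 2 ^ n" "L > 0" "1 \<le> lam"
  shows "dilated_cell a L lam n k \<subseteq> {a - lam * L..<a + L + lam * L}"
proof -
  define h where "h = L / 2 ^ n"
  have h: "0 < h" "h \<le> L" "2 ^ n * h = L" using assms one_le_power[of "2::real" n] by (auto simp: h_def field_simps)
  have "real (k + 1) \<le> real (2 ^ n)" using assms(1) by (intro of_nat_mono) simp
  then have "real (k + 1) * h \<le> 2 ^ n * h" using h by (intro mult_right_mono) auto
  then have k: "real k * h + h \<le> L" "0 \<le> real k * h" using h by (auto simp: algebra_simps)
  have l: "0 \<le> lam * h" "lam * h \<le> lam * L" using h assms by (auto intro: mult_left_mono)
  have e: "(real k + 1/2) * h = real k * h + h / 2" by (simp add: algebra_simps)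
  show ?thesis unfolding dilated_cell_def h_def[symmetric] e
    using k l h by (intro subsetI) (simp only: atLeastLessThan_iff, linarith)
qed

text \<open>The energy over one bounded square that contains all dilated intervals serves twice: through the
subintervals of a single interval it bounds the exponential moments uniformly, and through the
whole family it bounds the sum of the oscillations.\<close>

lemma weil_petersson_imp_summable_beta:
  assumes F: "continuous_on UNIV F" "strict_mono F" and U: "log_density F U"
    and l2: "(\<integral>\<^sup>+x\<in>{0..<pi}. ennreal ((U x)\<^sup>2) \<partial>lborel) < \<infinity>" and en: "circle_energy U < \<infinity>"
    and lam: "1 \<le> lam"
  shows "(\<lambda>I. (beta_lift F (dilate lam I))\<^sup>2) summable_on dyadic_decomposition x0"
proof -
  have Um: "U \<in> borel_measurable borel" and per: "\<And>x. U (x + pi) = U x"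
    and FU: "\<And>x y. x \<le> y \<Longrightarrow> (\<integral>\<^sup>+t\<in>{x..<y}. ennreal (exp (U t)) \<partial>lborel) = ennreal (F y - F x)"
    using U by (auto simp: log_density_def)
  interpret locally_square_integrable U by (rule periodic_locally_square_integrable[OF Um per l2])
  define c d where "c = x0 - lam * pi" and "d = x0 + pi + lam * pi"
  define En where "En = enn2real (\<integral>\<^sup>+x\<in>{c..<d}. (\<integral>\<^sup>+y\<in>{c..<d}. ennreal ((U x - U y)\<^sup>2 / (x - y)\<^sup>2) \<partial>lborel) \<partial>lborel)"
  have En: "(\<integral>\<^sup>+x\<in>{c..<d}. (\<integral>\<^sup>+y\<in>{c..<d}. ennreal ((U x - U y)\<^sup>2 / (x - y)\<^sup>2) \<partial>lborel) \<partial>lborel) = ennreal En"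
    unfolding En_def using line_energy_finite[OF Um per en, of c d] by (simp add: less_top)
  have En0: "0 \<le> En" by (simp add: En_def)
  have sum: "(\<Sum>n<N. \<Sum>k<2 ^ n. osc U (p n k) (q n k)) \<le> (l + 1) * En"
    if L: "L > 0" and l: "1 \<le> l" and sub: "\<And>n k. k < 2 ^ n \<Longrightarrow> dilated_cell a L l n k \<subseteq> {c..<d}"
    and pq: "\<And>n k. dilate l (dyadic_interval a L n k) = (p n k, q n k)" for N L l a p q
  proof -
    have "p n k < q n k" for n k
    proof -
      have "0 < l * (L / 2 ^ n)" using L l by simp
      then show ?thesis using dilate_dyadic_interval(2)[OF pq[of n k]] by linarith
    qed
    then have o: "0 \<le> osc U (p n k) (q n k)" for n k by (rule osc_nonneg)
    have "(\<Sum>n<N. \<Sum>k<2 ^ n. ennreal (osc U (p n k) (q n k))) \<le> ennreal (l + 1) * ennreal En"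
      unfolding En[symmetric] by (rule osc_sum_le[OF L l sub dilate_dyadic_interval[OF pq]])
    also have "ennreal (l + 1) * ennreal En = ennreal ((l + 1) * En)"
      by (rule ennreal_mult[symmetric]) (use l En0 in auto)
    finally have "ennreal (\<Sum>n<N. \<Sum>k<2 ^ n. osc U (p n k) (q n k)) \<le> ennreal ((l + 1) * En)"
      by (simp add: o sum_nonneg)
    then show ?thesis using l En0 by (simp add: ennreal_le_iff)
  qed
  define p where "p n k = fst (dilate lam (dyadic_interval x0 pi n k))" for n k
  define q where "q n k = snd (dilate lam (dyadic_interval x0 pi n k))" for n k
  have pq: "dilate lam (dyadic_interval x0 pi n k) = (p n k, q n k)" for n k by (simp add: p_def q_def)
  have less: "p n k < q n k" for n k
  proof -
    have "0 < lam * (pi / 2 ^ n)" using lam by simp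
    then show ?thesis using dilate_dyadic_interval(2)[OF pq[of n k]] by linarith
  qed
  have sub: "dilated_cell x0 pi lam n k \<subseteq> {c..<d}" if "k < 2 ^ n" for n k
    unfolding c_def d_def using that lam by (intro dilated_cell_subset) auto
  \<comment> \<open>The factor \<open>1 + 1\<close> is \<open>l + 1\<close> for undilated cells, \<open>l = 1\<close>.\<close>
  define K where "K = exp (4 * ((1 + 1) * En))"
  have beta: "(beta_lift F (p n k, q n k))\<^sup>2 \<le> 2 * (1 + K) * osc U (p n k) (q n k)" if k: "k < 2 ^ n" for n k
  proof (rule beta_sq_le_osc[OF F FU less])
    define L where "L = q n k - p n k"
    have L: "L > 0" "p n k + L = q n k" using less by (auto simp: L_def)
    have "(\<Sum>m<N. \<Sum>j<2 ^ m. osc U (p n k + real j * (L / 2 ^ m)) (p n k + real (j + 1) * (L / 2 ^ m))) \<le> (1 + 1) * En" for N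
    proof (rule sum[OF L(1)])
      show d1: "dilate 1 (dyadic_interval (p n k) L m j) = (p n k + real j * (L / 2 ^ m), p n k + real (j + 1) * (L / 2 ^ m))" for m j
        by (simp add: dilate_def dyadic_interval_def field_simps)
      show "dilated_cell (p n k) L 1 m j \<subseteq> {c..<d}" if j: "j < 2 ^ m" for m j
      proof -
        have "real (j + 1) \<le> real (2 ^ m)" using j by (intro of_nat_mono) simp
        then have "real (j + 1) * (L / 2 ^ m) \<le> real (2 ^ m) * (L / 2 ^ m)" using L by (intro mult_right_mono) auto
        then have "dilated_cell (p n k) L 1 m j \<subseteq> {p n k..<q n k}"
          unfolding dilate_dyadic_interval(1)[OF d1] using L by auto
        also have "\<dots> \<subseteq> {c..<d}" using sub[OF k] unfolding dilate_dyadic_interval(1)[OF pq] .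
        finally show ?thesis .
      qed
    qed simp
    from exp_moment_le[OF L(1) this]
    show "(\<integral>\<^sup>+x\<in>{p n k..<q n k}. ennreal (exp (2 * (U x - mean U (p n k) (q n k)))) \<partial>lborel) \<le> ennreal ((q n k - p n k) * K)"
      unfolding L(2) K_def by (simp only: L_def)
    show "0 \<le> K" by (simp add: K_def)
  qed
  show ?thesis
  proof (subst summable_on_dyadic_decomposition)
    show "summable (\<lambda>m. \<Sum>k<2 ^ m. (beta_lift F (dilate lam (dyadic_interval x0 pi m k)))\<^sup>2)"
    proof (rule summableI_nonneg_bounded)
      fix N
      have "(\<Sum>m<N. \<Sum>k<2 ^ m. (beta_lift F (dilate lam (dyadic_interval x0 pi m k)))\<^sup>2) \<le> (\<Sum>m<N. \<Sum>k<2 ^ m. 2 * (1 + K) * osc U (p m k) (q m k))"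
        unfolding pq by (intro sum_mono beta) simp
      also have "\<dots> = 2 * (1 + K) * (\<Sum>m<N. \<Sum>k<2 ^ m. osc U (p m k) (q m k))" by (simp only: sum_distrib_left)
      also have "\<dots> \<le> 2 * (1 + K) * ((lam + 1) * En)"
        by (intro mult_left_mono sum[OF _ lam sub pq]) (auto simp: K_def add_nonneg_nonneg)
      finally show "(\<Sum>m<N. \<Sum>k<2 ^ m. (beta_lift F (dilate lam (dyadic_interval x0 pi m k)))\<^sup>2) \<le> 2 * (1 + K) * ((lam + 1) * En)" .
    qed (simp add: sum_nonneg)
  qed simp
qed

section \<open>Limits of dyadic slopes\<close>

text \<open>Increments that are square summable against \<open>2\<^sup>n\<close> have tails with the same property. With
\<open>w n = 2\<^sup>n (s K - s n)\<^sup>2\<close> and \<open>(x + y)\<^sup>2 \<le> 3/2 x\<^sup>2 + 3 y\<^sup>2\<close> one gets \<open>w n \<le> 3/4 w (n + 1) + 3 \<cdot> 2\<^sup>n (s (n + 1) - s n)\<^sup>2\<close>;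
since the factor \<open>3/4\<close> is less than \<open>1\<close>, summing lets the left side absorb the first term.\<close>

lemma weighted_tail_sum_le:
  fixes s :: "nat \<Rightarrow> real"
  assumes sm: "summable (\<lambda>n. 2 ^ n * (s (Suc n) - s n)\<^sup>2)"
  shows "convergent s" "(\<Sum>n<N. 2 ^ n * (lim s - s n)\<^sup>2) \<le> 12 * (\<Sum>n. 2 ^ n * (s (Suc n) - s n)\<^sup>2)"
proof -
  define T where "T = (\<Sum>n. 2 ^ n * (s (Suc n) - s n)\<^sup>2)"
  have pT: "(\<Sum>n<N. 2 ^ n * (s (Suc n) - s n)\<^sup>2) \<le> T" for N
    unfolding T_def by (rule sum_le_suminf[OF sm]) auto
  define r where "r = 1 / sqrt 2"
  have r: "0 < r" "r < 1" "r\<^sup>2 = 1 / 2" by (auto simp: r_def power_divide)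
  have "summable (\<lambda>n. s (Suc n) - s n)"
  proof (rule summable_comparison_test')
    show "summable (\<lambda>n. sqrt T * r ^ n)" using r by (intro summable_mult summable_geometric) auto
    fix n :: nat assume "n \<ge> 0"
    have "2 ^ n * (s (Suc n) - s n)\<^sup>2 \<le> (\<Sum>m<Suc n. 2 ^ m * (s (Suc m) - s m)\<^sup>2)"
      by (rule member_le_sum) auto
    also have "\<dots> \<le> T" by (rule pT)
    finally have "(s (Suc n) - s n)\<^sup>2 \<le> T / 2 ^ n" by (simp add: field_simps)
    also have "\<dots> = T * (r ^ n)\<^sup>2"
    proof -
      have "(r ^ n)\<^sup>2 = (r\<^sup>2) ^ n" by (simp only: power_mult[symmetric] mult.commute)
      then show ?thesis by (simp add: r(3) power_divide)
    qed
    finally have "sqrt ((s (Suc n) - s n)\<^sup>2) \<le> sqrt (T * (r ^ n)\<^sup>2)" by (rule real_sqrt_le_mono)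
    then show "norm (s (Suc n) - s n) \<le> sqrt T * r ^ n" using r by (simp add: real_sqrt_mult)
  qed
  then have "convergent (\<lambda>n. \<Sum>i<n. s (Suc i) - s i)" by (simp add: summable_iff_convergent)
  then have "convergent (\<lambda>n. s 0 + (\<Sum>i<n. s (Suc i) - s i))" by (intro convergent_add convergent_const)
  moreover have "s 0 + (\<Sum>i<n. s (Suc i) - s i) = s n" for n by (induction n) auto
  ultimately show conv: "convergent s" by simp
  have fin: "(\<Sum>n<N. 2 ^ n * (s K - s n)\<^sup>2) \<le> 12 * T" if NK: "N \<le> K" for K
  proof -
    define w where "w n = 2 ^ n * (s K - s n)\<^sup>2" for n
    have step: "w n \<le> 3 / 4 * w (Suc n) + 3 * (2 ^ n * (s (Suc n) - s n)\<^sup>2)" for n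
    proof -
      have "(x + y)\<^sup>2 \<le> 3 / 2 * x\<^sup>2 + 3 * y\<^sup>2" for x y :: real
      proof -
        have "0 \<le> (x - 2 * y)\<^sup>2" by simp
        then show ?thesis by (simp add: power2_eq_square algebra_simps)
      qed
      from this[of "s K - s (Suc n)" "s (Suc n) - s n"]
      have "2 ^ n * (s K - s n)\<^sup>2 \<le> 2 ^ n * (3 / 2 * (s K - s (Suc n))\<^sup>2 + 3 * (s (Suc n) - s n)\<^sup>2)"
        by (intro mult_left_mono) (simp_all add: algebra_simps)
      then show ?thesis by (simp add: w_def algebra_simps)
    qed
    have w0: "0 \<le> w n" for n by (simp add: w_def)
    have s1: "(\<Sum>n<K. w n) \<le> 3 / 4 * (\<Sum>n<K. w (Suc n)) + 3 * (\<Sum>n<K. 2 ^ n * (s (Suc n) - s n)\<^sup>2)"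
      using sum_mono[of "{..<K}" w "\<lambda>n. 3 / 4 * w (Suc n) + 3 * (2 ^ n * (s (Suc n) - s n)\<^sup>2)"] step
      by (simp add: sum.distrib sum_distrib_left)
    have s2: "(\<Sum>n<K. w (Suc n)) \<le> (\<Sum>n<K. w n)"
    proof -
      have "(\<Sum>n<Suc K. w n) = w 0 + (\<Sum>n<K. w (Suc n))" by (rule sum.lessThan_Suc_shift)
      then show ?thesis using w0[of 0] by (simp add: w_def)
    qed
    have "(\<Sum>n<K. w n) \<le> 12 * T" using s1 s2 pT[of K] by linarith
    moreover have "(\<Sum>n<N. w n) \<le> (\<Sum>n<K. w n)" using NK w0 by (intro sum_mono2) auto
    ultimately show ?thesis by (simp add: w_def)
  qed
  have "s \<longlonglongrightarrow> lim s" using conv by (simp add: convergent_LIMSEQ_iff)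
  then have "(\<lambda>K. \<Sum>n<N. 2 ^ n * (s K - s n)\<^sup>2) \<longlonglongrightarrow> (\<Sum>n<N. 2 ^ n * (lim s - s n)\<^sup>2)"
    by (intro tendsto_intros)
  then show "(\<Sum>n<N. 2 ^ n * (lim s - s n)\<^sup>2) \<le> 12 * (\<Sum>n. 2 ^ n * (s (Suc n) - s n)\<^sup>2)"
    unfolding T_def[symmetric]
    by (rule LIMSEQ_le_const2) (use fin in blast)
qed

definition slope :: "(real \<Rightarrow> real) \<Rightarrow> real \<Rightarrow> real \<Rightarrow> real \<Rightarrow> real" where
  "slope F a h x = (F (grid_left a h x + h) - F (grid_left a h x)) / h"

lemma slope_measurable [measurable]: "slope F a h \<in> borel_measurable borel"
  unfolding slope_def by (rule measurable_grid_left)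

lemma slope_pos: "strict_mono F \<Longrightarrow> 0 < h \<Longrightarrow> 0 < slope F a h x"
  by (simp add: slope_def strict_mono_less)

lemma slope_cong: "grid_left a h x = grid_left a h y \<Longrightarrow> slope F a h x = slope F a h y"
  by (simp add: slope_def)

lemma slope_periodic:
  assumes "\<And>x. F (x + pi) = F x + pi"
  shows "slope F a (pi / 2 ^ n) (x + pi) = slope F a (pi / 2 ^ n) x"
proof -
  have "(x + pi - a) / (pi / 2 ^ n) = (x - a) / (pi / 2 ^ n) + of_int (2 ^ n)"
    by (simp add: field_simps)
  then have "\<lfloor>(x + pi - a) / (pi / 2 ^ n)\<rfloor> = \<lfloor>(x - a) / (pi / 2 ^ n)\<rfloor> + 2 ^ n"
    by (simp only: floor_add_int)
  then have "grid_left a (pi / 2 ^ n) (x + pi) = grid_left a (pi / 2 ^ n) x + pi"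
    unfolding grid_left_def by (simp add: algebra_simps)
  moreover have "F (y + pi + z) = F (y + z) + pi" for y z using assms[of "y + z"] by (simp add: add_ac)
  ultimately show ?thesis by (simp add: slope_def assms)
qed

text \<open>Integrals that involve two consecutive generations become sums over the parents, with one term for
each half.\<close>

lemma nn_integral_two_levels:
  fixes \<Phi> :: "real \<Rightarrow> real \<Rightarrow> ennreal"
  assumes L: "L > 0" and hn: "\<And>n. h n = L / 2 ^ n"
    and [measurable]: "(\<lambda>x. \<Phi> (grid_left a (h (Suc n)) x) (grid_left a (h n) x)) \<in> borel_measurable borel"
  shows "(\<integral>\<^sup>+x\<in>{a..<a + L}. \<Phi> (grid_left a (h (Suc n)) x) (grid_left a (h n) x) \<partial>lborel) =
    (\<Sum>k<2 ^ n. \<Phi> (a + real (2 * k) * h (Suc n)) (a + real k * h n) * ennreal (h (Suc n))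
      + \<Phi> (a + real (2 * k + 1) * h (Suc n)) (a + real k * h n) * ennreal (h (Suc n)))"
proof -
  define h' where "h' = h (Suc n)"
  have h: "h n = 2 * h'" "h' > 0" "L = real (2 ^ Suc n) * h'" using L by (auto simp: h'_def hn)
  have cell: "(\<integral>\<^sup>+x\<in>{a + real j * h'..<a + real (j + 1) * h'}. \<Phi> (grid_left a h' x) (grid_left a (h n) x) \<partial>lborel)
     = \<Phi> (a + real j * h') (a + real k * h n) * ennreal h'" if j: "j = 2 * k \<or> j = 2 * k + 1" for j k
  proof -
    have "grid_left a h' x = a + real j * h'" "grid_left a (h n) x = a + real k * h n"
      if x: "x \<in> {a + real j * h'..<a + real (j + 1) * h'}" for x
    proof -
      show "grid_left a h' x = a + real j * h'" by (rule grid_left_cell[OF h(2) x])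
      show "grid_left a (h n) x = a + real k * h n"
        by (rule grid_left_cell) (use x j h in \<open>auto simp: algebra_simps\<close>)
    qed
    then have "(\<integral>\<^sup>+x\<in>{a + real j * h'..<a + real (j + 1) * h'}. \<Phi> (grid_left a h' x) (grid_left a (h n) x) \<partial>lborel)
      = (\<integral>\<^sup>+x\<in>{a + real j * h'..<a + real (j + 1) * h'}. \<Phi> (a + real j * h') (a + real k * h n) \<partial>lborel)"
      by (intro nn_integral_cong) (auto simp: indicator_def)
    also have "\<dots> = \<Phi> (a + real j * h') (a + real k * h n) * ennreal ((a + real (j + 1) * h') - (a + real j * h'))"
      by (rule nn_integral_const_Ico) (use h in \<open>simp add: algebra_simps\<close>)
    also have "(a + real (j + 1) * h') - (a + real j * h') = h'" by (simp add: algebra_simps)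
    finally show ?thesis .
  qed
  have "(\<integral>\<^sup>+x\<in>{a..<a + L}. \<Phi> (grid_left a h' x) (grid_left a (h n) x) \<partial>lborel)
    = (\<Sum>j<2 * 2 ^ n. \<integral>\<^sup>+x\<in>{a + real j * h'..<a + real (j + 1) * h'}. \<Phi> (grid_left a h' x) (grid_left a (h n) x) \<partial>lborel)"
    unfolding h(3) power_Suc
  proof (rule nn_integral_cells)
    show "(\<lambda>x. \<Phi> (grid_left a h' x) (grid_left a (h n) x)) \<in> borel_measurable borel" unfolding h'_def by measurable
  qed (use h in simp)
  also have "\<dots> = (\<Sum>k<2 ^ n. \<Phi> (a + real (2 * k) * h') (a + real k * h n) * ennreal h'
      + \<Phi> (a + real (2 * k + 1) * h') (a + real k * h n) * ennreal h')"
    unfolding sum_even_odd by (intro sum.cong refl arg_cong2[where f="(+)"] cell) auto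
  finally show ?thesis unfolding h'_def .
qed

text \<open>The cells of generation \<open>n\<close> have length \<open>mesh n\<close>; \<open>skew\<close> measures how unevenly \<open>F\<close> divides its
increment between the two halves of a cell.\<close>

locale dyadic_increments =
  fixes F :: "real \<Rightarrow> real" and a :: real
  assumes F_mono: "strict_mono F" and F_cont: "continuous_on UNIV F" and F_per: "\<And>x. F (x + pi) = F x + pi"
begin

definition mesh :: "nat \<Rightarrow> real" where "mesh n = pi / 2 ^ n"

definition inc :: "nat \<Rightarrow> nat \<Rightarrow> real" where
  "inc n k = F (a + real (k + 1) * mesh n) - F (a + real k * mesh n)"

definition skew :: "nat \<Rightarrow> nat \<Rightarrow> real" where
  "skew n k = (inc (Suc n) (2 * k) - inc (Suc n) (2 * k + 1)) / inc n k"

lemma mesh_simps: "0 < mesh n" "mesh (Suc n) = mesh n / 2" "real (2 ^ n) * mesh n = pi" "mesh 0 = pi"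
  by (auto simp: mesh_def)

lemma inc_pos: "0 < inc n k"
  unfolding inc_def using F_mono mesh_simps(1)[of n] by (simp add: strict_mono_less)

lemma inc_split: "inc n k = inc (Suc n) (2 * k) + inc (Suc n) (2 * k + 1)"
proof -
  have "a + real k * mesh n = a + real (2 * k) * mesh (Suc n)" "a + real (k + 1) * mesh n = a + real (2 * k + 1 + 1) * mesh (Suc n)"
    by (simp_all add: mesh_simps(2) field_simps)
  then have "inc n k = F (a + real (2 * k + 1 + 1) * mesh (Suc n)) - F (a + real (2 * k) * mesh (Suc n))"
    by (simp only: inc_def)
  then show ?thesis by (simp add: inc_def)
qed

lemma inc_children:
  "inc (Suc n) (2 * k) = inc n k * (1 + skew n k) / 2" "inc (Suc n) (2 * k + 1) = inc n k * (1 - skew n k) / 2"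
  using inc_pos[of n k] inc_split[of n k] by (simp_all add: skew_def field_simps)

lemma skew_bounds: "-1 < skew n k" "skew n k < 1"
proof -
  have "0 < inc n k * (1 + skew n k)" "0 < inc n k * (1 - skew n k)"
    using inc_pos[of "Suc n" "2 * k", unfolded inc_children] inc_pos[of "Suc n" "2 * k + 1", unfolded inc_children] by simp_all
  then show "-1 < skew n k" "skew n k < 1" using inc_pos[of n k] by (simp_all add: zero_less_mult_iff)
qed

lemma inc_telescope: "(\<Sum>k<K. inc n k) = F (a + real K * mesh n) - F a"
  by (induction K) (simp_all add: inc_def)

lemma slope_cell: "slope F a (mesh n) (a + real k * mesh n) = inc n k / mesh n"
proof -
  have "grid_left a (mesh n) (a + real k * mesh n) = a + real k * mesh n"
    by (rule grid_left_cell) (use mesh_simps(1)[of n] in \<open>simp_all add: algebra_simps\<close>)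
  then show ?thesis by (simp add: slope_def inc_def algebra_simps)
qed

lemma slope_grid_left: "slope F a (mesh n) (grid_left a (mesh n) x) = slope F a (mesh n) x"
proof (rule slope_cong)
  show "grid_left a (mesh n) (grid_left a (mesh n) x) = grid_left a (mesh n) x"
    using mesh_simps(1)[of n] by (simp add: grid_left_def)
qed

lemma nn_integral_slope_cells:
  "(\<integral>\<^sup>+x\<in>{a..<a + real K * mesh n}. ennreal (slope F a (mesh n) x) \<partial>lborel) = ennreal (F (a + real K * mesh n) - F a)"
proof -
  have "(\<integral>\<^sup>+x\<in>{a..<a + real K * mesh n}. ennreal (slope F a (mesh n) (grid_left a (mesh n) x)) \<partial>lborel)
    = (\<Sum>k<K. \<integral>\<^sup>+x\<in>{a + real k * mesh n..<a + real (k + 1) * mesh n}. ennreal (slope F a (mesh n) (a + real k * mesh n)) \<partial>lborel)"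
    by (rule nn_integral_grid[where f="\<lambda>l x. ennreal (slope F a (mesh n) l)"]) (use mesh_simps in auto)
  also have "\<dots> = (\<Sum>k<K. ennreal (inc n k))"
  proof (rule sum.cong[OF refl])
    fix k
    have e: "a + real (k + 1) * mesh n - (a + real k * mesh n) = mesh n" by (simp add: algebra_simps)
    have "(\<integral>\<^sup>+x\<in>{a + real k * mesh n..<a + real (k + 1) * mesh n}. ennreal (slope F a (mesh n) (a + real k * mesh n)) \<partial>lborel)
      = ennreal (inc n k / mesh n) * ennreal (mesh n)"
      unfolding slope_cell by (subst nn_integral_const_Ico) (use mesh_simps(1)[of n] e in \<open>simp_all add: algebra_simps\<close>)
    also have "\<dots> = ennreal (inc n k)"
      using mesh_simps(1)[of n] inc_pos[of n k] by (simp flip: ennreal_mult)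
    finally show "(\<integral>\<^sup>+x\<in>{a + real k * mesh n..<a + real (k + 1) * mesh n}. ennreal (slope F a (mesh n) (a + real k * mesh n)) \<partial>lborel) = ennreal (inc n k)" .
  qed
  also have "\<dots> = ennreal (F (a + real K * mesh n) - F a)"
    using inc_pos by (simp add: less_imp_le flip: inc_telescope)
  finally show ?thesis by (simp only: slope_grid_left)
qed

text \<open>Up to grid points the integral of the slopes telescopes; an arbitrary \<open>y\<close> is squeezed between two
neighbouring grid points.\<close>

lemma nn_integral_slope_tendsto:
  assumes y: "a \<le> y"
  shows "(\<lambda>n. \<integral>\<^sup>+x\<in>{a..<y}. ennreal (slope F a (mesh n) x) \<partial>lborel) \<longlonglongrightarrow> ennreal (F y - F a)"
proof -
  define K where "K n = nat \<lfloor>(y - a) / mesh n\<rfloor>" for n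
  have K: "a + real (K n) * mesh n \<le> y" "y \<le> a + real (K n + 1) * mesh n" for n
  proof -
    have "real (K n) = of_int \<lfloor>(y - a) / mesh n\<rfloor>" using y mesh_simps(1)[of n] by (simp add: K_def)
    then have "real (K n) \<le> (y - a) / mesh n" "(y - a) / mesh n \<le> real (K n + 1)" by linarith+
    then show "a + real (K n) * mesh n \<le> y" "y \<le> a + real (K n + 1) * mesh n"
      using mesh_simps(1)[of n] by (simp_all add: field_simps)
  qed
  have h0: "mesh \<longlonglongrightarrow> 0" unfolding mesh_def by real_asymp
  have c: "(\<lambda>n. F (f n)) \<longlonglongrightarrow> F y" if "\<And>n. \<bar>f n - y\<bar> \<le> mesh n" for f
  proof -
    have "(\<lambda>n. f n - y) \<longlonglongrightarrow> 0" by (rule Lim_null_comparison[OF _ h0]) (simp add: that)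
    then have "f \<longlonglongrightarrow> y" by (simp add: LIM_zero_iff)
    moreover have "isCont F y" using F_cont by (simp add: continuous_on_eq_continuous_at)
    ultimately show ?thesis by (rule isCont_tendsto_compose[rotated])
  qed
  show ?thesis
  proof (rule tendsto_sandwich)
    show "eventually (\<lambda>n. ennreal (F (a + real (K n) * mesh n) - F a) \<le> (\<integral>\<^sup>+x\<in>{a..<y}. ennreal (slope F a (mesh n) x) \<partial>lborel)) sequentially"
      unfolding nn_integral_slope_cells[symmetric]
      by (intro always_eventually allI nn_integral_mono) (use K(1) in \<open>auto simp: indicator_def intro: less_le_trans\<close>)
    show "eventually (\<lambda>n. (\<integral>\<^sup>+x\<in>{a..<y}. ennreal (slope F a (mesh n) x) \<partial>lborel) \<le> ennreal (F (a + real (K n + 1) * mesh n) - F a)) sequentially"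
      unfolding nn_integral_slope_cells[symmetric]
      by (intro always_eventually allI nn_integral_mono) (use K(2) in \<open>auto simp: indicator_def intro: less_le_trans\<close>)
    have "\<bar>a + real (K n) * mesh n - y\<bar> \<le> mesh n" "\<bar>a + real (K n + 1) * mesh n - y\<bar> \<le> mesh n" for n
      using K[of n] by (auto simp: algebra_simps)
    then show "(\<lambda>n. ennreal (F (a + real (K n) * mesh n) - F a)) \<longlonglongrightarrow> ennreal (F y - F a)"
      "(\<lambda>n. ennreal (F (a + real (K n + 1) * mesh n) - F a)) \<longlonglongrightarrow> ennreal (F y - F a)"
      by (intro tendsto_ennrealI tendsto_diff tendsto_const c; simp)+
  qed
qed

end

text \<open>The restriction on \<open>t\<close> keeps \<open>1 + t\<close> away from the singularity of the logarithm.\<close>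

lemma ln_one_plus_sq_le:
  assumes "\<bar>t\<bar> \<le> 1 / 2"
  shows "(ln (1 + t))\<^sup>2 \<le> 4 * (t::real)\<^sup>2"
proof -
  have "\<bar>ln (1 + t)\<bar> \<le> 2 * \<bar>t\<bar>"
  proof (cases "0 \<le> t")
    case True
    have "ln (1 + t) \<le> t" by (rule ln_add_one_self_le_self[OF True])
    moreover have "0 \<le> ln (1 + t)" using True by (intro ln_ge_zero) simp
    ultimately show ?thesis using True by linarith
  next
    case False
    define x where "x = - t"
    have x: "0 \<le> x" "x \<le> 1 / 2" using False assms by (auto simp: x_def)
    have "x * x \<le> x * (1 / 2)" using x by (intro mult_left_mono) auto
    then have "- (2 * x) \<le> ln (1 - x)"
      using ln_one_minus_pos_lower_bound[OF x] by (simp add: power2_eq_square)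
    moreover have "ln (1 - x) \<le> 0" using x by (simp add: ln_le_zero_iff)
    ultimately show ?thesis using x by (simp add: x_def abs_le_iff)
  qed
  then have "\<bar>ln (1 + t)\<bar>\<^sup>2 \<le> (2 * \<bar>t\<bar>)\<^sup>2" by (intro power_mono) auto
  then show ?thesis by (simp add: power_mult_distrib)
qed

locale summable_skew = dyadic_increments +
  assumes skew_summable: "summable (\<lambda>n. \<Sum>k<2 ^ n. (skew n k)\<^sup>2)"
begin

definition skew_energy :: "nat \<Rightarrow> real" where "skew_energy n = (\<Sum>k<2 ^ n. (skew n k)\<^sup>2)"

definition log_skew_energy :: "nat \<Rightarrow> real" where
  "log_skew_energy n = (\<Sum>k<2 ^ n. (ln (1 + skew n k))\<^sup>2 + (ln (1 - skew n k))\<^sup>2)"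

lemma skew_energy_summable: "summable skew_energy"
  using skew_summable by (simp add: skew_energy_def[abs_def])

lemma skew_energy_nonneg: "0 \<le> skew_energy n"
  by (simp add: skew_energy_def sum_nonneg)

lemma log_skew_energy_nonneg: "0 \<le> log_skew_energy n"
  by (simp add: log_skew_energy_def sum_nonneg)

lemma skew_sq_le: "k < 2 ^ n \<Longrightarrow> (skew n k)\<^sup>2 \<le> skew_energy n"
  unfolding skew_energy_def by (rule member_le_sum) auto

text \<open>From some generation on every \<open>\<bar>skew\<bar>\<close> is at most \<open>1/2\<close>, and there \<open>\<bar>ln (1 \<plusminus> skew)\<bar>\<close> is at
most \<open>2 \<bar>skew\<bar>\<close>.\<close>

lemma log_skew_energy_summable: "summable log_skew_energy"
proof (rule summable_comparison_test_ev)
  show "summable (\<lambda>n. 8 * skew_energy n)" by (intro summable_mult skew_energy_summable)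
  have "eventually (\<lambda>n. skew_energy n < 1 / 4) sequentially"
    using summable_LIMSEQ_zero[OF skew_energy_summable] by (rule order_tendstoD) simp
  then show "eventually (\<lambda>n. norm (log_skew_energy n) \<le> 8 * skew_energy n) sequentially"
  proof eventually_elim
    case (elim n)
    have "log_skew_energy n \<le> (\<Sum>k<2 ^ n. 8 * (skew n k)\<^sup>2)"
      unfolding log_skew_energy_def
    proof (rule sum_mono)
      fix k :: nat assume "k \<in> {..<2 ^ n}"
      then have "\<bar>skew n k\<bar>\<^sup>2 \<le> (1 / 2)\<^sup>2" using skew_sq_le[of k n] elim by (simp add: power_divide)
      then have "\<bar>skew n k\<bar> \<le> 1 / 2" by (rule power2_le_imp_le) simp
      then show "(ln (1 + skew n k))\<^sup>2 + (ln (1 - skew n k))\<^sup>2 \<le> 8 * (skew n k)\<^sup>2"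
        using ln_one_plus_sq_le[of "skew n k"] ln_one_plus_sq_le[of "- skew n k"] by simp
    qed
    also have "\<dots> = 8 * skew_energy n" by (simp add: skew_energy_def sum_distrib_left)
    finally show ?case using log_skew_energy_nonneg[of n] by simp
  qed
qed

text \<open>This is the uniform \<open>L\<^sup>2\<close> bound for the slopes: in passing to the halves, the sum of squares is
multiplied by half of a weighted average of \<open>1 + skew\<^sup>2\<close>.\<close>

lemma inc_square_sum_le:
  "(\<Sum>k<2 ^ n. (inc n k)\<^sup>2) \<le> pi\<^sup>2 * exp (\<Sum>m<n. skew_energy m) / 2 ^ n"
proof (induction n)
  case 0
  have "inc 0 0 = pi" using F_per[of a] by (simp add: inc_def mesh_simps)
  then show ?case by simp
next
  case (Suc n)
  have "(\<Sum>k<2 ^ Suc n. (inc (Suc n) k)\<^sup>2) = (\<Sum>k<2 ^ n. (inc (Suc n) (2 * k))\<^sup>2 + (inc (Suc n) (2 * k + 1))\<^sup>2)"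
    unfolding power_Suc by (rule sum_even_odd)
  also have "\<dots> = (\<Sum>k<2 ^ n. (inc n k)\<^sup>2 * ((1 + (skew n k)\<^sup>2) / 2))"
    unfolding inc_children by (intro sum.cong refl) (simp add: power2_eq_square field_simps)
  also have "\<dots> \<le> (\<Sum>k<2 ^ n. (inc n k)\<^sup>2 * (exp (skew_energy n) / 2))"
  proof (intro sum_mono mult_left_mono divide_right_mono)
    fix k :: nat assume "k \<in> {..<2 ^ n}"
    then have "(skew n k)\<^sup>2 \<le> skew_energy n" by (intro skew_sq_le) simp
    then show "1 + (skew n k)\<^sup>2 \<le> exp (skew_energy n)" using exp_ge_add_one_self[of "skew_energy n"] by linarith
  qed auto
  also have "\<dots> = (\<Sum>k<2 ^ n. (inc n k)\<^sup>2) * (exp (skew_energy n) / 2)" by (simp only: sum_distrib_right)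
  also have "\<dots> \<le> (pi\<^sup>2 * exp (\<Sum>m<n. skew_energy m) / 2 ^ n) * (exp (skew_energy n) / 2)"
    by (intro mult_right_mono Suc.IH) simp
  also have "\<dots> = pi\<^sup>2 * exp (\<Sum>m<Suc n. skew_energy m) / 2 ^ Suc n" by (simp add: exp_add)
  finally show ?case .
qed

lemma slope_children:
  "slope F a (mesh (Suc n)) (a + real (2 * k) * mesh (Suc n)) = slope F a (mesh n) (a + real k * mesh n) * (1 + skew n k)"
  "slope F a (mesh (Suc n)) (a + real (2 * k + 1) * mesh (Suc n)) = slope F a (mesh n) (a + real k * mesh n) * (1 - skew n k)"
  unfolding slope_cell inc_children using mesh_simps(1)[of n] by (simp_all add: mesh_simps(2) field_simps)

text \<open>On either half of a cell the slope changes by \<open>skew\<close> times the slope of the cell.\<close>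

lemma nn_integral_slope_increment:
  "(\<integral>\<^sup>+x\<in>{a..<a + pi}. ennreal \<bar>slope F a (mesh (Suc n)) x - slope F a (mesh n) x\<bar> \<partial>lborel)
    = ennreal (\<Sum>k<2 ^ n. inc n k * \<bar>skew n k\<bar>)"
proof -
  have "(\<integral>\<^sup>+x\<in>{a..<a + pi}. ennreal \<bar>slope F a (mesh (Suc n)) (grid_left a (mesh (Suc n)) x) - slope F a (mesh n) (grid_left a (mesh n) x)\<bar> \<partial>lborel)
    = (\<Sum>k<2 ^ n. ennreal \<bar>slope F a (mesh (Suc n)) (a + real (2 * k) * mesh (Suc n)) - slope F a (mesh n) (a + real k * mesh n)\<bar> * ennreal (mesh (Suc n))
      + ennreal \<bar>slope F a (mesh (Suc n)) (a + real (2 * k + 1) * mesh (Suc n)) - slope F a (mesh n) (a + real k * mesh n)\<bar> * ennreal (mesh (Suc n)))"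
    by (rule nn_integral_two_levels[where \<Phi>="\<lambda>l l'. ennreal \<bar>slope F a (mesh (Suc n)) l - slope F a (mesh n) l'\<bar>" and L=pi and h=mesh])
       (simp_all add: mesh_def[abs_def] slope_grid_left[unfolded mesh_def])
  also have "\<dots> = (\<Sum>k<2 ^ n. ennreal (inc n k * \<bar>skew n k\<bar>))"
  proof (rule sum.cong[OF refl])
    fix k
    define s where "s = inc n k / mesh n * \<bar>skew n k\<bar>"
    have s0: "0 \<le> s" using inc_pos[of n k] mesh_simps(1)[of n] by (simp add: s_def)
    have "\<bar>slope F a (mesh (Suc n)) (a + real (2 * k) * mesh (Suc n)) - slope F a (mesh n) (a + real k * mesh n)\<bar> = s"
      "\<bar>slope F a (mesh (Suc n)) (a + real (2 * k + 1) * mesh (Suc n)) - slope F a (mesh n) (a + real k * mesh n)\<bar> = s"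
      unfolding slope_children unfolding slope_cell s_def using inc_pos[of n k] mesh_simps(1)[of n]
      by (simp_all add: right_diff_distrib distrib_left abs_mult)
    then have "ennreal \<bar>slope F a (mesh (Suc n)) (a + real (2 * k) * mesh (Suc n)) - slope F a (mesh n) (a + real k * mesh n)\<bar> * ennreal (mesh (Suc n))
      + ennreal \<bar>slope F a (mesh (Suc n)) (a + real (2 * k + 1) * mesh (Suc n)) - slope F a (mesh n) (a + real k * mesh n)\<bar> * ennreal (mesh (Suc n))
      = ennreal s * ennreal (mesh (Suc n)) + ennreal s * ennreal (mesh (Suc n))" by simp
    also have "\<dots> = ennreal (s * mesh (Suc n) + s * mesh (Suc n))"
    proof -
      have "0 \<le> mesh (Suc n)" using mesh_simps(1)[of "Suc n"] by simp
      then show ?thesis using s0 by (simp only: ennreal_plus ennreal_mult mult_nonneg_nonneg)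
    qed
    also have "s * mesh (Suc n) + s * mesh (Suc n) = inc n k * \<bar>skew n k\<bar>"
      using mesh_simps(1)[of n] by (simp add: s_def mesh_simps(2))
    finally show "ennreal \<bar>slope F a (mesh (Suc n)) (a + real (2 * k) * mesh (Suc n)) - slope F a (mesh n) (a + real k * mesh n)\<bar> * ennreal (mesh (Suc n))
      + ennreal \<bar>slope F a (mesh (Suc n)) (a + real (2 * k + 1) * mesh (Suc n)) - slope F a (mesh n) (a + real k * mesh n)\<bar> * ennreal (mesh (Suc n))
      = ennreal (inc n k * \<bar>skew n k\<bar>)" .
  qed
  also have "\<dots> = ennreal (\<Sum>k<2 ^ n. inc n k * \<bar>skew n k\<bar>)"
    using inc_pos by (intro sum_ennreal) (simp add: less_imp_le)
  finally show ?thesis by (simp only: slope_grid_left)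
qed

lemma nn_integral_log_slope_increment:
  "(\<integral>\<^sup>+x\<in>{a..<a + pi}. ennreal ((ln (slope F a (mesh (Suc n)) x) - ln (slope F a (mesh n) x))\<^sup>2) \<partial>lborel)
    = ennreal (mesh (Suc n) * log_skew_energy n)"
proof -
  have "(\<integral>\<^sup>+x\<in>{a..<a + pi}. ennreal ((ln (slope F a (mesh (Suc n)) (grid_left a (mesh (Suc n)) x)) - ln (slope F a (mesh n) (grid_left a (mesh n) x)))\<^sup>2) \<partial>lborel)
    = (\<Sum>k<2 ^ n. ennreal ((ln (slope F a (mesh (Suc n)) (a + real (2 * k) * mesh (Suc n))) - ln (slope F a (mesh n) (a + real k * mesh n)))\<^sup>2) * ennreal (mesh (Suc n))
      + ennreal ((ln (slope F a (mesh (Suc n)) (a + real (2 * k + 1) * mesh (Suc n))) - ln (slope F a (mesh n) (a + real k * mesh n)))\<^sup>2) * ennreal (mesh (Suc n)))"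
    by (rule nn_integral_two_levels[where \<Phi>="\<lambda>l l'. ennreal ((ln (slope F a (mesh (Suc n)) l) - ln (slope F a (mesh n) l'))\<^sup>2)" and L=pi and h=mesh])
       (simp_all add: mesh_def[abs_def] slope_grid_left[unfolded mesh_def])
  also have "\<dots> = (\<Sum>k<2 ^ n. ennreal (mesh (Suc n) * ((ln (1 + skew n k))\<^sup>2 + (ln (1 - skew n k))\<^sup>2)))"
  proof (rule sum.cong[OF refl])
    fix k
    have p: "0 < slope F a (mesh n) (a + real k * mesh n)" by (rule slope_pos[OF F_mono mesh_simps(1)])
    have "ln (slope F a (mesh (Suc n)) (a + real (2 * k) * mesh (Suc n))) - ln (slope F a (mesh n) (a + real k * mesh n)) = ln (1 + skew n k)"
      "ln (slope F a (mesh (Suc n)) (a + real (2 * k + 1) * mesh (Suc n))) - ln (slope F a (mesh n) (a + real k * mesh n)) = ln (1 - skew n k)"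
      unfolding slope_children using p skew_bounds[of n k] by (simp_all add: ln_mult)
    then show "ennreal ((ln (slope F a (mesh (Suc n)) (a + real (2 * k) * mesh (Suc n))) - ln (slope F a (mesh n) (a + real k * mesh n)))\<^sup>2) * ennreal (mesh (Suc n))
      + ennreal ((ln (slope F a (mesh (Suc n)) (a + real (2 * k + 1) * mesh (Suc n))) - ln (slope F a (mesh n) (a + real k * mesh n)))\<^sup>2) * ennreal (mesh (Suc n))
      = ennreal (mesh (Suc n) * ((ln (1 + skew n k))\<^sup>2 + (ln (1 - skew n k))\<^sup>2))"
      using mesh_simps(1)[of "Suc n"] by (simp only: distrib_left mult.commute[of "mesh (Suc n)"] distrib_right
         ennreal_plus ennreal_mult zero_le_power2 less_imp_le mult_nonneg_nonneg)
  qed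
  also have "\<dots> = ennreal (mesh (Suc n) * log_skew_energy n)"
    using mesh_simps(1)[of "Suc n"] by (simp add: log_skew_energy_def sum_distrib_left)
  finally show ?thesis by (simp only: slope_grid_left)
qed

definition log_slope :: "nat \<Rightarrow> real \<Rightarrow> real" where "log_slope n x = ln (slope F a (mesh n) x)"

text \<open>At points where the sequence diverges the value is arbitrary but still measurable and periodic;
these points form a null set.\<close>

definition log_deriv :: "real \<Rightarrow> real" where "log_deriv x = lim (\<lambda>n. log_slope n x)"

lemma log_slope_measurable [measurable]: "log_slope n \<in> borel_measurable borel"
  unfolding log_slope_def by measurable

lemma log_deriv_measurable [measurable]: "log_deriv \<in> borel_measurable borel"
  unfolding log_deriv_def by measurable

lemma log_slope_periodic: "log_slope n (x + pi) = log_slope n x"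
  unfolding log_slope_def mesh_def by (subst slope_periodic[where F=F]) (rule F_per, rule refl)

lemma log_deriv_periodic: "log_deriv (x + pi) = log_deriv x"
  by (simp add: log_deriv_def log_slope_periodic)

definition weighted_increment :: "nat \<Rightarrow> real \<Rightarrow> real" where
  "weighted_increment n x = 2 ^ n * (log_slope (Suc n) x - log_slope n x)\<^sup>2"

lemma weighted_increment_measurable [measurable]: "weighted_increment n \<in> borel_measurable borel"
  unfolding weighted_increment_def by measurable

lemma nn_integral_weighted_increment:
  "(\<integral>\<^sup>+x\<in>{a..<a + pi}. ennreal (weighted_increment n x) \<partial>lborel) = ennreal (pi / 2 * log_skew_energy n)"
proof -
  have "(\<integral>\<^sup>+x\<in>{a..<a + pi}. ennreal (weighted_increment n x) \<partial>lborel)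
    = (\<integral>\<^sup>+x. ennreal (2 ^ n) * (ennreal ((ln (slope F a (mesh (Suc n)) x) - ln (slope F a (mesh n) x))\<^sup>2) * indicator {a..<a + pi} x) \<partial>lborel)"
    unfolding weighted_increment_def log_slope_def by (intro nn_integral_cong) (simp add: ennreal_mult mult.assoc)
  also have "\<dots> = ennreal (2 ^ n) * ennreal (mesh (Suc n) * log_skew_energy n)"
    by (subst nn_integral_cmult) (simp_all add: nn_integral_log_slope_increment)
  also have "\<dots> = ennreal (2 ^ n * (mesh (Suc n) * log_skew_energy n))"
    using mesh_simps(1)[of "Suc n"] log_skew_energy_nonneg[of n] by (intro ennreal_mult[symmetric]) auto
  also have "2 ^ n * (mesh (Suc n) * log_skew_energy n) = pi / 2 * log_skew_energy n"
    by (simp add: mesh_def)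
  finally show ?thesis .
qed

lemma sum_nn_integral_weighted_increment:
  "(\<Sum>n<N. \<integral>\<^sup>+x\<in>{a..<a + pi}. ennreal (weighted_increment n x) \<partial>lborel) \<le> ennreal (pi / 2 * suminf log_skew_energy)"
proof -
  have "(\<Sum>n<N. \<integral>\<^sup>+x\<in>{a..<a + pi}. ennreal (weighted_increment n x) \<partial>lborel) = ennreal (pi / 2 * (\<Sum>n<N. log_skew_energy n))"
    unfolding nn_integral_weighted_increment using log_skew_energy_nonneg by (simp add: sum_distrib_left)
  also have "\<dots> \<le> ennreal (pi / 2 * suminf log_skew_energy)"
    by (intro ennreal_leI mult_left_mono sum_le_suminf log_skew_energy_summable) (auto simp: log_skew_energy_nonneg)
  finally show ?thesis .
qed

lemma AE_summable_weighted_increment: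
  "AE x in lborel. x \<in> {a..<a + pi} \<longrightarrow> summable (\<lambda>n. weighted_increment n x)"
  by (rule AE_summable[OF _ _ _ sum_nn_integral_weighted_increment]) (auto simp: weighted_increment_def)

lemma AE_log_slope_tendsto: "AE x in lborel. x \<in> {a..<a + pi} \<longrightarrow> (\<lambda>n. log_slope n x) \<longlonglongrightarrow> log_deriv x"
  using AE_summable_weighted_increment
proof (rule AE_mp, intro AE_I2 impI)
  fix x assume "x \<in> {a..<a + pi} \<longrightarrow> summable (\<lambda>n. weighted_increment n x)" "x \<in> {a..<a + pi}"
  then have "convergent (\<lambda>n. log_slope n x)"
    by (intro weighted_tail_sum_le(1)) (simp add: weighted_increment_def)
  then show "(\<lambda>n. log_slope n x) \<longlonglongrightarrow> log_deriv x"
    unfolding log_deriv_def by (simp only: convergent_LIMSEQ_iff)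
qed

text \<open>The pointwise inequality for weighted tails, integrated over a period.\<close>

lemma log_slope_approx:
  "(\<Sum>n<N. ennreal (2 ^ n) * (\<integral>\<^sup>+x\<in>{0..<pi}. ennreal ((log_deriv x - log_slope n x)\<^sup>2) \<partial>lborel))
    \<le> ennreal (6 * pi * suminf log_skew_energy)"
proof -
  have "(\<integral>\<^sup>+x\<in>{0..<pi}. ennreal ((log_deriv x - log_slope n x)\<^sup>2) \<partial>lborel)
     = (\<integral>\<^sup>+x\<in>{a..<a + pi}. ennreal ((log_deriv x - log_slope n x)\<^sup>2) \<partial>lborel)" for n
    by (rule nn_integral_period[symmetric]) (auto simp: log_deriv_periodic log_slope_periodic)
  then have "(\<Sum>n<N. ennreal (2 ^ n) * (\<integral>\<^sup>+x\<in>{0..<pi}. ennreal ((log_deriv x - log_slope n x)\<^sup>2) \<partial>lborel))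
    = (\<integral>\<^sup>+x. (\<Sum>n<N. ennreal (2 ^ n) * (ennreal ((log_deriv x - log_slope n x)\<^sup>2) * indicator {a..<a + pi} x)) \<partial>lborel)"
    by (simp add: nn_integral_sum nn_integral_cmult)
  also have "\<dots> \<le> (\<integral>\<^sup>+x. (\<Sum>n. ennreal 12 * (ennreal (weighted_increment n x) * indicator {a..<a + pi} x)) \<partial>lborel)"
  proof (rule nn_integral_mono_AE, rule AE_mp[OF AE_summable_weighted_increment], intro AE_I2 impI)
    fix x assume sm: "x \<in> {a..<a + pi} \<longrightarrow> summable (\<lambda>n. weighted_increment n x)"
    show "(\<Sum>n<N. ennreal (2 ^ n) * (ennreal ((log_deriv x - log_slope n x)\<^sup>2) * indicator {a..<a + pi} x))
      \<le> (\<Sum>n. ennreal 12 * (ennreal (weighted_increment n x) * indicator {a..<a + pi} x))"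
    proof (cases "x \<in> {a..<a + pi}")
      case True
      have "(\<Sum>n<N. 2 ^ n * (log_deriv x - log_slope n x)\<^sup>2) \<le> 12 * (\<Sum>n. weighted_increment n x)"
        using weighted_tail_sum_le(2)[of "\<lambda>n. log_slope n x" N] sm True
        by (simp add: weighted_increment_def log_deriv_def)
      then have "ennreal (\<Sum>n<N. 2 ^ n * (log_deriv x - log_slope n x)\<^sup>2) \<le> ennreal (12 * (\<Sum>n. weighted_increment n x))"
        by (rule ennreal_leI)
      also have "\<dots> = ennreal 12 * ennreal (\<Sum>n. weighted_increment n x)"
        using sm True by (intro ennreal_mult suminf_nonneg) (auto simp: weighted_increment_def)
      also have "ennreal (\<Sum>n. weighted_increment n x) = (\<Sum>n. ennreal (weighted_increment n x))"
        using sm True by (intro suminf_ennreal2[symmetric]) (auto simp: weighted_increment_def)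
      also have "ennreal 12 * (\<Sum>n. ennreal (weighted_increment n x)) = (\<Sum>n. ennreal 12 * ennreal (weighted_increment n x))"
        by (rule ennreal_suminf_cmult[symmetric])
      also have "ennreal (\<Sum>n<N. 2 ^ n * (log_deriv x - log_slope n x)\<^sup>2) = (\<Sum>n<N. ennreal (2 ^ n) * ennreal ((log_deriv x - log_slope n x)\<^sup>2))"
      proof -
        have "ennreal (2 ^ n) * ennreal ((log_deriv x - log_slope n x)\<^sup>2) = ennreal (2 ^ n * (log_deriv x - log_slope n x)\<^sup>2)" for n
          by (rule ennreal_mult[symmetric]) auto
        then show ?thesis by (simp only: sum_ennreal zero_le_mult_iff zero_le_power2 zero_le_power zero_le_numeral simp_thms)
      qed
      finally show ?thesis using True by simp
    qed simp
  qed
  also have "\<dots> = (\<Sum>n. \<integral>\<^sup>+x. ennreal 12 * (ennreal (weighted_increment n x) * indicator {a..<a + pi} x) \<partial>lborel)"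
    by (rule nn_integral_suminf) measurable
  also have "\<dots> = (\<Sum>n. ennreal 12 * (\<integral>\<^sup>+x\<in>{a..<a + pi}. ennreal (weighted_increment n x) \<partial>lborel))"
    by (intro arg_cong[where f=suminf] ext nn_integral_cmult) measurable
  also have "\<dots> = ennreal 12 * (\<Sum>n. \<integral>\<^sup>+x\<in>{a..<a + pi}. ennreal (weighted_increment n x) \<partial>lborel)"
    by (rule ennreal_suminf_cmult)
  also have "\<dots> \<le> ennreal 12 * ennreal (pi / 2 * suminf log_skew_energy)"
    by (intro mult_left_mono suminf_le_const[OF summableI sum_nn_integral_weighted_increment]) simp
  also have "\<dots> = ennreal (12 * (pi / 2 * suminf log_skew_energy))"
  proof -
    have "0 \<le> suminf log_skew_energy" by (intro suminf_nonneg log_skew_energy_summable log_skew_energy_nonneg)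
    then show ?thesis by (intro ennreal_mult[symmetric]) auto
  qed
  also have "12 * (pi / 2 * suminf log_skew_energy) = 6 * pi * suminf log_skew_energy" by simp
  finally show ?thesis .
qed

text \<open>The \<open>L\<^sup>1\<close> norms of the increments decay geometrically. By the inequality between arithmetic and
geometric means with weight \<open>r\<^sup>n = 2\<^sup>-\<^sup>n\<^sup>/\<^sup>2\<close>, the integral is at most half of \<open>r\<^sup>-\<^sup>n\<close> times the sum of the
squared increments of \<open>F\<close>, which is \<open>O(2\<^sup>-\<^sup>n)\<close>, plus half of \<open>r\<^sup>n\<close> times the bounded sum of \<open>skew\<^sup>2\<close>.\<close>

lemma slope_increments_bounded:
  obtains C where "\<And>N. (\<Sum>n<N. \<integral>\<^sup>+x\<in>{a..<a + pi}. ennreal \<bar>slope F a (mesh (Suc n)) x - slope F a (mesh n) x\<bar> \<partial>lborel) \<le> ennreal C"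
proof -
  define S where "S = suminf skew_energy"
  have pS: "(\<Sum>m<n. skew_energy m) \<le> S" for n
    unfolding S_def by (rule sum_le_suminf[OF skew_energy_summable]) (auto simp: skew_energy_nonneg)
  define D where "D = pi\<^sup>2 * exp S"
  define r where "r = 1 / sqrt 2"
  have r: "0 < r" "r < 1" "r * r = 1 / 2" by (auto simp: r_def)
  have rr: "r ^ n * r ^ n = 1 / 2 ^ n" for n by (simp add: r(3) power_divide flip: power_mult_distrib)
  have S0: "0 \<le> S" using pS[of 0] by simp
  have D0: "0 \<le> D" by (simp add: D_def)
  have bound: "(\<Sum>k<2 ^ n. inc n k * \<bar>skew n k\<bar>) \<le> (D + S) / 2 * r ^ n" for n
  proof -
    have rn: "0 < r ^ n" using r by simp
    have amgm: "inc n k * \<bar>skew n k\<bar> \<le> ((inc n k)\<^sup>2 / r ^ n + r ^ n * (skew n k)\<^sup>2) / 2" for k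
    proof -
      have "0 \<le> (inc n k - r ^ n * \<bar>skew n k\<bar>)\<^sup>2" by simp
      then have "2 * (r ^ n * (inc n k * \<bar>skew n k\<bar>)) \<le> (inc n k)\<^sup>2 + r ^ n * r ^ n * (skew n k)\<^sup>2"
        by (simp add: power2_diff power_mult_distrib power2_eq_square algebra_simps)
      also have "\<dots> = 2 * (r ^ n * (((inc n k)\<^sup>2 / r ^ n + r ^ n * (skew n k)\<^sup>2) / 2))"
        using r(1) by (simp add: field_simps)
      finally have "r ^ n * (inc n k * \<bar>skew n k\<bar>) \<le> r ^ n * (((inc n k)\<^sup>2 / r ^ n + r ^ n * (skew n k)\<^sup>2) / 2)" by linarith
      then show ?thesis by (simp only: mult_le_cancel_left_pos[OF rn])
    qed
    have "(\<Sum>k<2 ^ n. inc n k * \<bar>skew n k\<bar>) \<le> (\<Sum>k<2 ^ n. ((inc n k)\<^sup>2 / r ^ n + r ^ n * (skew n k)\<^sup>2) / 2)"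
      by (intro sum_mono amgm)
    also have "\<dots> = ((\<Sum>k<2 ^ n. (inc n k)\<^sup>2) / r ^ n + r ^ n * skew_energy n) / 2"
      unfolding skew_energy_def
      by (simp only: sum_divide_distrib[symmetric] sum.distrib sum_distrib_left[symmetric])
    also have "\<dots> \<le> (D / 2 ^ n / r ^ n + r ^ n * S) / 2"
    proof -
      have "(\<Sum>k<2 ^ n. (inc n k)\<^sup>2) \<le> pi\<^sup>2 * exp (\<Sum>m<n. skew_energy m) / 2 ^ n" by (rule inc_square_sum_le)
      also have "\<dots> \<le> D / 2 ^ n" unfolding D_def by (intro divide_right_mono mult_left_mono) (auto simp: pS)
      finally have 1: "(\<Sum>k<2 ^ n. (inc n k)\<^sup>2) / r ^ n \<le> D / 2 ^ n / r ^ n" using rn by (intro divide_right_mono) auto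
      have "skew_energy n \<le> (\<Sum>m<Suc n. skew_energy m)" by (rule member_le_sum) (auto simp: skew_energy_nonneg)
      also have "\<dots> \<le> S" by (rule pS)
      finally have 2: "r ^ n * skew_energy n \<le> r ^ n * S" using rn by (intro mult_left_mono) auto
      show ?thesis by (intro divide_right_mono add_mono 1 2) simp
    qed
    also have "D / 2 ^ n / r ^ n = D * r ^ n"
    proof -
      have "D / 2 ^ n = D * r ^ n * r ^ n" using rr[of n] by (simp add: mult.assoc)
      then show ?thesis using r(1) by (simp only:) simp
    qed
    finally show ?thesis by (simp add: algebra_simps)
  qed
  have geo: "(\<Sum>n<N. r ^ n) \<le> 1 / (1 - r)" for N
    using sum_le_suminf[OF summable_geometric[of r], of "{..<N}"] r by (simp add: suminf_geometric)
  show thesis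
  proof (rule that[of "(D + S) / 2 * (1 / (1 - r))"])
    fix N
    have "(\<Sum>n<N. \<integral>\<^sup>+x\<in>{a..<a + pi}. ennreal \<bar>slope F a (mesh (Suc n)) x - slope F a (mesh n) x\<bar> \<partial>lborel)
      = ennreal (\<Sum>n<N. \<Sum>k<2 ^ n. inc n k * \<bar>skew n k\<bar>)"
      unfolding nn_integral_slope_increment using inc_pos
      by (intro sum_ennreal sum_nonneg mult_nonneg_nonneg) (auto simp: less_imp_le)
    also have "\<dots> \<le> ennreal (\<Sum>n<N. (D + S) / 2 * r ^ n)" by (intro ennreal_leI sum_mono bound)
    also have "\<dots> = ennreal ((D + S) / 2 * (\<Sum>n<N. r ^ n))" by (simp only: sum_distrib_left)
    also have "\<dots> \<le> ennreal ((D + S) / 2 * (1 / (1 - r)))"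
      using D0 S0 by (intro ennreal_leI mult_left_mono geo) auto
    finally show "(\<Sum>n<N. \<integral>\<^sup>+x\<in>{a..<a + pi}. ennreal \<bar>slope F a (mesh (Suc n)) x - slope F a (mesh n) x\<bar> \<partial>lborel)
      \<le> ennreal ((D + S) / 2 * (1 / (1 - r)))" .
  qed
qed

text \<open>The first slope plus the sum of all absolute increments is an integrable majorant, so the integral
of the limit is the limit of the integrals, which is the increment of \<open>F\<close>.\<close>

lemma nn_integral_exp_log_deriv:
  assumes y: "a \<le> y" "y \<le> a + pi"
  shows "(\<integral>\<^sup>+x\<in>{a..<y}. ennreal (exp (log_deriv x)) \<partial>lborel) = ennreal (F y - F a)"
proof -
  obtain C where C: "\<And>N. (\<Sum>n<N. \<integral>\<^sup>+x\<in>{a..<a + pi}. ennreal \<bar>slope F a (mesh (Suc n)) x - slope F a (mesh n) x\<bar> \<partial>lborel) \<le> ennreal C"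
    by (rule slope_increments_bounded, rule that, assumption)
  define d where "d n x = ennreal \<bar>slope F a (mesh (Suc n)) x - slope F a (mesh n) x\<bar> * indicator {a..<a + pi} x" for n x
  define w where "w x = ennreal (slope F a (mesh 0) x) * indicator {a..<a + pi} x + (\<Sum>n. d n x)" for x
  have [measurable]: "d n \<in> borel_measurable lborel" for n unfolding d_def by measurable
  have [measurable]: "w \<in> borel_measurable lborel" unfolding w_def by measurable
  have sp: "0 \<le> slope F a (mesh n) x" for n x using slope_pos[OF F_mono mesh_simps(1)] by (simp add: less_imp_le)
  have wle: "ennreal (slope F a (mesh n) x) * indicator {a..<y} x \<le> w x" for n x
  proof (cases "x \<in> {a..<y}")
    case True
    then have x: "x \<in> {a..<a + pi}" using y by simp
    have "slope F a (mesh n) x \<le> slope F a (mesh 0) x + (\<Sum>i<n. \<bar>slope F a (mesh (Suc i)) x - slope F a (mesh i) x\<bar>)"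
      by (induction n) (auto simp: abs_le_iff abs_if split: if_splits)
    then have "ennreal (slope F a (mesh n) x) \<le> ennreal (slope F a (mesh 0) x + (\<Sum>i<n. \<bar>slope F a (mesh (Suc i)) x - slope F a (mesh i) x\<bar>))"
      by (rule ennreal_leI)
    also have "\<dots> = ennreal (slope F a (mesh 0) x) + (\<Sum>i<n. d i x)"
      using x sp by (simp add: ennreal_plus d_def sum_nonneg)
    also have "\<dots> \<le> ennreal (slope F a (mesh 0) x) + (\<Sum>i. d i x)"
      by (intro add_left_mono sum_le_suminf summableI) auto
    finally show ?thesis using True x by (simp add: w_def)
  qed simp
  have wfin: "(\<integral>\<^sup>+x. w x \<partial>lborel) < \<infinity>"
  proof -
    have "(\<integral>\<^sup>+x. (\<Sum>n. d n x) \<partial>lborel) = (\<Sum>n. \<integral>\<^sup>+x. d n x \<partial>lborel)" by (rule nn_integral_suminf) measurable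
    also have "\<dots> \<le> ennreal C" unfolding d_def by (rule suminf_le_const[OF summableI C])
    finally have "(\<integral>\<^sup>+x. (\<Sum>n. d n x) \<partial>lborel) < \<infinity>" by (rule le_less_trans) simp
    moreover have "(\<integral>\<^sup>+x\<in>{a..<a + pi}. ennreal (slope F a (mesh 0) x) \<partial>lborel) < \<infinity>"
      using nn_integral_slope_cells[where K=1 and n=0] by (simp add: mesh_simps(4))
    moreover have "(\<integral>\<^sup>+x. w x \<partial>lborel) = (\<integral>\<^sup>+x\<in>{a..<a + pi}. ennreal (slope F a (mesh 0) x) \<partial>lborel) + (\<integral>\<^sup>+x. (\<Sum>n. d n x) \<partial>lborel)"
      unfolding w_def by (rule nn_integral_add) measurable
    ultimately show ?thesis by simp
  qed
  have "(\<lambda>n. \<integral>\<^sup>+x\<in>{a..<y}. ennreal (slope F a (mesh n) x) \<partial>lborel) \<longlonglongrightarrow> (\<integral>\<^sup>+x\<in>{a..<y}. ennreal (exp (log_deriv x)) \<partial>lborel)"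
  proof (rule nn_integral_dominated_convergence[OF _ _ _ _ wfin])
    show "AE x in lborel. (\<lambda>n. ennreal (slope F a (mesh n) x) * indicator {a..<y} x) \<longlonglongrightarrow> ennreal (exp (log_deriv x)) * indicator {a..<y} x"
      using AE_log_slope_tendsto
    proof (rule AE_mp, intro AE_I2 impI)
      fix x assume l: "x \<in> {a..<a + pi} \<longrightarrow> (\<lambda>n. log_slope n x) \<longlonglongrightarrow> log_deriv x"
      show "(\<lambda>n. ennreal (slope F a (mesh n) x) * indicator {a..<y} x) \<longlonglongrightarrow> ennreal (exp (log_deriv x)) * indicator {a..<y} x"
      proof (cases "x \<in> {a..<y}")
        case True
        then have "(\<lambda>n. log_slope n x) \<longlonglongrightarrow> log_deriv x" using l y by simp
        then have "(\<lambda>n. ennreal (exp (log_slope n x))) \<longlonglongrightarrow> ennreal (exp (log_deriv x))"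
          by (intro tendsto_ennrealI tendsto_exp)
        moreover have "exp (log_slope n x) = slope F a (mesh n) x" for n
          unfolding log_slope_def by (rule exp_ln) (rule slope_pos[OF F_mono mesh_simps(1)])
        ultimately show ?thesis using True by simp
      qed simp
    qed
    show "AE x in lborel. ennreal (slope F a (mesh n) x) * indicator {a..<y} x \<le> w x" for n
      by (intro AE_I2 wle)
  qed measurable
  with nn_integral_slope_tendsto[OF y(1)] show ?thesis using LIMSEQ_unique by blast
qed

text \<open>The identity on one period extends by periodicity to every translate of it, then by additivity to
all intervals that start at a translate of \<open>a\<close>, and by subtraction to all intervals.\<close>

lemma log_density_log_deriv: "log_density F log_deriv"
proof -
  define g where "g x = ennreal (exp (log_deriv x))" for x
  have [measurable]: "g \<in> borel_measurable borel" unfolding g_def by measurable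
  have gper: "g (x + pi) = g x" for x by (simp add: g_def log_deriv_periodic)
  have Fp: "F (x + of_int k * pi) = F x + of_int k * pi" for x k
    using periodic_shift_int[of "\<lambda>x. F x - x" pi x k] F_per by simp
  have Fm: "F x \<le> F y" if "x \<le> y" for x y using F_mono that by (simp add: strict_mono_less_eq)
  have one: "(\<integral>\<^sup>+x\<in>{a + of_int k * pi..<y}. g x \<partial>lborel) = ennreal (F y - F (a + of_int k * pi))"
    if y: "a + of_int k * pi \<le> y" "y \<le> a + of_int k * pi + pi" for k :: int and y
  proof -
    define t where "t = of_int k * pi"
    have "(\<integral>\<^sup>+x\<in>{a + t..<(y - t) + t}. g x \<partial>lborel) = (\<integral>\<^sup>+x\<in>{a..<y - t}. g (x + t) \<partial>lborel)"
      by (rule nn_integral_shift_Ico) measurable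
    also have "\<dots> = (\<integral>\<^sup>+x\<in>{a..<y - t}. g x \<partial>lborel)" unfolding t_def by (simp only: periodic_shift_int[of g, OF gper])
    also have "\<dots> = ennreal (F (y - t) - F a)"
      unfolding g_def by (rule nn_integral_exp_log_deriv) (use y in \<open>auto simp: t_def\<close>)
    also have "F (y - t) - F a = F y - F (a + t)" using Fp[of a k] Fp[of "y - t" k] by (simp add: t_def)
    finally show ?thesis by (simp add: t_def)
  qed
  have many: "(\<integral>\<^sup>+x\<in>{a + of_int k * pi..<y}. g x \<partial>lborel) = ennreal (F y - F (a + of_int k * pi))"
    if "a + of_int k * pi \<le> y" "y \<le> a + of_int k * pi + real n * pi" for k :: int and y n
    using that
  proof (induction n arbitrary: k)
    case 0 then show ?case using one[of k y] by simp
  next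
    case (Suc n)
    define b where "b = a + of_int k * pi"
    have b: "b + pi = a + of_int (k + 1) * pi" by (simp add: b_def algebra_simps)
    show ?case
    proof (cases "y \<le> b + pi")
      case True then show ?thesis using one[of k y] Suc.prems by (simp add: b_def)
    next
      case False
      have "(\<integral>\<^sup>+x\<in>{b..<y}. g x \<partial>lborel) = (\<integral>\<^sup>+x\<in>{b..<b + pi}. g x \<partial>lborel) + (\<integral>\<^sup>+x\<in>{b + pi..<y}. g x \<partial>lborel)"
        by (rule nn_integral_split_Ico) (use False in auto)
      also have "(\<integral>\<^sup>+x\<in>{b..<b + pi}. g x \<partial>lborel) = ennreal (F (b + pi) - F b)"
        using one[of k "b + pi"] by (simp add: b_def)
      also have "(\<integral>\<^sup>+x\<in>{b + pi..<y}. g x \<partial>lborel) = ennreal (F y - F (b + pi))"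
        unfolding b by (rule Suc.IH) (use False Suc.prems b in \<open>auto simp: b_def algebra_simps\<close>)
      also have "ennreal (F (b + pi) - F b) + ennreal (F y - F (b + pi)) = ennreal (F y - F b)"
        using Fm[of b "b + pi"] Fm[of "b + pi" y] False by (subst ennreal_plus[symmetric]) auto
      finally show ?thesis by (simp add: b_def)
    qed
  qed
  have "(\<integral>\<^sup>+t\<in>{x..<y}. g t \<partial>lborel) = ennreal (F y - F x)" if xy: "x \<le> y" for x y
  proof -
    define k where "k = \<lfloor>(x - a) / pi\<rfloor>"
    define b where "b = a + of_int k * pi"
    have b: "b \<le> x" using floor_divide_lower[of pi "x - a"] by (simp add: b_def k_def)
    obtain n :: nat where "(y - b) / pi < of_nat n" using reals_Archimedean2 by blast
    then have n: "y \<le> b + real n * pi" by (simp add: field_simps)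
    have "ennreal (F y - F b) = (\<integral>\<^sup>+t\<in>{b..<y}. g t \<partial>lborel)"
      unfolding b_def by (rule many[symmetric, of k y n]) (use b n xy in \<open>auto simp: b_def\<close>)
    also have "\<dots> = (\<integral>\<^sup>+t\<in>{b..<x}. g t \<partial>lborel) + (\<integral>\<^sup>+t\<in>{x..<y}. g t \<partial>lborel)"
      by (rule nn_integral_split_Ico) (use b xy in auto)
    also have "(\<integral>\<^sup>+t\<in>{b..<x}. g t \<partial>lborel) = ennreal (F x - F b)"
      unfolding b_def by (rule many[of k x n]) (use b n xy in \<open>auto simp: b_def\<close>)
    finally have "ennreal (F x - F b) + ennreal (F y - F x) = ennreal (F x - F b) + (\<integral>\<^sup>+t\<in>{x..<y}. g t \<partial>lborel)"
      using Fm[OF b] Fm[OF xy] by (subst ennreal_plus[symmetric]) auto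
    then show ?thesis by (simp add: ennreal_add_left_cancel)
  qed
  then show ?thesis unfolding log_density_def g_def using log_deriv_periodic by auto
qed

end

section \<open>Two dyadic grids control the energy\<close>

text \<open>Cut off to a bounded interval, both densities define finite measures that agree on all half-lines.\<close>

lemma log_density_unique:
  assumes u: "log_density F u" and v: "log_density F v"
  shows "AE x in lborel. x \<in> {p..<q} \<longrightarrow> u x = v x"
proof -
  have [measurable]: "u \<in> borel_measurable borel" "v \<in> borel_measurable borel"
    using u v by (auto simp: log_density_def)
  define d where "d w x = ennreal (exp (w x)) * indicator {p..<q} x" for w and x :: real
  have [measurable]: "d u \<in> borel_measurable lborel" "d v \<in> borel_measurable lborel"
    unfolding d_def by measurable
  have em: "emeasure (density lborel (d w)) {x<..} = ennreal (if max x p \<le> q then F q - F (max x p) else 0)"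
    if w: "log_density F w" for w x
  proof -
    have [measurable]: "w \<in> borel_measurable borel" using w by (auto simp: log_density_def)
    have [measurable]: "d w \<in> borel_measurable lborel" unfolding d_def by measurable
    have "emeasure (density lborel (d w)) {x<..} = (\<integral>\<^sup>+t\<in>{x<..}. d w t \<partial>lborel)"
      by (rule emeasure_density) auto
    also have "\<dots> = (\<integral>\<^sup>+t\<in>{max x p..<q}. ennreal (exp (w t)) \<partial>lborel)"
      by (rule nn_integral_cong_AE, rule AE_mp[OF AE_lborel_singleton[of x]], intro AE_I2 impI) (auto simp: d_def indicator_def)
    also have "\<dots> = ennreal (if max x p \<le> q then F q - F (max x p) else 0)"
      using w by (auto simp: log_density_def)
    finally show ?thesis .
  qed
  have "density lborel (d u) = density lborel (d v)"
    by (rule measure_eqI_lessThan) (simp_all only: em[OF u] em[OF v] sets_density sets_lborel infinity_ennreal_def ennreal_less_top)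
  then have "AE x in lborel. d u x = d v x"
    by (intro sigma_finite_measure.density_unique[OF sigma_finite_lborel]) auto
  then show ?thesis
    by (rule AE_mp) (auto simp: d_def intro!: AE_I2)
qed

lemma three_not_dvd_power_two: "\<not> (3::int) dvd 2 ^ n"
proof (induction n)
  case (Suc n)
  then show ?case unfolding power_Suc by presburger
qed simp

text \<open>In units of the mesh the second grid is shifted by \<open>2\<^sup>n / 3\<close>, which is at distance \<open>1/3\<close> from the
integers. If both grids separated two points less than \<open>1/3\<close> apart, there would be grid points \<open>p\<close>
and \<open>q + 2\<^sup>n / 3\<close> between them; then \<open>3 (p - q)\<close> and \<open>2\<^sup>n\<close> would be integers less than \<open>1\<close> apart,
hence equal.\<close>

lemma same_grid_cell:
  assumes t: "\<bar>t\<bar> < pi / 3 / 2 ^ n"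
  shows "grid_left 0 (pi / 2 ^ n) x = grid_left 0 (pi / 2 ^ n) (x + t) \<or>
    grid_left (pi / 3) (pi / 2 ^ n) x = grid_left (pi / 3) (pi / 2 ^ n) (x + t)"
proof -
  define h where "h = pi / 2 ^ n"
  have h: "h > 0" "pi / 3 = (2 ^ n / 3) * h" by (auto simp: h_def)
  \<comment> \<open>Between two points with different floors there is an integer.\<close>
  have ordered: "\<lfloor>X\<rfloor> = \<lfloor>Y\<rfloor> \<or> \<lfloor>X - 2 ^ n / 3\<rfloor> = \<lfloor>Y - 2 ^ n / 3\<rfloor>" if XY: "X \<le> Y" "Y - X < 1 / 3" for X Y :: real
  proof (rule ccontr)
    assume "\<not> ?thesis"
    then have ne: "\<lfloor>X\<rfloor> \<noteq> \<lfloor>Y\<rfloor>" "\<lfloor>X - 2 ^ n / 3\<rfloor> \<noteq> \<lfloor>Y - 2 ^ n / 3\<rfloor>" by auto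
    have jump: "Z < of_int \<lfloor>W\<rfloor> \<and> of_int \<lfloor>W\<rfloor> \<le> W" if "Z \<le> W" "\<lfloor>Z\<rfloor> \<noteq> \<lfloor>W\<rfloor>" for Z W :: real
    proof -
      have "\<lfloor>Z\<rfloor> < \<lfloor>W\<rfloor>" using that floor_mono[of Z W] by linarith
      then have "Z < of_int \<lfloor>W\<rfloor>" by (simp add: floor_less_iff)
      then show ?thesis by simp
    qed
    define p q where "p = \<lfloor>Y\<rfloor>" and "q = \<lfloor>Y - 2 ^ n / 3\<rfloor>"
    have "X < of_int p" "of_int p \<le> Y" using jump[of X Y] XY ne by (auto simp: p_def)
    moreover have "X - 2 ^ n / 3 < of_int q" "of_int q \<le> Y - 2 ^ n / 3"
      using jump[of "X - 2 ^ n / 3" "Y - 2 ^ n / 3"] XY ne by (auto simp: q_def)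
    moreover have "\<bar>3 * (P - Q) - 3 * s\<bar> < 1" if "X < P" "P \<le> Y" "X - s < Q" "Q \<le> Y - s" for P Q s :: real
    proof -
      have XY3: "3 * Y - 3 * X < 1" using XY(2) by simp
      have "3 * (P - Q) - 3 * s < 1" using that(2,3) XY3 by argo
      moreover have "- (3 * (P - Q) - 3 * s) < 1" using that(1,4) XY3 by argo
      ultimately show ?thesis by (rule abs_less_iff[THEN iffD2, OF conjI])
    qed
    ultimately have "\<bar>3 * (real_of_int p - real_of_int q) - 3 * (2 ^ n / 3)\<bar> < 1" by blast
    also have "3 * (real_of_int p - real_of_int q) - 3 * (2 ^ n / 3) = real_of_int (3 * (p - q) - 2 ^ n)" by simp
    finally have "\<bar>real_of_int (3 * (p - q) - 2 ^ n)\<bar> < 1" .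
    then have "\<bar>3 * (p - q) - 2 ^ n\<bar> < 1" by linarith
    then have "2 ^ n = 3 * (p - q)" by linarith
    then show False using three_not_dvd_power_two[of n] by simp
  qed
  define T where "T = t / h"
  have tt: "\<bar>T\<bar> < 1 / 3"
  proof -
    have "\<bar>T\<bar> = \<bar>t\<bar> / h" using h(1) by (simp add: T_def abs_divide)
    moreover have "\<bar>t\<bar> < 1 / 3 * h" using t by (simp add: h_def)
    ultimately show ?thesis using h(1) by (simp only: pos_divide_less_eq)
  qed
  have "\<lfloor>x / h\<rfloor> = \<lfloor>x / h + T\<rfloor> \<or> \<lfloor>x / h - 2 ^ n / 3\<rfloor> = \<lfloor>x / h + T - 2 ^ n / 3\<rfloor>"
  proof (cases "0 \<le> T")
    case True
    show ?thesis by (rule ordered) (use True tt in linarith)+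
  next
    case False
    have "\<lfloor>x / h + T\<rfloor> = \<lfloor>x / h\<rfloor> \<or> \<lfloor>x / h + T - 2 ^ n / 3\<rfloor> = \<lfloor>x / h - 2 ^ n / 3\<rfloor>"
      by (rule ordered) (use False tt in linarith)+
    then show ?thesis by (elim disjE) simp_all
  qed
  moreover have "(x - 0) / h = x / h" "(x + t - 0) / h = x / h + T"
    "(x - pi / 3) / h = x / h - 2 ^ n / 3" "(x + t - pi / 3) / h = x / h + T - 2 ^ n / 3"
    unfolding h(2) T_def using h(1) by (simp_all add: diff_divide_distrib add_divide_distrib)
  ultimately show ?thesis unfolding grid_left_def h_def[symmetric] by auto
qed

lemma nn_integral_shift_period:
  assumes [measurable]: "f \<in> borel_measurable borel" and p: "\<And>x. f (x + pi) = f x"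
  shows "(\<integral>\<^sup>+x\<in>{0..<pi}. f (x + t) \<partial>lborel) = (\<integral>\<^sup>+x\<in>{0..<pi}. f x \<partial>lborel)"
proof -
  have "(\<integral>\<^sup>+x\<in>{0..<pi}. f (x + t) \<partial>lborel) = (\<integral>\<^sup>+x\<in>{0 + t..<pi + t}. f x \<partial>lborel)"
    by (rule nn_integral_shift_Ico[symmetric]) measurable
  also have "\<dots> = (\<integral>\<^sup>+x\<in>{t..<t + pi}. f x \<partial>lborel)" by (simp add: add.commute)
  also have "\<dots> = (\<integral>\<^sup>+x\<in>{0..<pi}. f x \<partial>lborel)" by (rule nn_integral_period) (simp_all add: p)
  finally show ?thesis .
qed

text \<open>By periodicity the second variable may run over a window centred at the first one, where the
distance on the circle is \<open>\<bar>t\<bar>\<close>.\<close>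

lemma circle_energy_eq_difference_integral:
  assumes [measurable]: "u \<in> borel_measurable borel" and per: "\<And>x. u (x + pi) = u x"
  shows "circle_energy u = (\<integral>\<^sup>+t\<in>{- (pi / 2)..<pi / 2}. (\<integral>\<^sup>+x\<in>{0..<pi}. ennreal ((u x - u (x + t))\<^sup>2 / t\<^sup>2) \<partial>lborel) \<partial>lborel)"
proof -
  have inner: "(\<integral>\<^sup>+y\<in>{0..<pi}. gagliardo u x y \<partial>lborel) = (\<integral>\<^sup>+t\<in>{- (pi / 2)..<pi / 2}. ennreal ((u x - u (x + t))\<^sup>2 / t\<^sup>2) \<partial>lborel)" for x
  proof -
    have "(\<integral>\<^sup>+y\<in>{0..<pi}. gagliardo u x y \<partial>lborel) = (\<integral>\<^sup>+y\<in>{- (pi / 2) + x..<(- (pi / 2) + x) + pi}. gagliardo u x y \<partial>lborel)"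
      by (rule nn_integral_period[symmetric]) (measurable, simp add: gagliardo_def per)
    also have "(- (pi / 2) + x) + pi = pi / 2 + x" by simp
    also have "(\<integral>\<^sup>+y\<in>{- (pi / 2) + x..<pi / 2 + x}. gagliardo u x y \<partial>lborel) = (\<integral>\<^sup>+t\<in>{- (pi / 2)..<pi / 2}. gagliardo u x (t + x) \<partial>lborel)"
      by (rule nn_integral_shift_Ico) measurable
    also have "\<dots> = (\<integral>\<^sup>+t\<in>{- (pi / 2)..<pi / 2}. ennreal ((u x - u (x + t))\<^sup>2 / t\<^sup>2) \<partial>lborel)"
    proof (rule nn_integral_cong)
      fix t
      show "gagliardo u x (t + x) * indicator {- (pi / 2)..<pi / 2} t = ennreal ((u x - u (x + t))\<^sup>2 / t\<^sup>2) * indicator {- (pi / 2)..<pi / 2} t"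
      proof (cases "t \<in> {- (pi / 2)..<pi / 2}")
        case True
        then have "circle_dist x (t + x) = \<bar>x - (t + x)\<bar>" by (intro circle_dist_eq) auto
        then show ?thesis by (simp add: gagliardo_def add.commute)
      qed simp
    qed
    finally show ?thesis .
  qed
  define f where "f t x = ennreal ((u x - u (x + t))\<^sup>2 / t\<^sup>2) * indicator {- (pi / 2)..<pi / 2} t * indicator {0..<pi} x" for t x
  have [measurable]: "(\<lambda>x. ennreal ((u x - u (x + t))\<^sup>2 / t\<^sup>2)) \<in> borel_measurable lborel" for t
    by measurable
  have "circle_energy u = (\<integral>\<^sup>+x. \<integral>\<^sup>+t. f t x \<partial>lborel \<partial>lborel)"
    unfolding circle_energy_def inner f_def
    by (intro nn_integral_cong, rule nn_integral_multc[symmetric]) measurable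
  also have "\<dots> = (\<integral>\<^sup>+t. \<integral>\<^sup>+x. f t x \<partial>lborel \<partial>lborel)"
    by (rule lborel_pair.Fubini') (unfold f_def, measurable)
  also have "\<dots> = (\<integral>\<^sup>+t\<in>{- (pi / 2)..<pi / 2}. (\<integral>\<^sup>+x\<in>{0..<pi}. ennreal ((u x - u (x + t))\<^sup>2 / t\<^sup>2) \<partial>lborel) \<partial>lborel)"
  proof (rule nn_integral_cong)
    fix t
    show "(\<integral>\<^sup>+x. f t x \<partial>lborel) = (\<integral>\<^sup>+x\<in>{0..<pi}. ennreal ((u x - u (x + t))\<^sup>2 / t\<^sup>2) \<partial>lborel) * indicator {- (pi / 2)..<pi / 2} t"
      by (cases "t \<in> {- (pi / 2)..<pi / 2}") (simp_all add: f_def)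
  qed
  finally show ?thesis .
qed

lemma ennreal_square_diff_le:
  "ennreal ((x - y)\<^sup>2) \<le> 2 * (ennreal ((x - c)\<^sup>2) + ennreal ((y - c)\<^sup>2))"
proof -
  have "0 \<le> ((x - c) + (y - c))\<^sup>2" by simp
  then have "(x - y)\<^sup>2 \<le> 2 * ((x - c)\<^sup>2 + (y - c)\<^sup>2)"
    by (simp add: power2_eq_square algebra_simps)
  then have "ennreal ((x - y)\<^sup>2) \<le> ennreal (2 * ((x - c)\<^sup>2 + (y - c)\<^sup>2))" by (rule ennreal_leI)
  also have "\<dots> = 2 * (ennreal ((x - c)\<^sup>2) + ennreal ((y - c)\<^sup>2))"
    by (simp add: ennreal_mult)
  finally show ?thesis .
qed

text \<open>Let \<open>\<omega>(t)\<close> be the integral of \<open>(u(x) - u(x + t))\<^sup>2\<close>. When \<open>\<bar>t\<bar> < \<delta> n\<close>, for each \<open>x\<close> one of the two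
step functions of generation \<open>n\<close> takes the same value at \<open>x\<close> and \<open>x + t\<close> and serves as an
intermediate value, so \<open>\<omega>(t)\<close> is at most four times the sum \<open>R n\<close> of the squared errors. On the shell
\<open>\<delta> (n + 1) \<le> \<bar>t\<bar> < \<delta> n\<close> the kernel \<open>t\<^sup>-\<^sup>2\<close> has integral of order \<open>2\<^sup>n\<close>, which is the weight in the two
hypotheses; large \<open>\<bar>t\<bar>\<close> are covered by the \<open>L\<^sup>2\<close> norm.\<close>

lemma circle_energy_finite:
  fixes u :: "real \<Rightarrow> real" and l m :: "nat \<Rightarrow> real \<Rightarrow> real"
  assumes [measurable]: "u \<in> borel_measurable borel" "\<And>n. l n \<in> borel_measurable borel" "\<And>n. m n \<in> borel_measurable borel"
    and per: "\<And>x. u (x + pi) = u x" "\<And>n x. l n (x + pi) = l n x" "\<And>n x. m n (x + pi) = m n x"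
    and cell: "\<And>n x t. \<bar>t\<bar> < pi / 3 / 2 ^ n \<Longrightarrow> l n x = l n (x + t) \<or> m n x = m n (x + t)"
    and l2: "(\<integral>\<^sup>+x\<in>{0..<pi}. ennreal ((u x)\<^sup>2) \<partial>lborel) < \<infinity>"
    and l: "\<And>N. (\<Sum>n<N. ennreal (2 ^ n) * (\<integral>\<^sup>+x\<in>{0..<pi}. ennreal ((u x - l n x)\<^sup>2) \<partial>lborel)) \<le> ennreal C"
    and m: "\<And>N. (\<Sum>n<N. ennreal (2 ^ n) * (\<integral>\<^sup>+x\<in>{0..<pi}. ennreal ((u x - m n x)\<^sup>2) \<partial>lborel)) \<le> ennreal D"
  shows "circle_energy u < \<infinity>"
proof -
  define A where "A n x = ennreal ((u x - l n x)\<^sup>2)" for n x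
  define B where "B n x = ennreal ((u x - m n x)\<^sup>2)" for n x
  have ABm [measurable]: "A n \<in> borel_measurable borel" "B n \<in> borel_measurable borel" for n
    unfolding A_def B_def by measurable
  define P where "P f = (\<integral>\<^sup>+x\<in>{0..<pi}. f x \<partial>lborel)" for f :: "real \<Rightarrow> ennreal"
  define R where "R n = P (A n) + P (B n)" for n
  define Q where "Q = P (\<lambda>x. ennreal ((u x)\<^sup>2))"
  define \<omega> where "\<omega> t = P (\<lambda>x. ennreal ((u x - u (x + t))\<^sup>2))" for t
  define \<delta> where "\<delta> n = pi / 3 / 2 ^ n" for n :: nat
  have \<delta>: "0 < \<delta> n" for n by (simp add: \<delta>_def)
  have Pshift: "P (\<lambda>x. f x + f (x + t)) = 2 * P f" if [measurable]: "f \<in> borel_measurable borel" and "\<And>x. f (x + pi) = f x" for f t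
  proof -
    have "P (\<lambda>x. f x + f (x + t)) = P f + P (\<lambda>x. f (x + t))"
      unfolding P_def distrib_right by (rule nn_integral_add) measurable
    also have "P (\<lambda>x. f (x + t)) = P f" unfolding P_def by (rule nn_integral_shift_period) (use that in auto)
    finally show ?thesis by (simp add: mult_2)
  qed
  have Pm: "P f \<le> P g" if "\<And>x. f x \<le> g x" for f g
    unfolding P_def by (intro nn_integral_mono mult_right_mono that) simp
  have Pc: "P (\<lambda>x. c * f x) = c * P f" if [measurable]: "f \<in> borel_measurable borel" for c f
    unfolding P_def mult.assoc by (rule nn_integral_cmult) measurable
  have \<omega>1: "\<omega> t \<le> 4 * R n" if t: "\<bar>t\<bar> < \<delta> n" for t n
  proof -
    have "\<omega> t \<le> P (\<lambda>x. 2 * (A n x + A n (x + t)) + 2 * (B n x + B n (x + t)))"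
      unfolding \<omega>_def
    proof (rule Pm)
      fix x
      show "ennreal ((u x - u (x + t))\<^sup>2) \<le> 2 * (A n x + A n (x + t)) + 2 * (B n x + B n (x + t))"
        using cell[OF t[unfolded \<delta>_def], of x]
      proof
        assume e: "l n x = l n (x + t)"
        have "ennreal ((u x - u (x + t))\<^sup>2) \<le> 2 * (A n x + A n (x + t))"
          using ennreal_square_diff_le[of "u x" "u (x + t)" "l n x"] unfolding A_def e .
        then show ?thesis by (rule add_increasing2[rotated]) simp
      next
        assume e: "m n x = m n (x + t)"
        have "ennreal ((u x - u (x + t))\<^sup>2) \<le> 2 * (B n x + B n (x + t))"
          using ennreal_square_diff_le[of "u x" "u (x + t)" "m n x"] unfolding B_def e .
        then show ?thesis by (rule add_increasing[rotated]) simp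
      qed
    qed
    also have "\<dots> = P (\<lambda>x. 2 * (A n x + A n (x + t))) + P (\<lambda>x. 2 * (B n x + B n (x + t)))"
      unfolding P_def distrib_right[of "2 * _"] by (rule nn_integral_add) measurable
    also have "P (\<lambda>x. 2 * (A n x + A n (x + t))) = 2 * (2 * P (A n))"
      by (subst Pc, measurable, subst Pshift) (auto simp: A_def per)
    also have "P (\<lambda>x. 2 * (B n x + B n (x + t))) = 2 * (2 * P (B n))"
      by (subst Pc, measurable, subst Pshift) (auto simp: B_def per)
    finally show ?thesis by (simp add: R_def distrib_left)
  qed
  have \<omega>2: "\<omega> t \<le> 4 * Q" for t
  proof -
    have "\<omega> t \<le> P (\<lambda>x. 2 * (ennreal ((u x)\<^sup>2) + ennreal ((u (x + t))\<^sup>2)))"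
      unfolding \<omega>_def by (rule Pm) (use ennreal_square_diff_le[where c=0] in simp)
    also have "\<dots> = 2 * (2 * Q)"
      unfolding Q_def by (subst Pc, measurable, subst Pshift[of "\<lambda>x. ennreal ((u x)\<^sup>2)"]) (auto simp: per)
    finally show ?thesis by simp
  qed
  define b where "b n = ennreal (1 / (\<delta> (Suc n))\<^sup>2) * (4 * R n)" for n
  define b0 where "b0 = ennreal (9 / pi\<^sup>2) * (4 * Q)"
  have bound: "ennreal (1 / t\<^sup>2) * \<omega> t \<le> b0 + (\<Sum>n. b n * indicator {- \<delta> n<..<\<delta> n} t)" if t0: "t \<noteq> 0" for t
  proof (cases "\<bar>t\<bar> < \<delta> 0")
    case False
    then have "pi / 3 \<le> \<bar>t\<bar>" by (simp add: \<delta>_def)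
    then have "(pi / 3)\<^sup>2 \<le> \<bar>t\<bar>\<^sup>2" by (intro power_mono) auto
    then have "1 / \<bar>t\<bar>\<^sup>2 \<le> 1 / (pi / 3)\<^sup>2" using t0 by (intro divide_left_mono mult_pos_pos) auto
    then have "1 / t\<^sup>2 \<le> 9 / pi\<^sup>2" by (simp add: power_divide)
    then have "ennreal (1 / t\<^sup>2) * \<omega> t \<le> b0"
      unfolding b0_def by (intro mult_mono ennreal_leI \<omega>2) auto
    then show ?thesis by (rule add_increasing2[rotated]) simp
  next
    case True
    have "\<exists>n. \<delta> n \<le> \<bar>t\<bar>"
    proof -
      obtain n where "\<delta> 0 / \<bar>t\<bar> < 2 ^ n" using real_arch_pow[of 2 "\<delta> 0 / \<bar>t\<bar>"] by auto
      then have "\<delta> n \<le> \<bar>t\<bar>" using t0 by (simp add: \<delta>_def field_simps)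
      then show ?thesis ..
    qed
    \<comment> \<open>Generation \<open>N - 1\<close> is the finest one at which \<open>t\<close> is still below the threshold.\<close>
    define N where "N = (LEAST n. \<delta> n \<le> \<bar>t\<bar>)"
    have N: "\<delta> N \<le> \<bar>t\<bar>" unfolding N_def using \<open>\<exists>n. \<delta> n \<le> \<bar>t\<bar>\<close> by (rule LeastI_ex)
    have "N \<noteq> 0" using N True by (intro notI) simp
    then obtain n where n: "N = Suc n" using not0_implies_Suc by blast
    have tn: "\<bar>t\<bar> < \<delta> n"
    proof (rule ccontr)
      assume "\<not> ?thesis"
      then have "N \<le> n" unfolding N_def by (intro Least_le) simp
      then show False using n by simp
    qed
    have "(\<delta> (Suc n))\<^sup>2 \<le> \<bar>t\<bar>\<^sup>2" using N \<delta>[of "Suc n"] by (intro power_mono) (auto simp: n)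
    then have "1 / \<bar>t\<bar>\<^sup>2 \<le> 1 / (\<delta> (Suc n))\<^sup>2" using t0 \<delta>[of "Suc n"] by (intro divide_left_mono mult_pos_pos) auto
    then have "ennreal (1 / t\<^sup>2) * \<omega> t \<le> b n"
      unfolding b_def by (intro mult_mono ennreal_leI \<omega>1[OF tn]) auto
    also have "b n = (\<Sum>i\<in>{n}. b i * indicator {- \<delta> i<..<\<delta> i} t)" using tn by (auto simp: abs_less_iff)
    also have "\<dots> \<le> (\<Sum>i. b i * indicator {- \<delta> i<..<\<delta> i} t)" by (rule sum_le_suminf[OF summableI]) auto
    finally show ?thesis by (rule add_increasing[rotated]) simp
  qed
  have shell: "b n * ennreal (2 * \<delta> n) = ennreal (96 / pi) * (ennreal (2 ^ n) * R n)" for n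
  proof -
    have e: "1 / (\<delta> (Suc n))\<^sup>2 * (4 * (2 * \<delta> n)) = 96 / pi * 2 ^ n"
      by (simp add: \<delta>_def power2_eq_square field_simps)
    have "b n * ennreal (2 * \<delta> n) = (ennreal (1 / (\<delta> (Suc n))\<^sup>2) * (ennreal 4 * ennreal (2 * \<delta> n))) * R n"
      by (simp add: b_def mult_ac)
    also have "ennreal (1 / (\<delta> (Suc n))\<^sup>2) * (ennreal 4 * ennreal (2 * \<delta> n)) = ennreal (96 / pi * 2 ^ n)"
    proof -
      have "0 \<le> 1 / (\<delta> (Suc n))\<^sup>2" "0 \<le> (4::real)" "0 \<le> 2 * \<delta> n" "0 \<le> 4 * (2 * \<delta> n)"
        using \<delta>[of n] by simp_all
      then show ?thesis unfolding e[symmetric] by (simp only: ennreal_mult)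
    qed
    also have "\<dots> = ennreal (96 / pi) * ennreal (2 ^ n)" by (rule ennreal_mult) auto
    finally show ?thesis by (simp only: mult.assoc)
  qed
  have Rsum: "(\<Sum>n. ennreal (2 ^ n) * R n) \<le> ennreal C + ennreal D"
  proof (rule suminf_le_const[OF summableI])
    fix N
    show "(\<Sum>n<N. ennreal (2 ^ n) * R n) \<le> ennreal C + ennreal D"
      unfolding R_def distrib_left sum.distrib P_def A_def B_def by (intro add_mono l m)
  qed
  have "circle_energy u = (\<integral>\<^sup>+t\<in>{- (pi / 2)..<pi / 2}. (ennreal (1 / t\<^sup>2) * \<omega> t) \<partial>lborel)"
  proof -
    have "(\<integral>\<^sup>+x\<in>{0..<pi}. ennreal ((u x - u (x + t))\<^sup>2 / t\<^sup>2) \<partial>lborel) = ennreal (1 / t\<^sup>2) * \<omega> t" for t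
    proof -
      have "ennreal ((u x - u (x + t))\<^sup>2 / t\<^sup>2) = ennreal (1 / t\<^sup>2) * ennreal ((u x - u (x + t))\<^sup>2)" for x
        using ennreal_mult[of "1 / t\<^sup>2" "(u x - u (x + t))\<^sup>2"] by simp
      then show ?thesis unfolding \<omega>_def by (simp only:) (subst Pc[symmetric], measurable, simp only: P_def)
    qed
    then show ?thesis by (simp only: circle_energy_eq_difference_integral[OF assms(1) per(1)])
  qed
  also have "\<dots> \<le> (\<integral>\<^sup>+t. b0 * indicator {- (pi / 2)..<pi / 2} t + (\<Sum>n. b n * indicator {- \<delta> n<..<\<delta> n} t) \<partial>lborel)"
  proof (rule nn_integral_mono_AE, rule AE_mp[OF AE_lborel_singleton[of 0]], intro AE_I2 impI)
    fix t :: real assume "t \<noteq> 0"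
    from bound[OF this] show "ennreal (1 / t\<^sup>2) * \<omega> t * indicator {- (pi / 2)..<pi / 2} t
      \<le> b0 * indicator {- (pi / 2)..<pi / 2} t + (\<Sum>n. b n * indicator {- \<delta> n<..<\<delta> n} t)"
      by (cases "t \<in> {- (pi / 2)..<pi / 2}") auto
  qed
  also have "\<dots> = (\<integral>\<^sup>+t. b0 * indicator {- (pi / 2)..<pi / 2} t \<partial>lborel) + (\<integral>\<^sup>+t. (\<Sum>n. b n * indicator {- \<delta> n<..<\<delta> n} t) \<partial>lborel)"
    by (rule nn_integral_add) measurable
  also have "(\<integral>\<^sup>+t. (\<Sum>n. b n * indicator {- \<delta> n<..<\<delta> n} t) \<partial>lborel) = (\<Sum>n. \<integral>\<^sup>+t. b n * indicator {- \<delta> n<..<\<delta> n} t \<partial>lborel)"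
    by (rule nn_integral_suminf) measurable
  also have "(\<lambda>n. \<integral>\<^sup>+t. b n * indicator {- \<delta> n<..<\<delta> n} t \<partial>lborel) = (\<lambda>n. ennreal (96 / pi) * (ennreal (2 ^ n) * R n))"
  proof
    fix n
    have "(\<integral>\<^sup>+t. b n * indicator {- \<delta> n<..<\<delta> n} t \<partial>lborel) = b n * ennreal (2 * \<delta> n)"
      using \<delta>[of n] by (simp add: nn_integral_cmult_indicator)
    then show "(\<integral>\<^sup>+t. b n * indicator {- \<delta> n<..<\<delta> n} t \<partial>lborel) = ennreal (96 / pi) * (ennreal (2 ^ n) * R n)"
      by (simp only: shell)
  qed
  also have "(\<Sum>n. ennreal (96 / pi) * (ennreal (2 ^ n) * R n)) = ennreal (96 / pi) * (\<Sum>n. ennreal (2 ^ n) * R n)"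
    by (rule ennreal_suminf_cmult)
  also have "(\<integral>\<^sup>+t. b0 * indicator {- (pi / 2)..<pi / 2} t \<partial>lborel) = b0 * ennreal pi"
    by (simp add: nn_integral_cmult_indicator)
  finally have "circle_energy u \<le> b0 * ennreal pi + ennreal (96 / pi) * (\<Sum>n. ennreal (2 ^ n) * R n)" .
  also have "\<dots> \<le> b0 * ennreal pi + ennreal (96 / pi) * (ennreal C + ennreal D)"
    by (intro add_left_mono mult_left_mono Rsum) simp
  also have "\<dots> < \<infinity>"
    using l2 unfolding b0_def Q_def P_def infinity_ennreal_def
    by (simp only: ennreal_add_less_top ennreal_mult_less_top ennreal_less_top ennreal_numeral_less_top simp_thms)
  finally show ?thesis .
qed

lemma (in dyadic_increments) skew_sq_le_beta:
  assumes lam: "1 \<le> lam"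
  shows "(skew n k)\<^sup>2 \<le> (8 * lam)\<^sup>2 * (beta_lift F (dilate lam (dyadic_interval a pi n k)))\<^sup>2"
proof -
  define p q where "p = a + real k * mesh n" and "q = a + real (k + 1) * mesh n"
  have I: "dyadic_interval a pi n k = (p, q)" by (simp add: dyadic_interval_def p_def q_def mesh_def)
  have pq: "p < q" using mesh_simps(1)[of n] by (simp add: p_def q_def)
  have mid: "(p + q) / 2 = a + real (2 * k + 1) * mesh (Suc n)" "p = a + real (2 * k) * mesh (Suc n)" "q = a + real (2 * k + 1 + 1) * mesh (Suc n)"
    by (simp_all add: p_def q_def mesh_simps(2) field_simps)
  have d1: "inc (Suc n) (2 * k) = F ((p + q) / 2) - F p" "inc (Suc n) (2 * k + 1) = F q - F ((p + q) / 2)"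
    unfolding inc_def mid(1) unfolding mid(2,3) by simp_all
  have d2: "inc n k = F q - F p" by (simp only: inc_def p_def q_def)
  have "\<bar>skew n k\<bar> = \<bar>F p - 2 * F ((p + q) / 2) + F q\<bar> / (F q - F p)"
    unfolding skew_def d1 d2 using inc_pos[of n k] unfolding d2 by (simp add: abs_divide abs_minus_commute algebra_simps)
  also have "\<dots> \<le> 8 * lam * beta_lift F (dilate lam (p, q))"
    by (rule bisection_defect_le_beta[OF pq F_cont F_mono lam])
  finally have "\<bar>skew n k\<bar>\<^sup>2 \<le> (8 * lam * beta_lift F (dilate lam (p, q)))\<^sup>2" by (intro power_mono) auto
  then show ?thesis unfolding I by (simp add: power_mult_distrib)
qed

lemma (in dyadic_increments) summable_skewI:
  assumes lam: "1 \<le> lam"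
    and s: "(\<lambda>I. (beta_lift F (dilate lam I))\<^sup>2) summable_on dyadic_decomposition a"
  shows "summable_skew F a"
proof
  have sb: "summable (\<lambda>n. \<Sum>k<2 ^ n. (beta_lift F (dilate lam (dyadic_interval a pi n k)))\<^sup>2)"
    using s by (subst (asm) summable_on_dyadic_decomposition) auto
  show "summable (\<lambda>n. \<Sum>k<2 ^ n. (skew n k)\<^sup>2)"
  proof (rule summable_comparison_test')
    show "summable (\<lambda>n. (8 * lam)\<^sup>2 * (\<Sum>k<2 ^ n. (beta_lift F (dilate lam (dyadic_interval a pi n k)))\<^sup>2))"
      by (rule summable_mult[OF sb])
    fix n :: nat assume "n \<ge> 0"
    have "(\<Sum>k<2 ^ n. (skew n k)\<^sup>2) \<le> (\<Sum>k<2 ^ n. (8 * lam)\<^sup>2 * (beta_lift F (dilate lam (dyadic_interval a pi n k)))\<^sup>2)"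
      by (intro sum_mono skew_sq_le_beta lam)
    also have "\<dots> = (8 * lam)\<^sup>2 * (\<Sum>k<2 ^ n. (beta_lift F (dilate lam (dyadic_interval a pi n k)))\<^sup>2)"
      by (simp only: sum_distrib_left)
    finally show "norm (\<Sum>k<2 ^ n. (skew n k)\<^sup>2) \<le> (8 * lam)\<^sup>2 * (\<Sum>k<2 ^ n. (beta_lift F (dilate lam (dyadic_interval a pi n k)))\<^sup>2)"
      by (simp add: sum_nonneg)
  qed
qed

text \<open>The two base points \<open>0\<close> and \<open>\<pi>/3\<close> give limits that are densities of the same \<open>F\<close>, so they agree
almost everywhere and one function is approximated along both grids.\<close>

lemma summable_beta_imp_log_density:
  assumes F: "strict_mono F" "continuous_on UNIV F" "\<And>x. F (x + pi) = F x + pi" and lam: "1 \<le> lam"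
    and s: "\<And>x0. (\<lambda>I. (beta_lift F (dilate lam I))\<^sup>2) summable_on dyadic_decomposition x0"
  shows "\<exists>U. log_density F U \<and> (\<integral>\<^sup>+x\<in>{0..<pi}. ennreal ((U x)\<^sup>2) \<partial>lborel) < \<infinity> \<and> circle_energy U < \<infinity>"
proof -
  have di: "dyadic_increments F" by (rule dyadic_increments.intro) (use F in auto)
  interpret g: summable_skew F 0 by (rule dyadic_increments.summable_skewI[OF di lam s])
  interpret t: summable_skew F "pi / 3" by (rule dyadic_increments.summable_skewI[OF di lam s])
  define u where "u = g.log_deriv"
  have [measurable]: "u \<in> borel_measurable borel" unfolding u_def by (rule g.log_deriv_measurable)
  have u: "log_density F u" unfolding u_def by (rule g.log_density_log_deriv)
  have l: "(\<Sum>n<N. ennreal (2 ^ n) * (\<integral>\<^sup>+x\<in>{0..<pi}. ennreal ((u x - g.log_slope n x)\<^sup>2) \<partial>lborel)) \<le> ennreal (6 * pi * suminf g.log_skew_energy)" for N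
    unfolding u_def by (rule g.log_slope_approx)
  have "AE x in lborel. x \<in> {0..<pi} \<longrightarrow> u x = t.log_deriv x"
    by (rule log_density_unique[OF u t.log_density_log_deriv])
  then have "(\<integral>\<^sup>+x\<in>{0..<pi}. ennreal ((u x - t.log_slope n x)\<^sup>2) \<partial>lborel) = (\<integral>\<^sup>+x\<in>{0..<pi}. ennreal ((t.log_deriv x - t.log_slope n x)\<^sup>2) \<partial>lborel)" for n
    by (intro nn_integral_cong_AE, elim AE_mp, intro AE_I2) (auto simp: indicator_def)
  then have m: "(\<Sum>n<N. ennreal (2 ^ n) * (\<integral>\<^sup>+x\<in>{0..<pi}. ennreal ((u x - t.log_slope n x)\<^sup>2) \<partial>lborel)) \<le> ennreal (6 * pi * suminf t.log_skew_energy)" for N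
    using t.log_slope_approx[of N] by simp
  have l2: "(\<integral>\<^sup>+x\<in>{0..<pi}. ennreal ((u x)\<^sup>2) \<partial>lborel) < \<infinity>"
  proof -
    define c where "c = g.log_slope 0 0"
    have c: "g.log_slope 0 x = c" if "x \<in> {0..<pi}" for x
    proof -
      have "grid_left 0 pi x = 0 + real 0 * pi" "grid_left 0 pi 0 = 0 + real 0 * pi"
        by (rule grid_left_cell; use that in simp)+
      then show ?thesis unfolding c_def g.log_slope_def g.mesh_simps(4) by (simp add: slope_def)
    qed
    have "(\<integral>\<^sup>+x\<in>{0..<pi}. ennreal ((u x)\<^sup>2) \<partial>lborel)
      \<le> (\<integral>\<^sup>+x. 2 * (ennreal ((u x - g.log_slope 0 x)\<^sup>2) * indicator {0..<pi} x) + 2 * ennreal (c\<^sup>2) * indicator {0..<pi} x \<partial>lborel)"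
    proof (rule nn_integral_mono)
      fix x
      show "ennreal ((u x)\<^sup>2) * indicator {0..<pi} x \<le> 2 * (ennreal ((u x - g.log_slope 0 x)\<^sup>2) * indicator {0..<pi} x) + 2 * ennreal (c\<^sup>2) * indicator {0..<pi} x"
        using ennreal_square_diff_le[of "u x" 0 c] c[of x]
        by (cases "x \<in> {0..<pi}") (simp_all add: distrib_left)
    qed
    also have "\<dots> = 2 * (\<integral>\<^sup>+x\<in>{0..<pi}. ennreal ((u x - g.log_slope 0 x)\<^sup>2) \<partial>lborel) + 2 * ennreal (c\<^sup>2) * ennreal pi"
      by (simp add: nn_integral_add nn_integral_cmult nn_integral_cmult_indicator)
    also have "\<dots> < \<infinity>"
    proof -
      have "(\<integral>\<^sup>+x\<in>{0..<pi}. ennreal ((u x - g.log_slope 0 x)\<^sup>2) \<partial>lborel) \<le> ennreal (6 * pi * suminf g.log_skew_energy)"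
        using l[of 1] by simp
      then have "(\<integral>\<^sup>+x\<in>{0..<pi}. ennreal ((u x - g.log_slope 0 x)\<^sup>2) \<partial>lborel) < top" by (rule le_less_trans) simp
      then show ?thesis unfolding infinity_ennreal_def
        by (simp only: ennreal_add_less_top ennreal_mult_less_top ennreal_less_top ennreal_numeral_less_top simp_thms)
    qed
    finally show ?thesis .
  qed
  have "circle_energy u < \<infinity>"
  proof (rule circle_energy_finite[OF _ _ _ _ _ _ _ l2 l m])
    show "u (x + pi) = u x" for x unfolding u_def by (rule g.log_deriv_periodic)
    show "g.log_slope n x = g.log_slope n (x + t) \<or> t.log_slope n x = t.log_slope n (x + t)" if "\<bar>t\<bar> < pi / 3 / 2 ^ n" for n x t
      using same_grid_cell[OF that, of x] unfolding g.log_slope_def t.log_slope_def g.mesh_def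
      by (auto intro: slope_cong arg_cong[where f=ln])
  qed (auto simp: g.log_slope_periodic t.log_slope_periodic)
  with u l2 show ?thesis by blast
qed

section \<open>The equivalence\<close>

theorem theorem3p2p1:
  fixes lam :: real and \<phi> :: "rp1 \<Rightarrow> rp1"
  assumes "lam \<ge> 1" and "orientation_preserving_homeo \<phi>"
  shows "weil_petersson \<phi> \<longleftrightarrow>
    (\<forall>x0. (\<lambda>I. (beta \<phi> (dilate lam I))\<^sup>2) summable_on dyadic_decomposition x0)"
proof -
  define F where "F = the_lift \<phi>"
  obtain F' where "is_lift \<phi> F'" using assms(2) unfolding orientation_preserving_homeo_def by blast
  then have "is_lift \<phi> F" unfolding F_def the_lift_def by (rule someI[of "is_lift \<phi>"])
  then have F: "strict_mono F" "continuous_on UNIV F" "\<And>x. F (x + pi) = F x + pi"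
    by (auto simp: is_lift_def homeomorphism_def)
  have beta: "beta \<phi> = beta_lift F" by (simp add: beta_def F_def)
  show ?thesis
    unfolding weil_petersson_iff[OF assms(2)] beta F_def[symmetric]
    using weil_petersson_imp_summable_beta[OF F(2,1) _ _ _ assms(1)]
      summable_beta_imp_log_density[OF F assms(1)] by blast
qed

end
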